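(* For each $k\geq 1$ let $\xi^{(k)}=(\xi^{(k)}_1,\xi^{(k)}_2,\dots)\in\mathcal{SP}_{n_k}$, where $(n_k)$ is a sequence of positive integers tending to infinity. Assume that the rescaled profiles converge pointwise on $\mathbb{R}_+=[0,\infty)$ to some limit \[\Omega_1:=\lim_{k\to\infty}\omega_{\frac{1}{\sqrt{2n_k}}\xi^{(k)}},\] and put $\Lambda=\{(x,y): 0\leq y\leq x \text{ and } x+y<\Omega_1(x-y)\}$. Assume moreover that the sequence $(\xi^{(k)})$ is $C$-balanced for some constant $C>0$, i.e. $\xi^{(k)}_1<C\sqrt{n_k}$ for all $k\geq 1$. Then there exists a function $F\colon\Lambda\to[0,1]$ with the following property. For $0<\alpha<1$ define the level curve $\Omega_\alpha\colon\mathbb{R}_+\to\mathbb{R}_+$ by \[\Omega_\alpha(z)=\sup\{x+y : (x,y)\in\Lambda,\ x-y=z,\ F(x,y)\leq\alpha\}\] for $z\geq 0$, with the convention that $\Omega_\alpha(z)=|z|$ if the supremum is over the empty set. Let $T^{(k)}$ be a uniformly random element of $\mathcal{T}_{\xi^{(k)}}$. Then for each $0<\alpha<1$ and each $\epsilon>0$, \[\lim_{k\to\infty}\mathbb{P}\Big\{\sup_{x\geq 0}\Big|\omega_{\frac{1}{\sqrt{2n_k}}T^{(k)}_{\leq\alpha n_k}}(x)-\Omega_\alpha(x)\Big|>\epsilon\Big\}=0.\]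
   Context: A strict partition of $n$ is a sequence of integers $\xi_1>\xi_2>\dots>\xi_\ell>0$ with $\xi_1+\dots+\xi_\ell=n$ (padded by zeros); $\mathcal{SP}_n$ denotes the set of strict partitions of $n$. The shifted Young diagram of $\xi$ is the set of boxes $\{(x,y)\in\mathbb{N}^2: 1\leq y<x\leq y+\xi_y\}$, the box $(x,y)$ being the unit square $[x-1,x]\times[y-1,y]$ in the plane. Introduce coordinates $z=x-y-\tfrac12$, $t=x+y-\tfrac12$. The profile $\omega_\xi\colon\mathbb{R}\to\mathbb{R}_+$ is defined for $z\geq0$ by $\omega_\xi(z)=\max\big(|z|,\sup\{t:(z,t)\text{ lies in the union of the boxes of }\xi\}\big)$ (the supremum of the empty set being $-\infty$), and extended by $\omega_\xi(-z)=\omega_\xi(z)$. For $r>0$ the profile of the dilated diagram is defined by $\omega_{r\xi}(z)=r\,\omega_\xi(z/r)$. A shifted standard tableau of shape $\xi\in\mathcal{SP}_n$ is a filling of the boxes of the shifted Young diagram of $\xi$ by $1,\dots,n$, each used once, increasing along rows and columns; $\mathcal{T}_\xi$ is the set of such tableaux. For a tableau $T$ and a real $s$, $T_{\leq s}$ denotes the strict partition whose shifted Young diagram consists of the boxes of $T$ with entries $\leq s$. *)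

theory Defs
  imports "HOL-Probability.Probability"
begin

definition strict_partitions :: "nat \<Rightarrow> nat list set" where
  "strict_partitions n = {xs. sorted_wrt (>) xs \<and> (\<forall>p\<in>set xs. p > 0) \<and> sum_list xs = n}"

text \<open>Parts are numbered from 1, and the sequence of parts is padded by zeros.\<close>

definition nth_part :: "nat list \<Rightarrow> nat \<Rightarrow> nat" where
  "nth_part xs i = (if 1 \<le> i \<and> i \<le> length xs then xs ! (i - 1) else 0)"

definition shifted_diagram :: "nat list \<Rightarrow> (nat \<times> nat) set" where
  "shifted_diagram xs = {(x, y). 1 \<le> y \<and> y < x \<and> x \<le> y + nth_part xs y}"

definition shifted_region :: "nat list \<Rightarrow> (real \<times> real) set" where
  "shifted_region xs =
     (\<Union>(x, y)\<in>shifted_diagram xs. {real x - 1..real x} \<times> {real y - 1..real y})"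

text \<open>
  The heights \<open>t = x + y - 1/2\<close> of the points of the region that lie on the vertical line
  of abscissa \<open>z = x - y - 1/2\<close>.
\<close>

definition profile_heights :: "nat list \<Rightarrow> real \<Rightarrow> real set" where
  "profile_heights xs z =
     {x + y - 1/2 | x y. (x, y) \<in> shifted_region xs \<and> x - y - 1/2 = z}"

text \<open>
  The defining formula is only meant for nonnegative arguments; \<open>\<bar>z\<bar>\<close> gives the even extension.
  The first branch is the convention that the supremum of the empty set is \<open>-\<infinity>\<close>.
\<close>

definition profile :: "nat list \<Rightarrow> real \<Rightarrow> real" where
  "profile xs z =
     (if profile_heights xs \<bar>z\<bar> = {} then \<bar>z\<bar> else max \<bar>z\<bar> (Sup (profile_heights xs \<bar>z\<bar>)))"

definition dilated_profile :: "real \<Rightarrow> nat list \<Rightarrow> real \<Rightarrow> real" where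
  "dilated_profile r xs z = r * profile xs (z / r)"

text \<open>Box \<open>(x, y)\<close> lies in row \<open>y\<close> and column \<open>x\<close>. Fillings are extensional, so that
  distinct elements of the set are distinct tableaux.\<close>

definition shifted_tableaux :: "nat list \<Rightarrow> (nat \<times> nat \<Rightarrow> nat) set" where
  "shifted_tableaux xs =
     {T \<in> extensional (shifted_diagram xs).
        bij_betw T (shifted_diagram xs) {1..sum_list xs} \<and>
        (\<forall>x x' y. (x, y) \<in> shifted_diagram xs \<and> (x', y) \<in> shifted_diagram xs \<and> x < x'
           \<longrightarrow> T (x, y) < T (x', y)) \<and>
        (\<forall>x y y'. (x, y) \<in> shifted_diagram xs \<and> (x, y') \<in> shifted_diagram xs \<and> y < y'
           \<longrightarrow> T (x, y) < T (x, y'))}"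

definition tableau_le :: "nat list \<Rightarrow> (nat \<times> nat \<Rightarrow> nat) \<Rightarrow> real \<Rightarrow> nat list" where
  "tableau_le xs T s =
     (THE ys. (\<exists>m. ys \<in> strict_partitions m) \<and>
        shifted_diagram ys = {b \<in> shifted_diagram xs. real (T b) \<le> s})"

lemma shifted_diagram_inj:
  assumes "xs \<in> strict_partitions m" "ys \<in> strict_partitions m'"
    and eq: "shifted_diagram xs = shifted_diagram ys"
  shows "xs = ys"
proof -
  have row: "{x. (x, y) \<in> shifted_diagram zs} = {y<..y + nth_part zs y}" if "y \<ge> 1" for y zs
    using that by (auto simp: shifted_diagram_def)
  have p: "nth_part xs y = nth_part ys y" if "y \<ge> 1" for y
  proof -
    have "card {y<..y + nth_part xs y} = card {y<..y + nth_part ys y}"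
      using row[OF that] eq by metis
    then show ?thesis by simp
  qed
  have pos: "nth_part zs (Suc i) > 0 \<longleftrightarrow> i < length zs"
    if "zs \<in> strict_partitions q" for zs i q
    using that by (auto simp: strict_partitions_def nth_part_def)
  have len: "i < length xs \<longleftrightarrow> i < length ys" for i
    using pos[OF assms(1), of i] pos[OF assms(2), of i] p[of "Suc i"] by simp
  have l: "length xs = length ys"
    using len[of "length xs"] len[of "length ys"] by simp
  show ?thesis
  proof (rule nth_equalityI[OF l])
    fix i assume "i < length xs"
    then show "xs ! i = ys ! i" using p[of "Suc i"] l by (simp add: nth_part_def)
  qed
qed

text \<open>The description in the definition of \<open>tableau_le\<close> determines a unique strict partition.\<close>

lemma tableau_le_ex1:
  assumes xs: "xs \<in> strict_partitions n" and T: "T \<in> shifted_tableaux xs"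
  shows "\<exists>!ys. (\<exists>m. ys \<in> strict_partitions m) \<and>
           shifted_diagram ys = {b \<in> shifted_diagram xs. real (T b) \<le> s}"
proof -
  define S where "S = {b \<in> shifted_diagram xs. real (T b) \<le> s}"
  define r where "r y = card {x. (x, y) \<in> S}" for y
  have fin: "finite {x. (x, y) \<in> S}" for y
    by (rule finite_subset[of _ "{..y + nth_part xs y}"]) (auto simp: S_def shifted_diagram_def)
  have left: "(x', y) \<in> S" if "(x, y) \<in> S" "y < x'" "x' \<le> x" for x x' y
  proof (cases "x' = x")
    case False
    have d: "(x', y) \<in> shifted_diagram xs"
      using that by (auto simp: S_def shifted_diagram_def)
    then have "T (x', y) < T (x, y)"
      using T that False by (auto simp: shifted_tableaux_def S_def)
    then show ?thesis using that d by (auto simp: S_def)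
  qed (use that in simp)
  have row: "{x. (x, y) \<in> S} = {y<..y + r y}" for y
  proof (cases "{x. (x, y) \<in> S} = {}")
    case True
    then show ?thesis by (simp add: r_def)
  next
    case False
    define M where "M = Max {x. (x, y) \<in> S}"
    have M: "(M, y) \<in> S" "\<And>x. (x, y) \<in> S \<Longrightarrow> x \<le> M"
      using Max_in[OF fin False] Max_ge[OF fin] by (auto simp: M_def)
    have gt: "y < x" if "(x, y) \<in> S" for x
      using that by (auto simp: S_def shifted_diagram_def)
    have e: "{x. (x, y) \<in> S} = {y<..M}"
    proof (rule set_eqI)
      fix x
      show "x \<in> {x. (x, y) \<in> S} \<longleftrightarrow> x \<in> {y<..M}"
        using M(2)[of x] gt[of x] left[OF M(1), of x] by auto
    qed
    then have "r y = M - y" by (simp add: r_def)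
    with e gt[OF M(1)] show ?thesis by simp
  qed
  have mem: "(x, y) \<in> S \<longleftrightarrow> y < x \<and> x \<le> y + r y" for x y
    using row[of y] by (metis greaterThanAtMost_iff mem_Collect_eq)
  have r0: "r 0 = 0"
    using mem[of 1 0] by (auto simp: S_def shifted_diagram_def)
  have rx: "r y \<le> nth_part xs y" for y
    using mem[of "y + r y" y] by (cases "r y = 0") (auto simp: S_def shifted_diagram_def)
  have sx: "nth_part xs (Suc y) < nth_part xs y" if "nth_part xs (Suc y) > 0" "y \<ge> 1" for y
    using that xs sorted_wrt_nth_less[of "(>)" xs "y - 1" y]
    by (auto simp: strict_partitions_def nth_part_def split: if_splits)
  have dec: "r (Suc y) < r y" if "r (Suc y) > 0" "y \<ge> 1" for y
  proof -
    let ?x = "Suc y + r (Suc y)"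
    have a: "(?x, Suc y) \<in> S" using that mem by simp
    have "nth_part xs (Suc y) < nth_part xs y" using sx rx[of "Suc y"] that by simp
    then have d: "(?x, y) \<in> shifted_diagram xs"
      using rx[of "Suc y"] that by (auto simp: shifted_diagram_def)
    have "T (?x, y) < T (?x, Suc y)"
      using T a d by (auto simp: shifted_tableaux_def S_def)
    then have "(?x, y) \<in> S" using a d by (auto simp: S_def)
    then show ?thesis using mem by simp
  qed
  have ex: "r (Suc (length xs)) = 0"
    using rx[of "Suc (length xs)"] by (simp add: nth_part_def)
  define L where "L = (LEAST y. r (Suc y) = 0)"
  have L0: "r (Suc L) = 0" unfolding L_def using ex by (rule LeastI)
  have Lpos: "r (Suc y) > 0" if "y < L" for y
    using that not_less_Least[of y "\<lambda>y. r (Suc y) = 0"] by (auto simp: L_def)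
  have Lz: "r (Suc (L + j)) = 0" for j
  proof (induction j)
    case (Suc j)
    then show ?case using dec[of "Suc (L + j)"] by auto
  qed (use L0 in simp)
  define ys where "ys = map (\<lambda>i. r (Suc i)) [0..<L]"
  have ltL: "r (Suc j) < r (Suc i)" if "i < j" "j < L" for i j
    using that
  proof (induction j)
    case (Suc j)
    have "r (Suc (Suc j)) < r (Suc j)" using dec[of "Suc j"] Lpos[of "Suc j"] Suc by simp
    then show ?case using Suc by (cases "i = j") auto
  qed simp
  have ys: "ys \<in> strict_partitions (sum_list ys)"
    using Lpos ltL by (auto simp: strict_partitions_def ys_def sorted_wrt_iff_nth_less)
  have py: "nth_part ys y = r y" if "y \<ge> 1" for y
  proof (cases "y \<le> L")
    case False
    then have "r y = 0" using Lz[of "y - Suc L"] by simp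
    then show ?thesis using False by (simp add: nth_part_def ys_def)
  next
    case True
    then obtain j where "y = Suc j" "j < L" using \<open>y \<ge> 1\<close> by (cases y) auto
    then show ?thesis by (simp add: nth_part_def ys_def)
  qed
  have "shifted_diagram ys = S"
  proof (rule set_eqI)
    fix b :: "nat \<times> nat"
    obtain x y where b: "b = (x, y)" by (cases b)
    show "b \<in> shifted_diagram ys \<longleftrightarrow> b \<in> S"
      using py[of y] mem[of x y] r0 by (cases "y = 0") (auto simp: b shifted_diagram_def)
  qed
  with ys show ?thesis
    unfolding S_def by (intro ex1I[of _ ys]) (auto intro: shifted_diagram_inj)
qed

definition limit_region :: "(real \<Rightarrow> real) \<Rightarrow> (real \<times> real) set" where
  "limit_region \<Omega> = {(x, y). 0 \<le> y \<and> y \<le> x \<and> x + y < \<Omega> (x - y)}"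

definition level_heights ::
    "(real \<times> real) set \<Rightarrow> (real \<times> real \<Rightarrow> real) \<Rightarrow> real \<Rightarrow> real \<Rightarrow> real set" where
  "level_heights \<Lambda> F \<alpha> z = {x + y | x y. (x, y) \<in> \<Lambda> \<and> x - y = z \<and> F (x, y) \<le> \<alpha>}"

definition level_curve ::
    "(real \<times> real) set \<Rightarrow> (real \<times> real \<Rightarrow> real) \<Rightarrow> real \<Rightarrow> real \<Rightarrow> real" where
  "level_curve \<Lambda> F \<alpha> z =
     (if level_heights \<Lambda> F \<alpha> z = {} then \<bar>z\<bar> else Sup (level_heights \<Lambda> F \<alpha> z))"

end

theory Submission
  imports Defs
begin

text \<open>
  Attach to a strict partition with parts \<open>p\<close> the series
  \<open>\<Phi>(u) = \<Prod>p. (1 - u p(p+1)/\<nu>) / (1 - u p(p-1)/\<nu>)\<close>, where \<open>\<nu>\<close> is twice the size of the full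
  shape. By the product formula for the number of shifted tableaux, the
  residues of \<open>\<Phi>\<close> are, up to a factor, the probabilities with which the largest entry of a uniformly
  random tableau occupies the various corners. Hence the moments of the removed box are coefficients of
  \<open>\<Phi>\<close>, and by Lagrange inversion the coefficient of \<open>u^k\<close> in \<open>\<Phi>^(2k-1)\<close> is, up to an error of order
  \<open>1/n\<^sup>2\<close> per step, multiplied on average by \<open>1 - (2k-1)/m\<close> when a box is removed from a shape with
  \<open>m\<close> boxes. A second moment estimate then shows that after passing from \<open>n\<close> to \<open>\<alpha> n\<close> boxes this
  coefficient concentrates around \<open>\<alpha>^(2k-1)\<close> times its initial value. These coefficients determine the
  moments of the diagonal lengths, hence the profile.
\<close>

section \<open>Linear extensions of sets of boxes\<close>

text \<open>The limit curve is never computed. Deleting a box of weight w divides the series by 1 -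
  e / \<nu>, where e has the coefficients (4 i - 2) w^(i-1), and the mean of w^(i-1) is a multiple
  of the i-th coefficient of the series f. The mean change of f^a therefore involves 2 u f' f^a -
  f^(a+1) + f^a, which is nonlinear and does not close. Only at order k with a + 1 = 2 k do the
  first two terms cancel, and each such coefficient then evolves by itself. Its drift pulls
  deviations back to 0, so only the errors of single steps add up. \<nu> stays fixed while boxes
  disappear, so that all intermediate shapes share one unit of length, sqrt \<nu>. The weights c (c
  + 1) / \<nu> tend to z^2, which is injective for z \<ge> 0; this is why their moments see the
  heights. Heights are Lipschitz in z, which upgrades convergence of integrals to pointwise and then
  uniform convergence. F records the first time at which the limit height passes a point. Its level
  curves are the limit curves because heights have a square-root modulus of continuity in
  time.\<close>

definition linear_extensions :: "(nat \<times> nat) set \<Rightarrow> (nat \<times> nat \<Rightarrow> nat) set" where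
  "linear_extensions D =
     {T \<in> extensional D. bij_betw T D {1..card D} \<and>
        (\<forall>x x' y. (x, y) \<in> D \<and> (x', y) \<in> D \<and> x < x' \<longrightarrow> T (x, y) < T (x', y)) \<and>
        (\<forall>x y y'. (x, y) \<in> D \<and> (x, y') \<in> D \<and> y < y' \<longrightarrow> T (x, y) < T (x, y'))}"

definition corners :: "(nat \<times> nat) set \<Rightarrow> (nat \<times> nat) set" where
  "corners D = {(x, y) \<in> D. (\<forall>x'>x. (x', y) \<notin> D) \<and> (\<forall>y'>y. (x, y') \<notin> D)}"

lemma corners_subset: "corners D \<subseteq> D"
  by (auto simp: corners_def)

lemma finite_linear_extensions:
  assumes "finite D" shows "finite (linear_extensions D)"
proof (rule finite_subset)
  show "linear_extensions D \<subseteq> D \<rightarrow>\<^sub>E {1..card D}"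
    by (auto simp: linear_extensions_def PiE_def dest: bij_betw_apply)
  show "finite (D \<rightarrow>\<^sub>E {1..card D})" using assms by (intro finite_PiE) auto
qed

lemma linear_extension_le:
  assumes "T \<in> linear_extensions D" "b \<in> D" shows "T b \<le> card D"
  using assms by (auto simp: linear_extensions_def dest: bij_betw_apply)

text \<open>A box to the right of or above the box holding \<open>card D\<close> would carry a
  larger entry, so the largest entry sits in a corner.\<close>

lemma linear_extension_restrict:
  assumes D: "finite D" "D \<noteq> {}" and T: "T \<in> linear_extensions D"
  obtains b where "b \<in> corners D" "restrict T (D - {b}) \<in> linear_extensions (D - {b})"
    "T = (restrict T (D - {b}))(b := card D)"
proof -
  have bij: "bij_betw T D {1..card D}" and ext: "T \<in> extensional D"
    and row: "\<And>x x' y. (x, y) \<in> D \<Longrightarrow> (x', y) \<in> D \<Longrightarrow> x < x' \<Longrightarrow> T (x, y) < T (x', y)"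
    and col: "\<And>x y y'. (x, y) \<in> D \<Longrightarrow> (x, y') \<in> D \<Longrightarrow> y < y' \<Longrightarrow> T (x, y) < T (x, y')"
    using T by (auto simp: linear_extensions_def)
  have cpos: "card D > 0" using D by (simp add: card_gt_0_iff)
  then have "card D \<in> T ` D" using bij by (auto simp: bij_betw_def)
  then obtain b where b: "b \<in> D" "T b = card D" by auto
  obtain x y where xy: "b = (x, y)" by (cases b)
  have "(x', y) \<notin> D" if "x' > x" for x'
    using row[of x y x'] linear_extension_le[OF T, of "(x', y)"] b that by (auto simp: xy)
  moreover have "(x, y') \<notin> D" if "y' > y" for y'
    using col[of x y y'] linear_extension_le[OF T, of "(x, y')"] b that by (auto simp: xy)
  ultimately have bc: "b \<in> corners D" using b by (auto simp: corners_def xy)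
  have c1: "card (D - {b}) = card D - 1" using b D by simp
  have "{1..card D} - {card D} = {1..card D - 1}" by auto
  then have "bij_betw T (D - {b}) {1..card D - 1}"
    using bij_betw_DiffI[OF bij, of "{b}" "{card D}"] b cpos
    by (simp add: bij_betw_def)
  then have "bij_betw (restrict T (D - {b})) (D - {b}) {1..card (D - {b})}"
    unfolding c1 by (subst bij_betw_cong[of _ _ T]) auto
  then have "restrict T (D - {b}) \<in> linear_extensions (D - {b})"
    using row col by (auto simp: linear_extensions_def)
  moreover have "T = (restrict T (D - {b}))(b := card D)"
    using b ext by (auto simp: fun_eq_iff restrict_def extensional_def)
  ultimately show ?thesis using that bc by blast
qed

lemma linear_extension_extend:
  assumes D: "finite D" and b: "b \<in> corners D" and T: "T \<in> linear_extensions (D - {b})"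
  shows "T(b := card D) \<in> linear_extensions D"
proof -
  have bD: "b \<in> D" using b corners_subset by auto
  have cpos: "card D > 0" using D bD by (auto simp: card_gt_0_iff)
  have c1: "card (D - {b}) = card D - 1" using bD D by simp
  have bij: "bij_betw T (D - {b}) {1..card D - 1}" and ext: "T \<in> extensional (D - {b})"
    and row: "\<And>x x' y. (x, y) \<in> D - {b} \<Longrightarrow> (x', y) \<in> D - {b} \<Longrightarrow> x < x' \<Longrightarrow> T (x, y) < T (x', y)"
    and col: "\<And>x y y'. (x, y) \<in> D - {b} \<Longrightarrow> (x, y') \<in> D - {b} \<Longrightarrow> y < y' \<Longrightarrow> T (x, y) < T (x, y')"
    using T c1 by (auto simp: linear_extensions_def)
  have lt: "T a < card D" if "a \<in> D" "a \<noteq> b" for a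
    using linear_extension_le[OF T, of a] that c1 cpos by auto
  have "bij_betw (T(b := card D)) (D - {b}) {1..card D - 1}"
    using bij by (subst bij_betw_cong[of _ _ T]) auto
  then have "bij_betw (T(b := card D)) ((D - {b}) \<union> {b}) ({1..card D - 1} \<union> {card D})"
    using cpos by (intro bij_betw_combine) auto
  moreover have "(D - {b}) \<union> {b} = D" "{1..card D - 1} \<union> {card D} = {1..card D}"
    using bD cpos by auto
  ultimately have 1: "bij_betw (T(b := card D)) D {1..card D}" by simp
  have 2: "T(b := card D) \<in> extensional D"
    using ext bD by (auto simp: extensional_def)
  have 3: "(T(b := card D)) (x, y) < (T(b := card D)) (x', y)"
    if "(x, y) \<in> D" "(x', y) \<in> D" "x < x'" for x x' y
    using that row[of x y x'] lt[of "(x, y)"] b by (auto simp: corners_def)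
  have 4: "(T(b := card D)) (x, y) < (T(b := card D)) (x, y')"
    if "(x, y) \<in> D" "(x, y') \<in> D" "y < y'" for x y y'
    using that col[of x y y'] lt[of "(x, y)"] b by (auto simp: corners_def)
  show ?thesis using 1 2 3 4 unfolding linear_extensions_def by blast
qed

text \<open>Deleting the largest entry is a bijection onto pairs of a corner and a filling of the
  rest. Fillings live on sets of boxes rather than lists of parts so that the rest is again a domain
  of the same kind.\<close>

lemma sum_linear_extensions:
  assumes D: "finite D" "D \<noteq> {}"
  shows "(\<Sum>T\<in>linear_extensions D. F T) =
    (\<Sum>b\<in>corners D. \<Sum>T\<in>linear_extensions (D - {b}). (F (T(b := card D)) :: 'a :: comm_monoid_add))"
proof -
  let ?S = "SIGMA b:corners D. linear_extensions (D - {b})"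
  have fin: "finite (corners D)" using D corners_subset finite_subset by blast
  have bij: "bij_betw (\<lambda>(b, T). T(b := card D)) ?S (linear_extensions D)"
  proof (rule bij_betwI')
    fix u v assume u: "u \<in> ?S" and v: "v \<in> ?S"
    obtain b T where bT: "u = (b, T)" "b \<in> corners D" "T \<in> linear_extensions (D - {b})"
      using u by auto
    obtain b' T' where bT': "v = (b', T')" "b' \<in> corners D" "T' \<in> linear_extensions (D - {b'})"
      using v by auto
    have bD: "b \<in> D" "b' \<in> D" using bT bT' corners_subset by auto
    \<comment> \<open>Every entry of \<open>T'\<close> is below \<open>card D\<close>, so the value
      \<open>card D\<close> locates the added box.\<close>
    have c: "card (D - {b'}) < card D" using D bD by (auto simp: card_gt_0_iff)
    have "u = v" if eq: "T(b := card D) = T'(b' := card D)"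
    proof -
      have "b = b'"
      proof (rule ccontr)
        assume "b \<noteq> b'"
        then have "T' b = card D" using fun_cong[OF eq, of b] by auto
        then show False using linear_extension_le[OF bT'(3), of b] bD c \<open>b \<noteq> b'\<close> by auto
      qed
      moreover have "T a = T' a" for a
      proof (cases "a = b")
        case True
        \<comment> \<open>At the added box the equation of the updated fillings says nothing; both
          originals have the default value \<open>undefined\<close> there.\<close>
        have "T \<in> extensional (D - {b})" "T' \<in> extensional (D - {b})"
          using bT bT' \<open>b = b'\<close> by (auto simp: linear_extensions_def)
        then have "T b = undefined" "T' b = undefined" by (auto intro: extensional_arb)
        then show ?thesis using True by simp
      next
        case False
        then show ?thesis using fun_cong[OF eq, of a] \<open>b = b'\<close> by auto
      qed
      ultimately show ?thesis using bT bT' by auto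
    qed
    then show "((case u of (b, T) \<Rightarrow> T(b := card D)) = (case v of (b, T) \<Rightarrow> T(b := card D))) = (u = v)"
      using bT bT' by auto
  next
    fix u assume "u \<in> ?S"
    then show "(case u of (b, T) \<Rightarrow> T(b := card D)) \<in> linear_extensions D"
      using linear_extension_extend D by auto
  next
    fix T assume "T \<in> linear_extensions D"
    then obtain b where b: "b \<in> corners D" "restrict T (D - {b}) \<in> linear_extensions (D - {b})"
      "T = (restrict T (D - {b}))(b := card D)"
      by (rule linear_extension_restrict[OF D])
    then show "\<exists>u\<in>?S. T = (case u of (b, T) \<Rightarrow> T(b := card D))"
      by (intro bexI[of _ "(b, restrict T (D - {b}))"]) simp_all
  qed
  have "(\<Sum>T\<in>linear_extensions D. F T) = (\<Sum>u\<in>?S. F (case u of (b, T) \<Rightarrow> T(b := card D)))"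
    using sum.reindex_bij_betw[OF bij, of F] by simp
  also have "\<dots> = (\<Sum>b\<in>corners D. \<Sum>T\<in>linear_extensions (D - {b}). F (T(b := card D)))"
    using fin D by (subst sum.Sigma) (auto intro!: finite_linear_extensions sum.cong)
  finally show ?thesis .
qed

lemma card_linear_extensions:
  assumes "finite D" "D \<noteq> {}"
  shows "card (linear_extensions D) = (\<Sum>b\<in>corners D. card (linear_extensions (D - {b})))"
  using sum_linear_extensions[OF assms, of "\<lambda>_. 1 :: nat"] by simp

section \<open>Averages over the sublevels of a uniform filling\<close>

definition sublevel_avg :: "(nat \<times> nat) set \<Rightarrow> nat \<Rightarrow> ((nat \<times> nat) set \<Rightarrow> real) \<Rightarrow> real" where
  "sublevel_avg D m f =
     (\<Sum>T\<in>linear_extensions D. f {b \<in> D. T b \<le> m}) / card (linear_extensions D)"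

text \<open>Markov property: given the box b of the largest entry, the other entries form a uniform
  filling of \<open>D - {b}\<close>, and for \<open>m < card D\<close> the sublevel does not see
  b.\<close>

lemma sublevel_avg_step:
  assumes D: "finite D" and m: "m < card D"
  shows "sublevel_avg D m f =
    (\<Sum>b\<in>corners D. (card (linear_extensions (D - {b})) / card (linear_extensions D))
        * sublevel_avg (D - {b}) m f)"
proof -
  have ne: "D \<noteq> {}" using m by auto
  have "(\<Sum>T\<in>linear_extensions D. f {a \<in> D. T a \<le> m}) =
    (\<Sum>b\<in>corners D. \<Sum>T\<in>linear_extensions (D - {b}). f {a \<in> D - {b}. T a \<le> m})"
    unfolding sum_linear_extensions[OF D ne]
    by (intro sum.cong refl arg_cong[of _ _ f]) (use m in auto)
  also have "\<dots> = (\<Sum>b\<in>corners D. card (linear_extensions (D - {b})) * sublevel_avg (D - {b}) m f)"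
  proof (rule sum.cong[OF refl])
    fix b
    have "finite (linear_extensions (D - {b}))" using D by (intro finite_linear_extensions) auto
    then show "(\<Sum>T\<in>linear_extensions (D - {b}). f {a \<in> D - {b}. T a \<le> m}) =
        card (linear_extensions (D - {b})) * sublevel_avg (D - {b}) m f"
      unfolding sublevel_avg_def by (cases "linear_extensions (D - {b}) = {}") auto
  qed
  finally show ?thesis
    unfolding sublevel_avg_def[of D] by (simp add: sum_divide_distrib)
qed

lemma sublevel_avg_full:
  assumes D: "finite D" "linear_extensions D \<noteq> {}"
  shows "sublevel_avg D (card D) f = f D"
proof -
  have "{b \<in> D. T b \<le> card D} = D" if "T \<in> linear_extensions D" for T
    using linear_extension_le[OF that] by auto
  moreover have "card (linear_extensions D) \<noteq> 0"
    using D finite_linear_extensions[OF D(1)] by auto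
  ultimately show ?thesis by (simp add: sublevel_avg_def)
qed

section \<open>Shifted shapes\<close>

text \<open>A shape as a function of the row number, zero at 0 and beyond the last row. Removing a
  corner is then a single function update, even when it empties a row of length 1.\<close>

definition strict_seq :: "(nat \<Rightarrow> nat) \<Rightarrow> bool" where
  "strict_seq xi \<longleftrightarrow> xi 0 = 0 \<and> finite {y. xi y > 0} \<and>
     (\<forall>y\<ge>1. xi (Suc y) = 0 \<or> xi (Suc y) < xi y)"

definition seq_diagram :: "(nat \<Rightarrow> nat) \<Rightarrow> (nat \<times> nat) set" where
  "seq_diagram xi = {(x, y). y < x \<and> x \<le> y + xi y}"

definition parts :: "(nat \<Rightarrow> nat) \<Rightarrow> nat set" where
  "parts xi = xi ` {y. xi y > 0}"

text \<open>The distance from the main diagonal, starting at 0 for the boxes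
  \<open>(Suc y, y)\<close>. The truncated subtraction is exact because \<open>y < x\<close> on
  diagrams.\<close>

definition box_content :: "nat \<times> nat \<Rightarrow> nat" where
  "box_content b = fst b - snd b - 1"

lemma strict_seq_gap:
  assumes xi: "strict_seq xi" and "xi y' > 0" "1 \<le> y" "y \<le> y'"
  shows "xi y' + (y' - y) \<le> xi y"
  using \<open>y \<le> y'\<close> \<open>xi y' > 0\<close>
proof (induction y' rule: dec_induct)
  case (step m)
  have "m \<ge> 1" using step assms(3) by simp
  then have "xi (Suc m) = 0 \<or> xi (Suc m) < xi m" using xi by (simp add: strict_seq_def)
  then have "xi (Suc m) < xi m" using step by simp
  then show ?case using step by (auto simp: not_less)
qed simp

lemma strict_seq_less:
  assumes xi: "strict_seq xi" and "xi y' > 0" "1 \<le> y" "y < y'"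
  shows "xi y' < xi y"
  using strict_seq_gap[OF assms(1-3)] assms(4) by fastforce

lemma strict_seq_pos: "strict_seq xi \<Longrightarrow> xi y > 0 \<Longrightarrow> y \<ge> 1"
  by (cases y) (auto simp: strict_seq_def)

lemma strict_seq_inj:
  assumes xi: "strict_seq xi" shows "inj_on xi {y. xi y > 0}"
proof (rule inj_onI)
  fix y y' assume h: "y \<in> {y. xi y > 0}" "y' \<in> {y. xi y > 0}" "xi y = xi y'"
  have "xi y > 0" "xi y' > 0" using h by auto
  then show "y = y'"
    using strict_seq_less[OF xi, of y y'] strict_seq_less[OF xi, of y' y]
      strict_seq_pos[OF xi] h(3) by (metis less_irrefl linorder_neqE_nat)
qed

lemma partsI: "xi y > 0 \<Longrightarrow> xi y \<in> parts xi"
  by (simp add: parts_def)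

lemma finite_parts: "strict_seq xi \<Longrightarrow> finite (parts xi)"
  by (simp add: strict_seq_def parts_def)

lemma zero_notin_parts: "0 \<notin> parts xi"
  by (auto simp: parts_def)

text \<open>Row number and content serve as coordinates: a row of length p has the contents 0, ...,
  p - 1. Sums and products over boxes thus depend on the set of parts alone.\<close>

lemma bij_seq_diagram:
  "bij_betw (\<lambda>(y, c). (Suc (y + c), y)) (SIGMA y:{y. xi y > 0}. {..<xi y}) (seq_diagram xi)"
proof (rule bij_betw_byWitness[where f' = "\<lambda>b. (snd b, box_content b)"])
qed (auto simp: seq_diagram_def box_content_def)

lemma finite_seq_diagram:
  assumes "strict_seq xi" shows "finite (seq_diagram xi)"
proof -
  have "finite (SIGMA y:{y. xi y > 0}. {..<xi y})"
    using assms by (auto simp: strict_seq_def)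
  then show ?thesis using bij_betw_finite[OF bij_seq_diagram[of xi]] by simp
qed

lemma sum_seq_diagram:
  assumes xi: "strict_seq xi"
  shows "(\<Sum>b\<in>seq_diagram xi. g (box_content b)) = (\<Sum>p\<in>parts xi. \<Sum>c<p. g c)"
proof -
  have "(\<Sum>b\<in>seq_diagram xi. g (box_content b)) =
      (\<Sum>u\<in>(SIGMA y:{y. xi y > 0}. {..<xi y}). g (snd u))"
    by (subst sum.reindex_bij_betw[OF bij_seq_diagram, symmetric])
       (auto intro!: sum.cong simp: box_content_def)
  also have "\<dots> = (\<Sum>y\<in>{y. xi y > 0}. \<Sum>c<xi y. g c)"
    using xi by (subst sum.Sigma) (auto simp: strict_seq_def split_beta)
  also have "\<dots> = (\<Sum>p\<in>parts xi. \<Sum>c<p. g c)"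
    unfolding parts_def by (subst sum.reindex[OF strict_seq_inj[OF xi]]) simp
  finally show ?thesis .
qed

lemma prod_seq_diagram:
  assumes xi: "strict_seq xi"
  shows "(\<Prod>b\<in>seq_diagram xi. g (box_content b)) = (\<Prod>p\<in>parts xi. \<Prod>c<p. g c)"
proof -
  have "(\<Prod>b\<in>seq_diagram xi. g (box_content b)) =
      (\<Prod>u\<in>(SIGMA y:{y. xi y > 0}. {..<xi y}). g (snd u))"
    by (subst prod.reindex_bij_betw[OF bij_seq_diagram, symmetric])
       (auto intro!: prod.cong simp: box_content_def)
  also have "\<dots> = (\<Prod>y\<in>{y. xi y > 0}. \<Prod>c<xi y. g c)"
    using xi by (subst prod.Sigma) (auto simp: strict_seq_def split_beta)
  also have "\<dots> = (\<Prod>p\<in>parts xi. \<Prod>c<p. g c)"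
    unfolding parts_def by (subst prod.reindex[OF strict_seq_inj[OF xi]]) simp
  finally show ?thesis .
qed

lemma card_seq_diagram:
  assumes "strict_seq xi" shows "card (seq_diagram xi) = \<Sum>(parts xi)"
  using sum_seq_diagram[OF assms, of "\<lambda>_. 1 :: nat"] by simp

text \<open>Shortening a row must not create a repeated part. A part 1 always qualifies because 0 is
  never in \<open>parts\<close>.\<close>

definition removable :: "(nat \<Rightarrow> nat) \<Rightarrow> nat set" where
  "removable xi = {y. xi y > 0 \<and> xi y - 1 \<notin> parts xi}"

text \<open>The box above the end of row y belongs to the diagram exactly when
  \<open>xi y - 1\<close> is itself a part, which strictness then places in the next row.\<close>

lemma corners_seq_diagram:
  assumes xi: "strict_seq xi"
  shows "corners (seq_diagram xi) = (\<lambda>y. (y + xi y, y)) ` removable xi"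
proof (intro set_eqI iffI)
  fix b assume b: "b \<in> corners (seq_diagram xi)"
  obtain x y where xy: "b = (x, y)" by (cases b)
  have D: "y < x" "x \<le> y + xi y" using b by (auto simp: corners_def xy seq_diagram_def)
  then have pos: "xi y > 0" and y1: "1 \<le> y" using strict_seq_pos[OF xi] by auto
  have x: "x = y + xi y"
  proof (rule ccontr)
    assume "x \<noteq> y + xi y"
    then have "(Suc x, y) \<in> seq_diagram xi" using D by (auto simp: seq_diagram_def)
    then show False using b by (auto simp: corners_def xy)
  qed
  have "xi y - 1 \<notin> parts xi"
  proof
    assume "xi y - 1 \<in> parts xi"
    then obtain y' where y': "xi y' > 0" "xi y' = xi y - 1" by (auto simp: parts_def)
    then have y'1: "1 \<le> y'" using strict_seq_pos[OF xi] by auto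
    have "y' > y" using strict_seq_less[OF xi pos y'1] y' pos by (cases "y' = y") fastforce+
    then have "(x, y') \<in> seq_diagram xi"
      using strict_seq_gap[OF xi y'(1) y1] y' pos x by (auto simp: seq_diagram_def)
    then show False using b \<open>y' > y\<close> by (auto simp: corners_def xy)
  qed
  then show "b \<in> (\<lambda>y. (y + xi y, y)) ` removable xi"
    using pos x xy by (auto simp: removable_def)
next
  fix b assume "b \<in> (\<lambda>y. (y + xi y, y)) ` removable xi"
  then obtain y where y: "xi y > 0" "xi y - 1 \<notin> parts xi" "b = (y + xi y, y)"
    by (auto simp: removable_def)
  have y1: "1 \<le> y" using strict_seq_pos[OF xi] y by auto
  have "(y + xi y, y') \<notin> seq_diagram xi" if "y' > y" for y'
  proof
    assume a: "(y + xi y, y') \<in> seq_diagram xi"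
    then have pos: "xi y' > 0" and le: "y + xi y \<le> y' + xi y'" and lt: "y' < y + xi y"
      by (auto simp: seq_diagram_def)
    \<comment> \<open>The gap estimate bounds the next part below by \<open>xi y - 1\<close>,
      strictness bounds it above.\<close>
    have "xi (Suc y) > 0"
      using strict_seq_gap[OF xi pos, of "Suc y"] that pos by auto
    then have "xi (Suc y) < xi y" using strict_seq_less[OF xi _ y1] by auto
    moreover have "xi y' + (y' - Suc y) \<le> xi (Suc y)"
      using strict_seq_gap[OF xi pos, of "Suc y"] that by auto
    ultimately have "xi (Suc y) = xi y - 1" using le that by auto
    then show False using y(2) partsI[of xi "Suc y"] \<open>xi (Suc y) > 0\<close> by simp
  qed
  then show "b \<in> corners (seq_diagram xi)"
    using y by (auto simp: corners_def seq_diagram_def)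
qed

lemma remove_corner:
  assumes xi: "strict_seq xi" and y: "y \<in> removable xi"
  shows "seq_diagram xi - {(y + xi y, y)} = seq_diagram (xi(y := xi y - 1))"
    and "strict_seq (xi(y := xi y - 1))"
    and "parts (xi(y := xi y - 1)) = insert (xi y - 1) (parts xi - {xi y}) - {0}"
    and "box_content (y + xi y, y) = xi y - 1"
proof -
  have pos: "xi y > 0" and ne: "xi y - 1 \<notin> parts xi" using y by (auto simp: removable_def)
  have y1: "y \<ge> 1" using strict_seq_pos[OF xi pos] .
  show "seq_diagram xi - {(y + xi y, y)} = seq_diagram (xi(y := xi y - 1))"
    using pos by (auto simp: seq_diagram_def split: if_splits)
  have "finite {z. (xi(y := xi y - 1)) z > 0}"
    by (rule finite_subset[of _ "{z. xi z > 0}"])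
       (use xi in \<open>auto simp: strict_seq_def split: if_splits\<close>)
  moreover have "(xi(y := xi y - 1)) (Suc z) = 0 \<or> (xi(y := xi y - 1)) (Suc z) < (xi(y := xi y - 1)) z"
    if "z \<ge> 1" for z
  proof -
    have *: "xi (Suc z) = 0 \<or> xi (Suc z) < xi z" using xi that by (auto simp: strict_seq_def)
    show ?thesis
    proof (cases "z = y")
      case True
      have "xi (Suc y) \<noteq> xi y - 1 \<or> xi (Suc y) = 0" using ne partsI[of xi "Suc y"] by (metis neq0_conv)
      then show ?thesis using * True by auto
    qed (use * in auto)
  qed
  ultimately show "strict_seq (xi(y := xi y - 1))"
    using xi y1 by (auto simp: strict_seq_def)
  show "parts (xi(y := xi y - 1)) = insert (xi y - 1) (parts xi - {xi y}) - {0}"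
    using strict_seq_inj[OF xi] pos
    by (auto simp: parts_def inj_on_def image_iff split: if_splits)
  show "box_content (y + xi y, y) = xi y - 1" by (simp add: box_content_def)
qed

section \<open>Partial fractions\<close>

text \<open>The residue at the simple pole \<open>a p\<close> of the product of all
  \<open>(v - b q) / (v - a q)\<close>.\<close>

definition pf_residue :: "('b \<Rightarrow> 'a) \<Rightarrow> ('b \<Rightarrow> 'a) \<Rightarrow> 'b set \<Rightarrow> 'b \<Rightarrow> 'a :: field" where
  "pf_residue a b P p = (a p - b p) * (\<Prod>q\<in>P - {p}. (a p - b q) / (a p - a q))"

lemma pf_residue_insert:
  assumes "finite P" "t \<notin> P" "p \<in> P"
  shows "pf_residue a b (insert t P) p = pf_residue a b P p * ((a p - b t) / (a p - a t))"
proof -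
  have "insert t P - {p} = insert t (P - {p})" using assms by auto
  then show ?thesis using assms by (simp add: pf_residue_def)
qed

text \<open>Induction on the set of poles. One more factor splits each old term into a term at its
  own pole and one at \<open>a t\<close>; the latter sum up to the value of the old product at
  \<open>a t\<close>.\<close>

lemma partial_fractions:
  fixes a b :: "'b \<Rightarrow> 'a :: field"
  assumes "finite P" "inj_on a P" "v \<notin> a ` P"
  shows "(\<Prod>p\<in>P. (v - b p) / (v - a p)) = 1 + (\<Sum>p\<in>P. pf_residue a b P p / (v - a p))"
  using assms
proof (induction P arbitrary: v rule: finite_induct)
  case (insert t P)
  let ?r = "pf_residue a b P"
  have at: "a t \<notin> a ` P" using insert by auto
  have vt: "v \<noteq> a t" and vp: "\<And>p. p \<in> P \<Longrightarrow> v \<noteq> a p" and tp: "\<And>p. p \<in> P \<Longrightarrow> a t \<noteq> a p"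
    using insert at by auto
  have rt: "pf_residue a b (insert t P) t = (a t - b t) * (1 + (\<Sum>p\<in>P. ?r p / (a t - a p)))"
    using insert at by (simp add: pf_residue_def)
  have tm: "?r p / (v - a p) * ((v - b t) / (v - a t)) =
      (a t - b t) * (?r p / (a t - a p)) / (v - a t) + ?r p * ((a p - b t) / (a p - a t)) / (v - a p)"
    if "p \<in> P" for p
  proof -
    have ne: "v - a p \<noteq> 0" "v - a t \<noteq> 0" "a t - a p \<noteq> 0" using vp tp vt that by auto
    have e: "(a p - b t) / (a p - a t) = - ((a p - b t) / (a t - a p))"
      using ne by (metis minus_diff_eq minus_divide_right)
    show ?thesis unfolding e using ne
      by (simp add: divide_simps) (simp add: algebra_simps)
  qed
  have S: "(\<Sum>p\<in>insert t P. pf_residue a b (insert t P) p / (v - a p)) =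
      pf_residue a b (insert t P) t / (v - a t) +
      (\<Sum>p\<in>P. ?r p * ((a p - b t) / (a p - a t)) / (v - a p))"
    using insert.hyps by (simp add: pf_residue_insert cong: sum.cong)
  have E: "1 + x / c + (x * y / c + z) = 1 + (x * (1 + y) / c + z)" for x y c z :: 'a
    by (simp add: distrib_left add_divide_distrib add.assoc)
  have V: "(v - b t) / (v - a t) = 1 + (a t - b t) / (v - a t)"
    using vt by (simp add: field_simps)
  have U: "(\<Sum>p\<in>P. ?r p / (v - a p) * ((v - b t) / (v - a t))) =
     (a t - b t) * (\<Sum>p\<in>P. ?r p / (a t - a p)) / (v - a t) +
       (\<Sum>p\<in>P. ?r p * ((a p - b t) / (a p - a t)) / (v - a p))"
    unfolding sum_distrib_left sum_divide_distrib sum.distrib[symmetric]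
    by (rule sum.cong[OF refl tm])
  have "(\<Prod>p\<in>insert t P. (v - b p) / (v - a p)) =
      (v - b t) / (v - a t) * (1 + (\<Sum>p\<in>P. ?r p / (v - a p)))"
    using insert.hyps insert.IH[of v] insert.prems by simp
  also have "\<dots> = (v - b t) / (v - a t) + (\<Sum>p\<in>P. ?r p / (v - a p) * ((v - b t) / (v - a t)))"
    by (simp add: distrib_left sum_distrib_left mult.commute)
  also have "\<dots> = 1 + (\<Sum>p\<in>insert t P. pf_residue a b (insert t P) p / (v - a p))"
    unfolding U unfolding S rt V by (rule E)
  finally show ?case .
qed simp

lemma fps_nth_mult_linear:
  "fps_nth (f * (1 - fps_const (w :: 'a :: comm_ring_1) * fps_X)) j =
     fps_nth f j - (if j = 0 then 0 else w * fps_nth f (j - 1))"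
proof -
  have "f * (1 - fps_const w * fps_X) = f - fps_const w * (f * fps_X)"
    by (simp add: algebra_simps)
  then show ?thesis by simp
qed

text \<open>The same expansion with v = 1 / u, where 1 / (v - a) becomes a geometric series in u.
  Multiplying out the denominators keeps inverse series away from the statement.\<close>

lemma partial_fractions_fps:
  fixes a b :: "'b \<Rightarrow> 'a :: field"
  assumes "finite P" "inj_on a P"
  shows "Abs_fps (\<lambda>j. if j = 0 then 1 else \<Sum>p\<in>P. pf_residue a b P p * a p ^ (j - 1)) *
      (\<Prod>p\<in>P. 1 - fps_const (a p) * fps_X) = (\<Prod>p\<in>P. 1 - fps_const (b p) * fps_X)"
  using assms
proof (induction P rule: finite_induct)
  case empty
  show ?case by (simp add: fps_eq_iff)
next
  case (insert t P)
  let ?r = "pf_residue a b P"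
  let ?f = "\<lambda>P. Abs_fps (\<lambda>j. if j = 0 then 1 else \<Sum>p\<in>P. pf_residue a b P p * a p ^ (j - 1))"
  have at: "a t \<notin> a ` P" using insert by auto
  have tp: "a p - a t \<noteq> 0" if "p \<in> P" for p using at that by (auto simp: image_iff)
  have rt: "pf_residue a b (insert t P) t = (a t - b t) * (1 + (\<Sum>p\<in>P. ?r p / (a t - a p)))"
    using partial_fractions[OF \<open>finite P\<close> _ at, of b] insert by (simp add: pf_residue_def)
  have s: "(\<Sum>p\<in>insert t P. pf_residue a b (insert t P) p * a p ^ j) =
      pf_residue a b (insert t P) t * a t ^ j + (\<Sum>p\<in>P. ?r p * ((a p - b t) / (a p - a t)) * a p ^ j)" for j
    using insert by (simp add: pf_residue_insert cong: sum.cong)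
  have "?f (insert t P) * (1 - fps_const (a t) * fps_X) = ?f P * (1 - fps_const (b t) * fps_X)"
  proof (rule fps_ext)
    fix j
    \<comment> \<open>Order 1 is a case of its own: the constant coefficient 1 does not follow the
      pattern of power sums of the poles.\<close>
    consider "j = 0" | "j = 1" | i where "j = Suc (Suc i)" by (metis One_nat_def not0_implies_Suc)
    then show "fps_nth (?f (insert t P) * (1 - fps_const (a t) * fps_X)) j =
        fps_nth (?f P * (1 - fps_const (b t) * fps_X)) j"
    proof cases
      case 2
      have tm: "?r p = (a t - b t) * (?r p / (a t - a p)) + ?r p * ((a p - b t) / (a p - a t))"
        if "p \<in> P" for p
      proof -
        have e: "?r p / (a t - a p) = - (?r p / (a p - a t))"
          by (metis minus_diff_eq minus_divide_right)
        have "(a p - b t) / (a p - a t) = 1 + (a t - b t) / (a p - a t)"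
          using tp[OF that] by (simp add: field_simps)
        then show ?thesis unfolding e by (simp add: algebra_simps)
      qed
      have "(\<Sum>p\<in>P. ?r p) = (a t - b t) * (\<Sum>p\<in>P. ?r p / (a t - a p)) +
          (\<Sum>p\<in>P. ?r p * ((a p - b t) / (a p - a t)))"
        unfolding sum_distrib_left sum.distrib[symmetric] by (rule sum.cong[OF refl tm])
      then have "(\<Sum>p\<in>insert t P. pf_residue a b (insert t P) p * a p ^ 0) = (a t - b t) + (\<Sum>p\<in>P. ?r p)"
        unfolding s rt by (simp add: distrib_left add.assoc)
      then show ?thesis
        unfolding fps_nth_mult_linear 2 by (simp add: algebra_simps)
    next
      case 3
      define k where "k p = ?r p * ((a p - b t) / (a p - a t))" for p
      have tm: "k p * a p ^ Suc i - a t * (k p * a p ^ i) = ?r p * a p ^ Suc i - b t * (?r p * a p ^ i)"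
        if "p \<in> P" for p
      proof -
        have k: "k p * (a p - a t) = ?r p * (a p - b t)" using tp[OF that] by (simp add: k_def)
        have "k p * a p ^ Suc i - a t * (k p * a p ^ i) = a p ^ i * (k p * (a p - a t))"
          by (simp add: algebra_simps)
        then show ?thesis unfolding k by (simp add: algebra_simps)
      qed
      have "(\<Sum>p\<in>P. k p * a p ^ Suc i) - a t * (\<Sum>p\<in>P. k p * a p ^ i) =
          (\<Sum>p\<in>P. k p * a p ^ Suc i - a t * (k p * a p ^ i))"
        by (simp only: sum_subtractf sum_distrib_left)
      also have "\<dots> = (\<Sum>p\<in>P. ?r p * a p ^ Suc i - b t * (?r p * a p ^ i))"
        by (rule sum.cong[OF refl tm])
      also have "\<dots> = (\<Sum>p\<in>P. ?r p * a p ^ Suc i) - b t * (\<Sum>p\<in>P. ?r p * a p ^ i)"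
        by (simp only: sum_subtractf sum_distrib_left)
      finally have eq: "(\<Sum>p\<in>P. k p * a p ^ Suc i) - a t * (\<Sum>p\<in>P. k p * a p ^ i) =
          (\<Sum>p\<in>P. ?r p * a p ^ Suc i) - b t * (\<Sum>p\<in>P. ?r p * a p ^ i)" .
      have "(\<Sum>p\<in>insert t P. pf_residue a b (insert t P) p * a p ^ Suc i) -
          a t * (\<Sum>p\<in>insert t P. pf_residue a b (insert t P) p * a p ^ i) =
          (\<Sum>p\<in>P. ?r p * a p ^ Suc i) - b t * (\<Sum>p\<in>P. ?r p * a p ^ i)"
        unfolding s k_def[symmetric] eq[symmetric] by (simp add: algebra_simps)
      then show ?thesis unfolding fps_nth_mult_linear 3 by simp
    qed (simp add: fps_nth_mult_linear)
  qed
  then have eq: "?f (insert t P) * (1 - fps_const (a t) * fps_X) = ?f P * (1 - fps_const (b t) * fps_X)" .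
  have step: "?f (insert t P) * ((1 - fps_const (a t) * fps_X) * A) =
      (1 - fps_const (b t) * fps_X) * (?f P * A)" for A
  proof -
    have "?f (insert t P) * ((1 - fps_const (a t) * fps_X) * A) =
        ?f (insert t P) * (1 - fps_const (a t) * fps_X) * A"
      by (rule mult.assoc[symmetric])
    also have "\<dots> = (1 - fps_const (b t) * fps_X) * ?f P * A"
      unfolding eq by (subst mult.commute[of "?f P"]) (rule refl)
    also have "\<dots> = (1 - fps_const (b t) * fps_X) * (?f P * A)" by (rule mult.assoc)
    finally show ?thesis .
  qed
  have "?f P * (\<Prod>p\<in>P. 1 - fps_const (a p) * fps_X) = (\<Prod>p\<in>P. 1 - fps_const (b p) * fps_X)"
    using insert by simp
  then show ?case
    unfolding prod.insert[OF insert.hyps] step by simp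
qed

section \<open>The number of shifted tableaux and the transition measure\<close>

text \<open>Schur's product formula for the number of shifted standard tableaux, divided by n!, as a
  function of the set of parts.\<close>

definition schur_product :: "nat set \<Rightarrow> real" where
  "schur_product P = (\<Prod>p\<in>P. 1 / fact p) *
     (\<Prod>(a, b)\<in>{(a, b). a \<in> P \<and> b \<in> P \<and> a < b}. (real b - real a) / (real b + real a))"

text \<open>The absolute values make the new factors independent of the position of p among the
  parts.\<close>

lemma schur_product_insert:
  assumes P: "finite P" "p \<notin> P"
  shows "schur_product (insert p P) =
    schur_product P * (1 / fact p * (\<Prod>q\<in>P. \<bar>real p - real q\<bar> / (real p + real q)))"
proof -
  let ?f = "\<lambda>(a, b). (real b - real a) / (real b + real a)"
  let ?pr = "\<lambda>P. {(a, b). a \<in> P \<and> b \<in> P \<and> a < b}"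
  let ?L = "{q \<in> P. q < p}" and ?R = "{q \<in> P. p < q}"
  have fin: "finite (?pr P)"
    by (rule finite_subset[of _ "P \<times> P"]) (use P in auto)
  have eq: "?pr (insert p P) = ?pr P \<union> ((\<lambda>q. (q, p)) ` ?L \<union> (\<lambda>q. (p, q)) ` ?R)" by auto
  let ?h = "\<lambda>q. \<bar>real p - real q\<bar> / (real p + real q)"
  have LR: "P = ?L \<union> ?R"
  proof (rule set_eqI)
    fix q show "q \<in> P \<longleftrightarrow> q \<in> ?L \<union> ?R" using P(2) by (cases q p rule: linorder_cases) auto
  qed
  have e1: "prod ?f ((\<lambda>q. (q, p)) ` ?L) = prod ?h ?L"
    by (subst prod.reindex) (auto simp: inj_on_def intro!: prod.cong)
  have e2: "prod ?f ((\<lambda>q. (p, q)) ` ?R) = prod ?h ?R"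
    by (subst prod.reindex) (auto simp: inj_on_def add.commute intro!: prod.cong)
  have e3: "prod ?h P = prod ?h ?L * prod ?h ?R"
    by (subst LR, rule prod.union_disjoint) (use P in auto)
  have "prod ?f (?pr (insert p P)) = prod ?f (?pr P) * prod ?f ((\<lambda>q. (q, p)) ` ?L \<union> (\<lambda>q. (p, q)) ` ?R)"
    unfolding eq using fin P by (intro prod.union_disjoint) auto
  moreover have "prod ?f ((\<lambda>q. (q, p)) ` ?L \<union> (\<lambda>q. (p, q)) ` ?R) =
      prod ?f ((\<lambda>q. (q, p)) ` ?L) * prod ?f ((\<lambda>q. (p, q)) ` ?R)"
    using P by (intro prod.union_disjoint) auto
  ultimately have main: "prod ?f (?pr (insert p P)) = prod ?f (?pr P) * prod ?h P"
    unfolding e1 e2 e3 by (simp only:)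
  show ?thesis unfolding schur_product_def main prod.insert[OF P] by (simp only: mult_ac)
qed

lemma schur_product_pos:
  assumes "finite P" shows "schur_product P > 0"
  using assms
proof (induction rule: finite_induct)
  case (insert p P)
  have "(\<Prod>q\<in>P. \<bar>real p - real q\<bar> / (real p + real q)) > 0"
  proof (rule prod_pos)
    fix q assume "q \<in> P"
    then have "p \<noteq> q" using insert by auto
    then have "real p + real q > 0" "\<bar>real p - real q\<bar> > 0" by (auto simp: nat_neq_iff)
    then show "0 < \<bar>real p - real q\<bar> / (real p + real q)" by simp
  qed
  then show ?case using insert by (simp add: schur_product_insert)
qed (simp add: schur_product_def)

text \<open>Up to the factor \<open>-2 / \<nu>\<close> this is the residue of the generating function at the pole of \<open>p\<close>.
  It vanishes when the last box of the row of \<open>p\<close> is not a corner.\<close>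

definition removal_weight :: "nat set \<Rightarrow> nat \<Rightarrow> real" where
  "removal_weight P p = real p * (\<Prod>q\<in>P - {p}.
     (real p * (real p - 1) - real q * (real q + 1)) / (real p * (real p - 1) - real q * (real q - 1)))"

lemma removal_weight_0:
  assumes "finite P" "p > 0" "p - 1 \<in> P" shows "removal_weight P p = 0"
proof -
  have "p - 1 \<in> P - {p}" using assms by auto
  moreover have "real p * (real p - 1) - real (p - 1) * (real (p - 1) + 1) = 0"
    using assms by (simp add: of_nat_diff)
  ultimately have "(\<Prod>q\<in>P - {p}. (real p * (real p - 1) - real q * (real q + 1)) /
      (real p * (real p - 1) - real q * (real q - 1))) = 0"
    using assms(1) by (intro prod_zero bexI[of _ "p - 1"]) (simp_all only: finite_Diff div_0)
  then show ?thesis unfolding removal_weight_def by (simp only: mult_zero_right)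
qed

lemma schur_product_remove:
  assumes P: "finite P" "0 \<notin> P" "p \<in> P" "p - 1 \<notin> P"
  shows "schur_product (insert (p - 1) (P - {p}) - {0}) = schur_product P * removal_weight P p"
proof -
  define Q where "Q = P - {p}"
  have Q: "finite Q" "0 \<notin> Q" "p \<notin> Q" "p - 1 \<notin> Q" "P = insert p Q" using P by (auto simp: Q_def)
  have p: "p > 0" using P by (cases p) auto
  \<comment> \<open>A part 0 contributes only factors 1, so a part 1 that drops to 0 follows the
    general formula.\<close>
  have zero: "schur_product (insert 0 Q) = schur_product Q"
    using Q by (subst schur_product_insert) (auto intro!: prod.neutral)
  have "schur_product (insert (p - 1) Q - {0}) = schur_product (insert (p - 1) Q)"
  proof (cases "p = 1")
    case True
    then show ?thesis using zero Q by simp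
  next
    case False
    then have "insert (p - 1) Q - {0} = insert (p - 1) Q" using Q p by auto
    then show ?thesis by simp
  qed
  also have "\<dots> = schur_product Q * (1 / fact (p - 1) * (\<Prod>q\<in>Q. \<bar>real (p - 1) - real q\<bar> / (real (p - 1) + real q)))"
    using Q by (intro schur_product_insert) auto
  also have "\<dots> = schur_product Q * (1 / fact p * real p * ((\<Prod>q\<in>Q. \<bar>real p - real q\<bar> / (real p + real q)) *
      (\<Prod>q\<in>Q. (real p * (real p - 1) - real q * (real q + 1)) / (real p * (real p - 1) - real q * (real q - 1)))))"
  proof -
    have 1: "1 / fact (p - 1) = (1 / fact p * real p :: real)"
      using p by (simp add: fact_reduce[of p])
    have 2: "(\<Prod>q\<in>Q. \<bar>real (p - 1) - real q\<bar> / (real (p - 1) + real q)) =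
      (\<Prod>q\<in>Q. \<bar>real p - real q\<bar> / (real p + real q)) *
      (\<Prod>q\<in>Q. (real p * (real p - 1) - real q * (real q + 1)) / (real p * (real p - 1) - real q * (real q - 1)))"
      unfolding prod.distrib[symmetric]
    proof (rule prod.cong[OF refl])
      fix q assume q: "q \<in> Q"
      then have ne: "q \<noteq> p" "q \<noteq> p - 1" "q > 0" using Q by (auto intro: gr0I)
      have r: "real (p - 1) = real p - 1" using p by (simp add: of_nat_diff)
      have f1: "real p * (real p - 1) - real q * (real q + 1) = (real p + real q) * (real p - 1 - real q)"
        and f2: "real p * (real p - 1) - real q * (real q - 1) = (real p - real q) * (real p - 1 + real q)"
        by (simp_all add: algebra_simps)
      have nz: "real p - real q \<noteq> 0" "real p + real q \<noteq> 0" "real p - 1 + real q \<noteq> 0"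
        using ne p by auto
      \<comment> \<open>For distinct integers p and q the numbers p - q and p - 1 - q never have
        opposite signs.\<close>
      have "\<bar>real p - 1 - real q\<bar> * (real p - real q) = \<bar>real p - real q\<bar> * (real p - 1 - real q)"
      proof (cases "q < p")
        case True
        then have "real p - real q \<ge> 1" by linarith
        then have "\<bar>real p - 1 - real q\<bar> = real p - 1 - real q" "\<bar>real p - real q\<bar> = real p - real q"
          by linarith+
        then show ?thesis by (simp only: mult.commute)
      next
        case False
        then have "\<bar>real p - 1 - real q\<bar> = - (real p - 1 - real q)" "\<bar>real p - real q\<bar> = - (real p - real q)"
          by linarith+
        then show ?thesis by (simp only: mult_minus_left mult.commute)
      qed
      then have "\<bar>real p - 1 - real q\<bar> = \<bar>real p - real q\<bar> * (real p - 1 - real q) / (real p - real q)"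
        using nz by (simp only: eq_divide_eq) simp
      then show "\<bar>real (p - 1) - real q\<bar> / (real (p - 1) + real q) = \<bar>real p - real q\<bar> / (real p + real q) *
        ((real p * (real p - 1) - real q * (real q + 1)) / (real p * (real p - 1) - real q * (real q - 1)))"
        unfolding r f1 f2 using nz by simp
    qed
    show ?thesis unfolding 1 2 by simp
  qed
  also have "\<dots> = schur_product P * removal_weight P p"
    using Q by (simp add: schur_product_insert removal_weight_def)
  finally show ?thesis by (simp add: Q_def)
qed

section \<open>The generating series of a shape\<close>

definition box_weight :: "real \<Rightarrow> nat \<Rightarrow> real" where
  "box_weight \<nu> c = real c * (real c + 1) / \<nu>"

text \<open>
  With \<open>w = c (c + 1) / \<nu>\<close> the coefficients are chosen such that \<open>box_factor \<nu> c\<close> is the expansion of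
  \<open>(1 - u (c + 1) (c + 2) / \<nu>) (1 - u c (c - 1) / \<nu>) / (1 - u w)\<^sup>2\<close>, which telescopes along a row.
\<close>

definition box_series :: "real \<Rightarrow> real fps" where
  "box_series w = Abs_fps (\<lambda>i. if i = 0 then 0 else (4 * real i - 2) * w ^ (i - 1))"

definition box_factor :: "real \<Rightarrow> nat \<Rightarrow> real fps" where
  "box_factor \<nu> c = 1 - fps_const (1 / \<nu>) * box_series (box_weight \<nu> c)"

definition shape_series :: "real \<Rightarrow> (nat \<times> nat) set \<Rightarrow> real fps" where
  "shape_series \<nu> D = (\<Prod>b\<in>D. box_factor \<nu> (box_content b))"

abbreviation lin_fps :: "real \<Rightarrow> real fps" where
  "lin_fps w \<equiv> 1 - fps_const w * fps_X"

lemma box_series_mult: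
  "box_series w * lin_fps w * lin_fps w = fps_const 2 * fps_X + fps_const (2 * w) * fps_X ^ 2"
proof (rule fps_ext)
  fix j
  consider "j = 0" | "j = 1" | "j = 2" | i where "j = Suc (Suc (Suc i))"
    by (metis One_nat_def Suc_1 not0_implies_Suc)
  then show "fps_nth (box_series w * lin_fps w * lin_fps w) j =
      fps_nth (fps_const 2 * fps_X + fps_const (2 * w) * fps_X ^ 2) j"
    by cases (simp_all add: fps_nth_mult_linear box_series_def fps_X_power_iff algebra_simps)
qed

lemma box_factor_mult:
  assumes "\<nu> \<noteq> 0"
  shows "box_factor \<nu> c * lin_fps (box_weight \<nu> c) * lin_fps (box_weight \<nu> c) =
    lin_fps (real (c + 1) * (real (c + 1) + 1) / \<nu>) * lin_fps (real c * (real c - 1) / \<nu>)"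
proof -
  define w where "w = box_weight \<nu> c"
  define A where "A = real (c + 1) * (real (c + 1) + 1) / \<nu>"
  define B where "B = real c * (real c - 1) / \<nu>"
  have s: "A + B = 2 * w + 2 / \<nu>"
    using assms by (simp add: A_def B_def w_def box_weight_def field_simps)
  have p: "A * B = w * w - 2 * w / \<nu>"
    using assms by (simp add: A_def B_def w_def box_weight_def field_simps)
  have lin: "lin_fps a * lin_fps b = 1 - fps_const (a + b) * fps_X + fps_const (a * b) * fps_X ^ 2" for a b
    by (simp add: algebra_simps power2_eq_square fps_const_add[symmetric] fps_const_mult[symmetric]
        del: fps_const_add fps_const_mult)
  have "box_factor \<nu> c * lin_fps w * lin_fps w =
      lin_fps w * lin_fps w - fps_const (1 / \<nu>) * (box_series w * lin_fps w * lin_fps w)"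
    by (simp add: box_factor_def w_def algebra_simps)
  also have "\<dots> = lin_fps A * lin_fps B"
    unfolding box_series_mult lin s p
    by (rule fps_ext) (simp add: fps_X_power_iff algebra_simps)
  finally show ?thesis unfolding A_def B_def w_def .
qed

lemma lin_fps_nonzero: "lin_fps w \<noteq> 0"
proof
  assume "lin_fps w = 0"
  then have "fps_nth (lin_fps w) 0 = 0" by (simp only: fps_zero_nth)
  then show False by simp
qed

lemma row_product:
  assumes "\<nu> \<noteq> 0"
  shows "(\<Prod>c<p. box_factor \<nu> c) * lin_fps (real p * (real p - 1) / \<nu>) = lin_fps (real p * (real p + 1) / \<nu>)"
proof (induction p)
  case (Suc p)
  let ?w = "box_weight \<nu> p"
  have "(\<Prod>c<Suc p. box_factor \<nu> c) * lin_fps ?w * lin_fps ?w =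
      (\<Prod>c<p. box_factor \<nu> c) * (box_factor \<nu> p * lin_fps ?w * lin_fps ?w)"
    by (simp add: mult_ac)
  also have "\<dots> = ((\<Prod>c<p. box_factor \<nu> c) * lin_fps (real p * (real p - 1) / \<nu>)) *
      lin_fps (real (p + 1) * (real (p + 1) + 1) / \<nu>)"
    unfolding box_factor_mult[OF assms] by (simp add: mult_ac)
  also have "\<dots> = lin_fps ?w * lin_fps (real (p + 1) * (real (p + 1) + 1) / \<nu>)"
    unfolding Suc.IH by (simp add: box_weight_def)
  finally have "lin_fps ?w * ((\<Prod>c<Suc p. box_factor \<nu> c) * lin_fps ?w) =
      lin_fps ?w * lin_fps (real (p + 1) * (real (p + 1) + 1) / \<nu>)"
    by (simp only: mult_ac)
  then have "(\<Prod>c<Suc p. box_factor \<nu> c) * lin_fps ?w = lin_fps (real (p + 1) * (real (p + 1) + 1) / \<nu>)"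
    using lin_fps_nonzero[of ?w] by (simp only: mult_cancel_left simp_thms)
  moreover have "?w = real (Suc p) * (real (Suc p) - 1) / \<nu>" by (simp add: box_weight_def)
  ultimately show ?case by simp
qed simp

text \<open>Telescoping along the rows leaves a rational function of v = 1 / u with poles p (p - 1)
  / \<nu>, the weights of the last boxes of the rows. Its coefficients are therefore power sums of
  these weights.\<close>

lemma shape_series_nth:
  assumes xi: "strict_seq xi" and nu: "\<nu> \<noteq> 0"
  shows "fps_nth (shape_series \<nu> (seq_diagram xi)) (Suc j) =
    - (2 / \<nu>) * (\<Sum>p\<in>parts xi. removal_weight (parts xi) p * box_weight \<nu> (p - 1) ^ j)"
    and "fps_nth (shape_series \<nu> (seq_diagram xi)) 0 = 1"
proof -
  let ?P = "parts xi"
  let ?a = "\<lambda>p. real p * (real p - 1) / \<nu>" and ?b = "\<lambda>p. real p * (real p + 1) / \<nu>"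
  let ?f = "Abs_fps (\<lambda>j. if j = 0 then 1 else \<Sum>p\<in>?P. pf_residue ?a ?b ?P p * ?a p ^ (j - 1))"
  let ?A = "\<Prod>p\<in>?P. lin_fps (?a p)"
  have fin: "finite ?P" using finite_parts[OF xi] .
  have pos: "p > 0" if "p \<in> ?P" for p using that zero_notin_parts[of xi] by (cases p) auto
  \<comment> \<open>Poles coincide only if p = q or p + q = 1, and the latter is impossible for
    positive parts.\<close>
  have inj: "inj_on ?a ?P"
  proof (rule inj_onI)
    fix p q assume pq: "p \<in> ?P" "q \<in> ?P" "?a p = ?a q"
    then have "(real p - real q) * (real p + real q - 1) = 0" using nu by (simp add: field_simps)
    moreover have "real p \<ge> 1" "real q \<ge> 1" using pos pq by (auto simp: Suc_le_eq)
    then have "real p + real q - 1 \<noteq> 0" by linarith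
    ultimately show "p = q" by simp
  qed
  have "?f * ?A = (\<Prod>p\<in>?P. lin_fps (?b p))"
    by (rule partial_fractions_fps[OF fin inj])
  also have "\<dots> = shape_series \<nu> (seq_diagram xi) * ?A"
    unfolding shape_series_def prod_seq_diagram[OF xi] prod.distrib[symmetric]
    by (intro prod.cong refl row_product[OF nu, symmetric])
  finally have eq: "shape_series \<nu> (seq_diagram xi) = ?f"
    using lin_fps_nonzero fin by (simp add: prod_zero_iff)
  show "fps_nth (shape_series \<nu> (seq_diagram xi)) 0 = 1" unfolding eq by simp
  have res: "pf_residue ?a ?b ?P p = - (2 / \<nu>) * removal_weight ?P p" for p
  proof -
    have 1: "?a p - ?b p = - (2 / \<nu>) * real p" using nu by (simp add: field_simps)
    have 2: "(?a p - ?b q) / (?a p - ?a q) = (real p * (real p - 1) - real q * (real q + 1)) /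
        (real p * (real p - 1) - real q * (real q - 1))" for q
      using nu by (simp add: diff_divide_distrib[symmetric])
    show ?thesis unfolding pf_residue_def 1 2 removal_weight_def by simp
  qed
  have "?a p = box_weight \<nu> (p - 1)" if "p \<in> ?P" for p
    using pos[OF that] by (simp add: box_weight_def of_nat_diff)
  then show "fps_nth (shape_series \<nu> (seq_diagram xi)) (Suc j) =
      - (2 / \<nu>) * (\<Sum>p\<in>?P. removal_weight ?P p * box_weight \<nu> (p - 1) ^ j)"
    unfolding eq by (simp add: res sum_distrib_left mult_ac cong: sum.cong)
qed

lemma shape_series_nth_1:
  assumes "finite D"
  shows "fps_nth (shape_series \<nu> D) 0 = 1 \<and> fps_nth (shape_series \<nu> D) (Suc 0) = - (2 / \<nu>) * real (card D)"
  using assms unfolding shape_series_def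
proof (induction rule: finite_induct)
  case (insert b D)
  have "fps_nth (box_factor \<nu> c) 0 = 1" "fps_nth (box_factor \<nu> c) (Suc 0) = - (2 / \<nu>)" for c
    by (simp_all add: box_factor_def box_series_def)
  then show ?case using insert by (simp add: fps_mult_nth field_simps add_divide_distrib)
qed simp

text \<open>The linear coefficient computed in two ways, as a sum of residues and by counting
  factors. This is the branching rule behind the product formula.\<close>

lemma sum_removal_weight:
  assumes xi: "strict_seq xi"
  shows "(\<Sum>p\<in>parts xi. removal_weight (parts xi) p) = real (card (seq_diagram xi))"
  using shape_series_nth(1)[OF xi, of 1 0] shape_series_nth_1[OF finite_seq_diagram[OF xi], of 1] by simp

text \<open>Rows that do not end in a corner have weight 0 and may be added, so a sum over corners
  becomes a sum over all residues.\<close>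

lemma sum_corners:
  fixes g :: "nat \<Rightarrow> real"
  assumes xi: "strict_seq xi"
  shows "(\<Sum>b\<in>corners (seq_diagram xi). removal_weight (parts xi) (box_content b + 1) * g (box_content b)) =
    (\<Sum>p\<in>parts xi. removal_weight (parts xi) p * g (p - 1))"
proof -
  have inj: "inj_on (\<lambda>y. (y + xi y, y)) (removable xi)" by (auto simp: inj_on_def)
  have "(\<Sum>b\<in>corners (seq_diagram xi). removal_weight (parts xi) (box_content b + 1) * g (box_content b)) =
      (\<Sum>y\<in>removable xi. removal_weight (parts xi) (xi y) * g (xi y - 1))"
    unfolding corners_seq_diagram[OF xi] sum.reindex[OF inj]
    by (rule sum.cong[OF refl]) (auto simp: box_content_def removable_def)
  also have "\<dots> = (\<Sum>y\<in>{y. xi y > 0}. removal_weight (parts xi) (xi y) * g (xi y - 1))"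
    using xi removal_weight_0[OF finite_parts[OF xi]]
    by (intro sum.mono_neutral_left) (auto simp: strict_seq_def removable_def)
  also have "\<dots> = (\<Sum>p\<in>parts xi. removal_weight (parts xi) p * g (p - 1))"
    unfolding parts_def by (subst sum.reindex[OF strict_seq_inj[OF xi]]) simp
  finally show ?thesis .
qed

lemma remove_corner':
  assumes xi: "strict_seq xi" and b: "b \<in> corners (seq_diagram xi)"
  obtains eta where "strict_seq eta" "seq_diagram xi - {b} = seq_diagram eta"
    "schur_product (parts eta) = schur_product (parts xi) * removal_weight (parts xi) (box_content b + 1)"
proof -
  obtain y where y: "y \<in> removable xi" "b = (y + xi y, y)"
    using b unfolding corners_seq_diagram[OF xi] by auto
  note r = remove_corner[OF xi y(1)]
  have pos: "xi y > 0" "xi y - 1 \<notin> parts xi" using y by (auto simp: removable_def)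
  have "schur_product (parts (xi(y := xi y - 1))) = schur_product (parts xi) * removal_weight (parts xi) (xi y)"
    unfolding r(3) using finite_parts[OF xi] zero_notin_parts partsI pos
    by (intro schur_product_remove) auto
  moreover have "box_content b + 1 = xi y" using r(4) pos y by simp
  ultimately show ?thesis using that[OF r(2)] r(1) y(2) by simp
qed

text \<open>Both sides obey the same recursion over corners: removing a corner changes the product
  by its removal weight, and these weights add up to the number of boxes.\<close>

lemma card_linear_extensions_eq:
  assumes "strict_seq xi"
  shows "real (card (linear_extensions (seq_diagram xi))) =
    fact (card (seq_diagram xi)) * schur_product (parts xi)"
  using assms
proof (induction "card (seq_diagram xi)" arbitrary: xi)
  case 0
  then have e: "seq_diagram xi = {}" using finite_seq_diagram by simp
  have "parts xi = {}"
  proof (rule ccontr)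
    assume "parts xi \<noteq> {}"
    then obtain y where "xi y > 0" by (auto simp: parts_def)
    then have "(Suc y, y) \<in> seq_diagram xi" by (auto simp: seq_diagram_def)
    then show False using e by simp
  qed
  moreover have "schur_product {} = 1" by (simp add: schur_product_def)
  moreover have "linear_extensions {} = extensional {}"
    unfolding linear_extensions_def by (simp add: bij_betw_def)
  then have "card (linear_extensions {}) = 1" by (simp add: extensional_empty)
  ultimately show ?case unfolding e by simp
next
  case (Suc m)
  let ?D = "seq_diagram xi"
  have fin: "finite ?D" and ne: "?D \<noteq> {}" using Suc.hyps(2) finite_seq_diagram[OF Suc.prems] by auto
  have "real (card (linear_extensions (?D - {b}))) =
      fact m * schur_product (parts xi) * (removal_weight (parts xi) (box_content b + 1) * 1)"
    if b: "b \<in> corners ?D" for b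
  proof -
    obtain eta where eta: "strict_seq eta" "?D - {b} = seq_diagram eta"
      "schur_product (parts eta) = schur_product (parts xi) * removal_weight (parts xi) (box_content b + 1)"
      using remove_corner'[OF Suc.prems b] .
    have "card (seq_diagram eta) = m"
      using Suc.hyps(2) b corners_subset[of ?D] fin by (subst eta(2)[symmetric]) auto
    then show ?thesis using Suc.hyps(1)[of eta] eta by simp
  qed
  then have "real (card (linear_extensions ?D)) = fact m * schur_product (parts xi) *
      (\<Sum>b\<in>corners ?D. removal_weight (parts xi) (box_content b + 1) * 1)"
    unfolding card_linear_extensions[OF fin ne] by (simp add: sum_distrib_left)
  also have "(\<Sum>b\<in>corners ?D. removal_weight (parts xi) (box_content b + 1) * 1) = real (Suc m)"
    unfolding sum_corners[OF Suc.prems, of "\<lambda>_. 1"] using sum_removal_weight[OF Suc.prems] Suc.hyps(2) by simp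
  finally show ?case unfolding Suc.hyps(2)[symmetric] by simp
qed

section \<open>Transition probabilities of box removal\<close>

definition shape :: "(nat \<times> nat) set \<Rightarrow> bool" where
  "shape D \<longleftrightarrow> (\<exists>xi. strict_seq xi \<and> D = seq_diagram xi)"

definition down_prob :: "(nat \<times> nat) set \<Rightarrow> nat \<times> nat \<Rightarrow> real" where
  "down_prob D b = card (linear_extensions (D - {b})) / card (linear_extensions D)"

lemma shape_finite: "shape D \<Longrightarrow> finite D"
  using finite_seq_diagram by (auto simp: shape_def)

lemma shape_linear_extensions: "shape D \<Longrightarrow> linear_extensions D \<noteq> {}"
proof -
  assume "shape D"
  then obtain xi where xi: "strict_seq xi" "D = seq_diagram xi" by (auto simp: shape_def)
  have "real (card (linear_extensions D)) > 0"
    unfolding xi(2) card_linear_extensions_eq[OF xi(1)]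
    using schur_product_pos[OF finite_parts[OF xi(1)]] by simp
  then show ?thesis by auto
qed

lemma shape_remove: "shape D \<Longrightarrow> b \<in> corners D \<Longrightarrow> shape (D - {b})"
  using remove_corner' by (metis shape_def)

text \<open>By the product formula the probability of a corner is its removal weight divided by the
  number of boxes, so the moments are residue sums. From here on coefficients of the series are
  averages over corners.\<close>

lemma transition_moments:
  assumes D: "shape D" "D \<noteq> {}" and nu: "\<nu> \<noteq> 0"
  shows "(\<Sum>b\<in>corners D. down_prob D b * box_weight \<nu> (box_content b) ^ j) =
    - (\<nu> / (2 * real (card D))) * fps_nth (shape_series \<nu> D) (Suc j)"
proof -
  obtain xi where xi: "strict_seq xi" "D = seq_diagram xi" using D by (auto simp: shape_def)
  have fin: "finite D" using D shape_finite by auto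
  have c: "card D > 0" using D fin by (simp add: card_gt_0_iff)
  have sp: "schur_product (parts xi) > 0" using schur_product_pos finite_parts xi by auto
  have dp: "down_prob D b = removal_weight (parts xi) (box_content b + 1) / real (card D)"
    if b: "b \<in> corners D" for b
  proof -
    obtain eta where eta: "strict_seq eta" "D - {b} = seq_diagram eta"
      "schur_product (parts eta) = schur_product (parts xi) * removal_weight (parts xi) (box_content b + 1)"
      using remove_corner'[OF xi(1)] b xi(2) by metis
    have c': "card (D - {b}) = card D - 1" using b corners_subset[of D] fin by auto
    have "real (card (linear_extensions (D - {b}))) =
        fact (card D - 1) * (schur_product (parts xi) * removal_weight (parts xi) (box_content b + 1))"
      using card_linear_extensions_eq[OF eta(1)] eta c' by simp
    moreover have "real (card (linear_extensions D)) = fact (card D) * schur_product (parts xi)"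
      using card_linear_extensions_eq[OF xi(1)] xi(2) by simp
    moreover have "(fact (card D) :: real) = real (card D) * fact (card D - 1)"
      using c by (simp add: fact_reduce)
    ultimately show ?thesis unfolding down_prob_def using sp c by simp
  qed
  have "(\<Sum>b\<in>corners D. down_prob D b * box_weight \<nu> (box_content b) ^ j) =
     (\<Sum>b\<in>corners D. removal_weight (parts xi) (box_content b + 1) * box_weight \<nu> (box_content b) ^ j) / real (card D)"
    by (simp add: dp sum_divide_distrib cong: sum.cong)
  also have "\<dots> = (\<Sum>p\<in>parts xi. removal_weight (parts xi) p * box_weight \<nu> (p - 1) ^ j) / real (card D)"
    unfolding xi(2) sum_corners[OF xi(1), of "\<lambda>c. box_weight \<nu> c ^ j"] ..
  also have "\<dots> = - (\<nu> / (2 * real (card D))) * fps_nth (shape_series \<nu> D) (Suc j)"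
    unfolding xi(2) shape_series_nth(1)[OF xi(1) nu] using nu by simp
  finally show ?thesis .
qed

lemma down_prob_nonneg: "down_prob D b \<ge> 0"
  by (simp add: down_prob_def)

lemma sum_down_prob:
  assumes D: "shape D" "D \<noteq> {}"
  shows "(\<Sum>b\<in>corners D. down_prob D b) = 1"
proof -
  have fin: "finite D" using D shape_finite by auto
  have "card (linear_extensions D) \<noteq> 0"
    using shape_linear_extensions D finite_linear_extensions[OF fin] by auto
  then show ?thesis
    unfolding down_prob_def sum_divide_distrib[symmetric] of_nat_sum[symmetric]
      card_linear_extensions[OF fin D(2), symmetric] by simp
qed

section \<open>Concentration\<close>

text \<open>Higher coefficients never influence lower ones in sums and products, so a bound on a
  truncation suffices; there a product costs a factor \<open>K + 1\<close>.\<close>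

definition fps_bounded :: "nat \<Rightarrow> real \<Rightarrow> real fps \<Rightarrow> bool" where
  "fps_bounded K m f \<longleftrightarrow> (\<forall>j\<le>K. \<bar>fps_nth f j\<bar> \<le> m)"

lemma fps_boundedD: "fps_bounded K m f \<Longrightarrow> j \<le> K \<Longrightarrow> \<bar>fps_nth f j\<bar> \<le> m"
  by (simp add: fps_bounded_def)

lemma fps_bounded_nonneg: "fps_bounded K m f \<Longrightarrow> m \<ge> 0"
  using fps_boundedD[of K m f 0] by simp

lemma fps_bounded_mono: "fps_bounded K m f \<Longrightarrow> m \<le> m' \<Longrightarrow> fps_bounded K m' f"
  by (force simp: fps_bounded_def)

lemma fps_bounded_add: "fps_bounded K m f \<Longrightarrow> fps_bounded K m' g \<Longrightarrow> fps_bounded K (m + m') (f + g)"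
  unfolding fps_bounded_def fps_add_nth by (meson abs_triangle_ineq add_mono order_trans)

lemma fps_bounded_diff: "fps_bounded K m f \<Longrightarrow> fps_bounded K m' g \<Longrightarrow> fps_bounded K (m + m') (f - g)"
  unfolding fps_bounded_def fps_sub_nth by (meson abs_triangle_ineq4 add_mono order_trans)

lemma fps_bounded_cmult: "fps_bounded K m f \<Longrightarrow> fps_bounded K (\<bar>c\<bar> * m) (fps_const c * f)"
  by (auto simp: fps_bounded_def abs_mult intro: mult_left_mono)

lemma fps_bounded_mult:
  assumes f: "fps_bounded K m f" and g: "fps_bounded K m' g"
  shows "fps_bounded K (real (K + 1) * (m * m')) (f * g)"
  unfolding fps_bounded_def
proof (intro allI impI)
  fix j assume j: "j \<le> K"
  have "\<bar>fps_nth (f * g) j\<bar> \<le> (\<Sum>i=0..j. \<bar>fps_nth f i * fps_nth g (j - i)\<bar>)"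
    unfolding fps_mult_nth by (rule sum_abs)
  also have "\<dots> \<le> (\<Sum>i=0..j. m * m')"
    unfolding abs_mult using fps_bounded_nonneg[OF f] j
    by (intro sum_mono mult_mono fps_boundedD[OF f] fps_boundedD[OF g]) auto
  also have "\<dots> = real (j + 1) * (m * m')" by simp
  also have "\<dots> \<le> real (K + 1) * (m * m')"
    using j fps_bounded_nonneg[OF f] fps_bounded_nonneg[OF g] by (intro mult_right_mono) auto
  finally show "\<bar>fps_nth (f * g) j\<bar> \<le> real (K + 1) * (m * m')" .
qed

lemma fps_bounded_power:
  assumes f: "fps_bounded K m f"
  shows "fps_bounded K ((real (K + 1) * m) ^ a) (f ^ a)"
proof (induction a)
  case 0
  show ?case by (simp add: fps_bounded_def)
next
  case (Suc a)
  show ?case using fps_bounded_mult[OF f Suc] by (simp add: mult_ac)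
qed

text \<open>Second-order expansion with a remainder bounded uniformly in x. The form
  \<open>x * (x * h)\<close> keeps both small factors visible.\<close>

lemma power_one_minus_fps:
  assumes "M \<ge> 0"
  shows "\<exists>H\<ge>0. \<forall>x. fps_bounded K M x \<longrightarrow>
    (\<exists>h. fps_bounded K H h \<and> (1 - x) ^ a = 1 - of_nat a * x + x * (x * h))"
proof (induction a)
  case 0
  show ?case
    by (intro exI[of _ 0]) (auto intro!: exI[of _ 0] simp: fps_bounded_def)
next
  case (Suc a)
  then obtain H where H: "H \<ge> 0" "\<And>x. fps_bounded K M x \<Longrightarrow>
    \<exists>h. fps_bounded K H h \<and> (1 - x) ^ a = 1 - of_nat a * x + x * (x * h)" by blast
  define H' where "H' = real a + H + real (K + 1) * (M * H)"
  have "\<exists>h. fps_bounded K H' h \<and> (1 - x) ^ Suc a = 1 - of_nat (Suc a) * x + x * (x * h)"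
    if x: "fps_bounded K M x" for x
  proof -
    obtain h where h: "fps_bounded K H h" "(1 - x) ^ a = 1 - of_nat a * x + x * (x * h)"
      using H(2)[OF x] by blast
    have "fps_bounded K (real a) (fps_const (real a))"
      by (auto simp: fps_bounded_def)
    then have "fps_bounded K H' (fps_const (real a) + h - x * h)"
      unfolding H'_def using h x by (intro fps_bounded_diff fps_bounded_add fps_bounded_mult)
    moreover have "(1 - x) ^ Suc a = 1 - of_nat (Suc a) * x + x * (x * (of_nat a + h - x * h))"
      unfolding power_Suc h(2) by (simp add: algebra_simps)
    ultimately show ?thesis by (auto simp: fps_of_nat)
  qed
  moreover have "H' \<ge> 0" using H assms by (simp add: H'_def)
  ultimately show ?case by blast
qed

text \<open>The conditions under which all error constants depend on M and the order only. They
  survive the removal of corners with \<nu> fixed.\<close>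

definition bounded_shape :: "real \<Rightarrow> real \<Rightarrow> (nat \<times> nat) set \<Rightarrow> bool" where
  "bounded_shape \<nu> M D \<longleftrightarrow>
     shape D \<and> (\<forall>b\<in>D. box_weight \<nu> (box_content b) \<le> M) \<and> real (card D) \<le> \<nu>"

lemma bounded_shape_remove:
  assumes "bounded_shape \<nu> M D" "b \<in> corners D" shows "bounded_shape \<nu> M (D - {b})"
proof -
  have "finite D" using assms shape_finite by (auto simp: bounded_shape_def)
  then have "card (D - {b}) \<le> card D" by (intro card_mono) auto
  then show ?thesis using assms shape_remove by (auto simp: bounded_shape_def)
qed

lemma box_weight_nonneg: "\<nu> \<ge> 0 \<Longrightarrow> box_weight \<nu> c \<ge> 0"
  by (simp add: box_weight_def)

text \<open>Up to sign and the factor \<open>2 * card D / \<nu>\<close>, which is at most 2, the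
  coefficient at order i + 1 is the i-th moment of a probability measure on corner weights in
  [0, M].\<close>

lemma shape_series_bounded:
  assumes D: "bounded_shape \<nu> M D" and M: "M \<ge> 1" and nu: "\<nu> > 0"
  shows "fps_bounded K (2 * M ^ K) (shape_series \<nu> D)"
  unfolding fps_bounded_def
proof (intro allI impI)
  fix j assume j: "j \<le> K"
  have MK: "M ^ K \<ge> 1" using M by simp
  have sh: "shape D" and fin: "finite D" using D shape_finite by (auto simp: bounded_shape_def)
  show "\<bar>fps_nth (shape_series \<nu> D) j\<bar> \<le> 2 * M ^ K"
  proof (cases "D = {} \<or> j = 0")
    case True
    show ?thesis
    proof (cases "j = 0")
      case True
      have "fps_nth (shape_series \<nu> D) j = 1"
        using shape_series_nth_1[OF fin, of \<nu>] unfolding True by blast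
      then show ?thesis using MK by simp
    next
      case False
      with True have "shape_series \<nu> D = 1" by (simp add: shape_series_def)
      then show ?thesis using False MK by simp
    qed
  next
    case False
    then obtain i where i: "j = Suc i" by (cases j) auto
    have ne: "D \<noteq> {}" using False by auto
    have c: "real (card D) > 0" using ne fin by (simp add: card_gt_0_iff)
    have "\<bar>\<Sum>b\<in>corners D. down_prob D b * box_weight \<nu> (box_content b) ^ i\<bar> \<le>
        (\<Sum>b\<in>corners D. \<bar>down_prob D b * box_weight \<nu> (box_content b) ^ i\<bar>)" by (rule sum_abs)
    also have "\<dots> \<le> (\<Sum>b\<in>corners D. down_prob D b * M ^ i)"
    proof (rule sum_mono)
      fix b assume "b \<in> corners D"
      then have "box_weight \<nu> (box_content b) \<le> M" using D corners_subset[of D] by (auto simp: bounded_shape_def)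
      then have "box_weight \<nu> (box_content b) ^ i \<le> M ^ i"
        using box_weight_nonneg[of \<nu>] nu by (intro power_mono) auto
      then show "\<bar>down_prob D b * box_weight \<nu> (box_content b) ^ i\<bar> \<le> down_prob D b * M ^ i"
        using box_weight_nonneg[of \<nu> "box_content b"] nu down_prob_nonneg[of D b]
        by (simp add: abs_mult mult_left_mono)
    qed
    also have "\<dots> = M ^ i" using sum_down_prob[OF sh ne] by (simp add: sum_distrib_right[symmetric])
    also have "\<dots> \<le> M ^ K" using i j M by (intro power_increasing) auto
    finally have "\<bar>\<nu> / (2 * real (card D)) * fps_nth (shape_series \<nu> D) (Suc i)\<bar> \<le> M ^ K"
      using transition_moments[OF sh ne, of \<nu> i] nu by simp
    then have "\<bar>fps_nth (shape_series \<nu> D) (Suc i)\<bar> \<le> 2 * (real (card D) / \<nu>) * M ^ K"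
      using nu c by (simp add: abs_mult field_simps)
    also have "\<dots> \<le> 2 * 1 * M ^ K"
      using D nu MK by (intro mult_mono) (auto simp: bounded_shape_def)
    finally show ?thesis using i by simp
  qed
qed

lemma box_series_bounded:
  assumes "0 \<le> w" "w \<le> M" "M \<ge> 1"
  shows "fps_bounded K (4 * real K * M ^ K) (box_series w)"
  unfolding fps_bounded_def
proof (intro allI impI)
  fix j assume j: "j \<le> K"
  show "\<bar>fps_nth (box_series w) j\<bar> \<le> 4 * real K * M ^ K"
  proof (cases "j = 0")
    case False
    have "w ^ (j - 1) \<le> M ^ (j - 1)" using assms by (intro power_mono) auto
    also have "\<dots> \<le> M ^ K" using j assms by (intro power_increasing) auto
    finally have "w ^ (j - 1) \<le> M ^ K" .
    moreover have "0 \<le> 4 * real j - 2" "4 * real j - 2 \<le> 4 * real K" using False j by auto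
    ultimately have "(4 * real j - 2) * w ^ (j - 1) \<le> 4 * real K * M ^ K"
      using assms by (intro mult_mono) auto
    moreover have "(4 * real j - 2) * w ^ (j - 1) \<ge> 0"
      using \<open>0 \<le> 4 * real j - 2\<close> assms by (intro mult_nonneg_nonneg) auto
    ultimately show ?thesis using False by (simp add: box_series_def)
  qed (use assms in \<open>simp add: box_series_def\<close>)
qed

lemma shape_series_remove:
  assumes "finite D" "b \<in> D"
  shows "shape_series \<nu> D = shape_series \<nu> (D - {b}) * box_factor \<nu> (box_content b)"
  using assms by (simp add: shape_series_def prod.remove mult.commute)

text \<open>Removing a box divides the series by 1 - x with x of order 1 / \<nu>, so its a-th power
  gains a x times itself at first order.\<close>

lemma remove_box_expansion:
  fixes k a :: nat
  assumes M: "M \<ge> 1"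
  shows "\<exists>B\<ge>0. \<forall>\<nu> D b. \<nu> \<ge> 1 \<longrightarrow> bounded_shape \<nu> M D \<longrightarrow> b \<in> corners D \<longrightarrow>
    \<bar>fps_nth (shape_series \<nu> (D - {b}) ^ a) k - fps_nth (shape_series \<nu> D ^ a) k
       - real a / \<nu> * fps_nth (box_series (box_weight \<nu> (box_content b)) * shape_series \<nu> D ^ a) k\<bar> \<le> B / \<nu>\<^sup>2 \<and>
    \<bar>fps_nth (shape_series \<nu> (D - {b}) ^ a) k - fps_nth (shape_series \<nu> D ^ a) k\<bar> \<le> B / \<nu>"
proof -
  define E where "E = 4 * real k * M ^ k"
  define p where "p = (real (k + 1) * (2 * M ^ k)) ^ a"
  define q where "q = real (k + 1)"
  have E: "E \<ge> 0" and p: "p \<ge> 0" and q: "q \<ge> 0" using M by (auto simp: E_def p_def q_def)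
  obtain H where H: "H \<ge> 0" "\<And>x. fps_bounded k E x \<Longrightarrow>
    \<exists>h. fps_bounded k H h \<and> (1 - x) ^ a = 1 - of_nat a * x + x * (x * h)"
    using power_one_minus_fps[OF E, of k a] by blast
  \<comment> \<open>Both constants collect the terms of the estimates below: E, p and H bound the
    box series, the power and the remainder, and q is the cost of one truncated product.\<close>
  define B1 where "B1 = real a * (q * (p * E)) + q * (p * (q * (E * (q * (E * H)))))"
  define B2 where "B2 = real a * (q * (B1 * E)) + q * (p * (q * (E * (q * (E * H)))))"
  have B1: "B1 \<ge> 0" and B2: "B2 \<ge> 0" using E p q H by (auto simp: B1_def B2_def)
  have main: "\<bar>fps_nth (shape_series \<nu> (D - {b}) ^ a) k - fps_nth (shape_series \<nu> D ^ a) k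
       - real a / \<nu> * fps_nth (box_series (box_weight \<nu> (box_content b)) * shape_series \<nu> D ^ a) k\<bar> \<le> B2 / \<nu>\<^sup>2 \<and>
    \<bar>fps_nth (shape_series \<nu> (D - {b}) ^ a) k - fps_nth (shape_series \<nu> D ^ a) k\<bar> \<le> B1 / \<nu>"
    if nu: "\<nu> \<ge> 1" and D: "bounded_shape \<nu> M D" and b: "b \<in> corners D" for \<nu> D b
  proof -
    have bD: "b \<in> D" and fin: "finite D"
      using b corners_subset D shape_finite by (auto simp: bounded_shape_def)
    define e where "e = box_series (box_weight \<nu> (box_content b))"
    define x where "x = fps_const (1 / \<nu>) * e"
    define P where "P = shape_series \<nu> (D - {b}) ^ a"
    define Q where "Q = shape_series \<nu> D ^ a"
    have "fps_bounded k E e"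
      unfolding e_def E_def using D bD nu M box_weight_nonneg[of \<nu>]
      by (intro box_series_bounded) (auto simp: bounded_shape_def)
    then have x: "fps_bounded k (E / \<nu>) x"
      using fps_bounded_cmult[of k E e "1 / \<nu>"] nu by (simp add: x_def)
    have "E / \<nu> \<le> E / 1" using nu E by (intro divide_left_mono) auto
    then obtain h where h: "fps_bounded k H h" "(1 - x) ^ a = 1 - of_nat a * x + x * (x * h)"
      using H(2)[OF fps_bounded_mono[OF x]] by auto
    have Pb: "fps_bounded k p P"
      unfolding P_def p_def using bounded_shape_remove[OF D b] M nu
      by (intro fps_bounded_power shape_series_bounded) auto
    have "Q = P * (1 - x) ^ a"
      unfolding Q_def P_def shape_series_remove[OF fin bD] box_factor_def x_def e_def
      by (simp add: power_mult_distrib)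
    then have PQ: "P - Q = fps_const (real a) * (P * x) - P * (x * (x * h))"
      unfolding h(2) by (simp add: algebra_simps fps_of_nat)
    have last: "fps_bounded k (q * (p * (q * (E / \<nu> * (q * (E / \<nu> * H)))))) (P * (x * (x * h)))"
      unfolding q_def by (intro fps_bounded_mult Pb x h)
    have "fps_bounded k (\<bar>real a\<bar> * (q * (p * (E / \<nu>))) + q * (p * (q * (E / \<nu> * (q * (E / \<nu> * H)))))) (P - Q)"
      unfolding PQ by (intro fps_bounded_diff fps_bounded_cmult last)
        (unfold q_def, intro fps_bounded_mult Pb x)
    moreover have "\<bar>real a\<bar> * (q * (p * (E / \<nu>))) + q * (p * (q * (E / \<nu> * (q * (E / \<nu> * H))))) \<le> B1 / \<nu>"
    proof -
      have "q * (p * (q * (E / \<nu> * (q * (E / \<nu> * H))))) = q * (p * (q * (E * (q * (E * H))))) / (\<nu> * \<nu>)"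
        by simp
      also have "\<dots> \<le> q * (p * (q * (E * (q * (E * H))))) / (\<nu> * 1)"
        using nu E p q H by (intro divide_left_mono mult_left_mono) auto
      finally show ?thesis by (simp add: B1_def add_divide_distrib)
    qed
    ultimately have PQb: "fps_bounded k (B1 / \<nu>) (P - Q)" by (rule fps_bounded_mono)
    \<comment> \<open>The linear term must contain the known power Q, not P. The exchange costs
      \<open>(P - Q) * x\<close>, which the crude bound just proved makes of order 1 /
      \<nu>^2.\<close>
    have eq: "P - Q - fps_const (real a / \<nu>) * (e * Q) =
        fps_const (real a) * ((P - Q) * x) - P * (x * (x * h))"
    proof -
      have cq: "fps_const (real a / \<nu>) * (e * Q) = fps_const (real a) * (Q * x)"
      proof -
        have "fps_const (real a / \<nu>) = fps_const (real a) * fps_const (1 / \<nu>)" by simp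
        then show ?thesis by (simp only: x_def mult_ac)
      qed
      show ?thesis unfolding cq by (subst PQ) (simp add: algebra_simps)
    qed
    have "fps_bounded k (\<bar>real a\<bar> * (q * (B1 / \<nu> * (E / \<nu>))) + q * (p * (q * (E / \<nu> * (q * (E / \<nu> * H))))))
       (P - Q - fps_const (real a / \<nu>) * (e * Q))"
      unfolding eq by (intro fps_bounded_diff fps_bounded_cmult last)
        (unfold q_def, intro fps_bounded_mult PQb x)
    then have "fps_bounded k (B2 / \<nu>\<^sup>2) (P - Q - fps_const (real a / \<nu>) * (e * Q))"
      by (rule fps_bounded_mono) (simp add: B2_def power2_eq_square add_divide_distrib)
    from fps_boundedD[OF this, of k] fps_boundedD[OF PQb, of k]
    show ?thesis unfolding P_def Q_def e_def by simp
  qed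
  have "\<forall>\<nu> D b. \<nu> \<ge> 1 \<longrightarrow> bounded_shape \<nu> M D \<longrightarrow> b \<in> corners D \<longrightarrow>
    \<bar>fps_nth (shape_series \<nu> (D - {b}) ^ a) k - fps_nth (shape_series \<nu> D ^ a) k
       - real a / \<nu> * fps_nth (box_series (box_weight \<nu> (box_content b)) * shape_series \<nu> D ^ a) k\<bar> \<le> max B1 B2 / \<nu>\<^sup>2 \<and>
    \<bar>fps_nth (shape_series \<nu> (D - {b}) ^ a) k - fps_nth (shape_series \<nu> D ^ a) k\<bar> \<le> max B1 B2 / \<nu>"
  proof (intro allI impI)
    fix \<nu> D b assume h: "\<nu> \<ge> 1" "bounded_shape \<nu> M D" "b \<in> corners D"
    have "B2 / \<nu>\<^sup>2 \<le> max B1 B2 / \<nu>\<^sup>2" "B1 / \<nu> \<le> max B1 B2 / \<nu>"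
      using h(1) by (auto intro!: divide_right_mono)
    then show "\<bar>fps_nth (shape_series \<nu> (D - {b}) ^ a) k - fps_nth (shape_series \<nu> D ^ a) k
       - real a / \<nu> * fps_nth (box_series (box_weight \<nu> (box_content b)) * shape_series \<nu> D ^ a) k\<bar> \<le> max B1 B2 / \<nu>\<^sup>2 \<and>
      \<bar>fps_nth (shape_series \<nu> (D - {b}) ^ a) k - fps_nth (shape_series \<nu> D ^ a) k\<bar> \<le> max B1 B2 / \<nu>"
      using main[OF h] by linarith
  qed
  then show ?thesis using B1 by (intro exI[of _ "max B1 B2"]) (auto simp: le_max_iff_disj)
qed

text \<open>Lagrange inversion: this is what makes the exponent \<open>2 k - 1\<close> special.\<close>

lemma lagrange_coefficient:
  fixes f :: "real fps"
  assumes k: "k \<ge> 1" and f0: "fps_nth f 0 = 1"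
  shows "(\<Sum>i=0..k. (if i = 0 then 0 else (2 * real i - 1) * fps_nth f i) * fps_nth (f ^ (2 * k - 1)) (k - i)) =
    fps_nth (f ^ (2 * k - 1)) k"
proof -
  let ?a = "2 * k - 1"
  have a: "Suc ?a = 2 * k" using k by simp
  \<comment> \<open>Taking the coefficient at order k of u (f^(2k))' = 2 k u f' f^(2k-1) shows that
    2 u f' f^(2k-1) and f^(2k) agree at that order.\<close>
  have "fps_X * fps_deriv (f ^ (2 * k)) = fps_const (real (2 * k)) * (fps_X * fps_deriv f * f ^ ?a)"
    unfolding fps_deriv_power by (simp only: mult_ac)
  then have "fps_nth (fps_X * fps_deriv (f ^ (2 * k))) k =
      fps_nth (fps_const (real (2 * k)) * (fps_X * fps_deriv f * f ^ ?a)) k"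
    by (rule arg_cong[where f = "\<lambda>g. fps_nth g k"])
  moreover have "fps_nth (fps_X * fps_deriv (f ^ (2 * k))) k = real k * fps_nth (f ^ (2 * k)) k"
    using k by simp
  ultimately have "real k * fps_nth (f ^ (2 * k)) k = real (2 * k) * fps_nth (fps_X * fps_deriv f * f ^ ?a) k"
    by (simp only: fps_mult_left_const_nth)
  then have "fps_nth (f ^ (2 * k)) k = 2 * fps_nth (fps_X * fps_deriv f * f ^ ?a) k"
    using k by simp
  moreover have "f * f ^ ?a = f ^ (2 * k)" by (metis a power_Suc)
  ultimately have 1: "2 * fps_nth (fps_X * fps_deriv f * f ^ ?a) k = fps_nth (f * f ^ ?a) k"
    by (simp only:)
  have "fps_nth (fps_X * fps_deriv f * f ^ ?a) k = (\<Sum>i=0..k. real i * fps_nth f i * fps_nth (f ^ ?a) (k - i))"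
    unfolding fps_mult_nth[of "fps_X * fps_deriv f"]
    by (rule sum.cong) (auto simp: of_nat_diff)
  moreover have "fps_nth (f * f ^ ?a) k = (\<Sum>i=0..k. fps_nth f i * fps_nth (f ^ ?a) (k - i))"
    by (rule fps_mult_nth)
  ultimately have "(\<Sum>i=0..k. (2 * real i - 1) * fps_nth f i * fps_nth (f ^ ?a) (k - i)) = 0"
    using 1 by (simp add: algebra_simps sum_subtractf sum_distrib_left)
  \<comment> \<open>At i = 0 the vanishing full sum contains minus the wanted coefficient; leaving
    that term out gives the coefficient itself.\<close>
  moreover have "(\<Sum>i=0..k. (if i = 0 then 0 else (2 * real i - 1) * fps_nth f i) * fps_nth (f ^ ?a) (k - i)) =
      (\<Sum>i=0..k. (2 * real i - 1) * fps_nth f i * fps_nth (f ^ ?a) (k - i) +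
         (if i = 0 then fps_nth (f ^ ?a) k else 0))"
    by (rule sum.cong) (auto simp: f0)
  ultimately show ?thesis by (simp add: sum.distrib)
qed

text \<open>The mean of the i-th coefficient of the box series is \<open>- (\<nu> / card D)\<close>
  times 2 i - 1 times the i-th coefficient of the series, which is the sum that Lagrange inversion
  evaluates.\<close>

lemma expected_change:
  assumes D: "shape D" "D \<noteq> {}" and nu: "\<nu> > 0" and k: "k \<ge> 1"
  shows "(\<Sum>b\<in>corners D. down_prob D b * (c / \<nu> *
      fps_nth (box_series (box_weight \<nu> (box_content b)) * shape_series \<nu> D ^ (2 * k - 1)) k)) =
    - (c / real (card D)) * fps_nth (shape_series \<nu> D ^ (2 * k - 1)) k"
proof -
  let ?f = "shape_series \<nu> D"
  let ?F = "?f ^ (2 * k - 1)"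
  have fin: "finite D" using D shape_finite by auto
  have m: "real (card D) > 0" using D fin by (simp add: card_gt_0_iff)
  have i: "(\<Sum>b\<in>corners D. down_prob D b * fps_nth (box_series (box_weight \<nu> (box_content b))) i) =
      - (\<nu> / real (card D)) * (if i = 0 then 0 else (2 * real i - 1) * fps_nth ?f i)" for i
  proof (cases i)
    case (Suc j)
    have "(\<Sum>b\<in>corners D. down_prob D b * fps_nth (box_series (box_weight \<nu> (box_content b))) i) =
       (4 * real i - 2) * (\<Sum>b\<in>corners D. down_prob D b * box_weight \<nu> (box_content b) ^ j)"
      using Suc by (simp add: box_series_def sum_distrib_left mult_ac)
    also have "\<dots> = (4 * real i - 2) * (- (\<nu> / (2 * real (card D))) * fps_nth ?f i)"
      using transition_moments[OF D, of \<nu> j] nu Suc by simp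
    also have "\<dots> = - (\<nu> / real (card D)) * (if i = 0 then 0 else (2 * real i - 1) * fps_nth ?f i)"
      using Suc m by (simp add: field_simps)
    finally show ?thesis .
  qed (simp add: box_series_def)
  have "(\<Sum>b\<in>corners D. down_prob D b * fps_nth (box_series (box_weight \<nu> (box_content b)) * ?F) k) =
    (\<Sum>b\<in>corners D. \<Sum>i=0..k. down_prob D b * fps_nth (box_series (box_weight \<nu> (box_content b))) i * fps_nth ?F (k - i))"
    by (simp add: fps_mult_nth sum_distrib_left mult_ac)
  also have "\<dots> = (\<Sum>i=0..k. (\<Sum>b\<in>corners D. down_prob D b * fps_nth (box_series (box_weight \<nu> (box_content b))) i) * fps_nth ?F (k - i))"
    by (subst sum.swap) (simp add: sum_distrib_right)
  also have "\<dots> = - (\<nu> / real (card D)) *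
      (\<Sum>i=0..k. (if i = 0 then 0 else (2 * real i - 1) * fps_nth ?f i) * fps_nth ?F (k - i))"
    unfolding i by (simp add: sum_distrib_left mult_ac)
  also have "\<dots> = - (\<nu> / real (card D)) * fps_nth ?F k"
    using shape_series_nth_1[OF fin] by (subst lagrange_coefficient[OF k]) auto
  finally have "c / \<nu> * (\<Sum>b\<in>corners D. down_prob D b * fps_nth (box_series (box_weight \<nu> (box_content b)) * ?F) k) =
     - (c / real (card D)) * fps_nth ?F k"
    using nu by simp
  then show ?thesis by (simp add: sum_distrib_left mult_ac)
qed

section \<open>Second moments along box removal\<close>

lemma power_diff_bounds:
  fixes x y :: real
  assumes "0 \<le> y" "y \<le> x" "x \<le> 1"
  shows "\<bar>x ^ a - y ^ a\<bar> \<le> real a * (x - y) \<and>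
    \<bar>x ^ a - y ^ a - real a * x ^ (a - 1) * (x - y)\<bar> \<le> (real a)\<^sup>2 * (x - y)\<^sup>2"
proof (induction a)
  case (Suc a)
  let ?h = "x - y"
  have h: "?h \<ge> 0" using assms by simp
  have e1: "x ^ Suc a - y ^ Suc a = x * (x ^ a - y ^ a) + y ^ a * ?h" by (simp add: algebra_simps)
  have ya: "y ^ a \<le> 1" "0 \<le> y ^ a" using assms by (auto intro: power_le_one)
  have x: "\<bar>x * t\<bar> \<le> \<bar>t\<bar>" for t using assms by (simp add: abs_mult mult_left_le_one_le)
  have IH1: "\<bar>x ^ a - y ^ a\<bar> \<le> real a * ?h"
    and IH2: "\<bar>x ^ a - y ^ a - real a * x ^ (a - 1) * ?h\<bar> \<le> (real a)\<^sup>2 * ?h\<^sup>2" using Suc by auto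
  have "\<bar>y ^ a * ?h\<bar> \<le> ?h" using ya h by (simp add: abs_mult mult_left_le_one_le)
  then have "\<bar>x * (x ^ a - y ^ a) + y ^ a * ?h\<bar> \<le> real a * ?h + ?h"
    using x[of "x ^ a - y ^ a"] IH1 by linarith
  then have 1: "\<bar>x ^ Suc a - y ^ Suc a\<bar> \<le> real (Suc a) * ?h"
    unfolding e1 by (simp only: of_nat_Suc distrib_right mult_1_left add.commute)
  have e2: "x ^ Suc a - y ^ Suc a - real (Suc a) * x ^ (Suc a - 1) * ?h =
      x * (x ^ a - y ^ a - real a * x ^ (a - 1) * ?h) + (y ^ a - x ^ a) * ?h"
  proof (cases a)
    case (Suc i)
    show ?thesis unfolding Suc by (simp add: algebra_simps)
  qed simp
  have "\<bar>x ^ Suc a - y ^ Suc a - real (Suc a) * x ^ (Suc a - 1) * ?h\<bar> \<le>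
      (real a)\<^sup>2 * ?h\<^sup>2 + real a * ?h * ?h"
    unfolding e2
  proof (intro order_trans[OF abs_triangle_ineq] add_mono)
    show "\<bar>x * (x ^ a - y ^ a - real a * x ^ (a - 1) * ?h)\<bar> \<le> (real a)\<^sup>2 * ?h\<^sup>2"
      using x[of "x ^ a - y ^ a - real a * x ^ (a - 1) * ?h"] IH2 by linarith
    show "\<bar>(y ^ a - x ^ a) * ?h\<bar> \<le> real a * ?h * ?h"
      unfolding abs_mult using IH1 h by (intro mult_mono) (auto simp: abs_minus_commute)
  qed
  also have "\<dots> = ((real a)\<^sup>2 + real a) * ?h\<^sup>2" by (simp add: power2_eq_square algebra_simps)
  also have "\<dots> \<le> (real (Suc a))\<^sup>2 * ?h\<^sup>2"
  proof (rule mult_right_mono)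
    show "(real a)\<^sup>2 + real a \<le> (real (Suc a))\<^sup>2" by (simp add: power2_eq_square algebra_simps)
  qed simp
  finally show ?case using 1 by blast
qed simp

text \<open>The mean change of the deviation \<delta> is \<open>- (a / card D) * \<delta>\<close> up
  to O(1 / N^2), so the cross term of the square is nonpositive up to that order. A single change is
  O(1 / N), hence its square is O(1 / N^2) too.\<close>

lemma down_step_second_moment:
  fixes k :: nat
  assumes M: "M \<ge> 1" and k: "k \<ge> 1"
  defines "a \<equiv> 2 * k - 1"
  shows "\<exists>B\<ge>0. \<forall>N D \<rho>. N \<ge> 1 \<longrightarrow> bounded_shape (2 * N) M D \<longrightarrow> real (card D) \<le> N \<longrightarrow> D \<noteq> {} \<longrightarrow>
    \<bar>\<rho>\<bar> \<le> (real (k + 1) * (2 * M ^ k)) ^ a \<longrightarrow>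
    (\<Sum>b\<in>corners D. down_prob D b *
      (fps_nth (shape_series (2 * N) (D - {b}) ^ a) k - (real (card (D - {b})) / N) ^ a * \<rho>)\<^sup>2)
    \<le> (fps_nth (shape_series (2 * N) D ^ a) k - (real (card D) / N) ^ a * \<rho>)\<^sup>2 + B / N\<^sup>2"
proof -
  define p where "p = (real (k + 1) * (2 * M ^ k)) ^ a"
  have p: "p \<ge> 0" using M by (simp add: p_def)
  obtain B where B: "B \<ge> 0" and step: "\<And>\<nu> D b. \<nu> \<ge> 1 \<Longrightarrow> bounded_shape \<nu> M D \<Longrightarrow> b \<in> corners D \<Longrightarrow>
    \<bar>fps_nth (shape_series \<nu> (D - {b}) ^ a) k - fps_nth (shape_series \<nu> D ^ a) k
       - real a / \<nu> * fps_nth (box_series (box_weight \<nu> (box_content b)) * shape_series \<nu> D ^ a) k\<bar> \<le> B / \<nu>\<^sup>2 \<and>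
    \<bar>fps_nth (shape_series \<nu> (D - {b}) ^ a) k - fps_nth (shape_series \<nu> D ^ a) k\<bar> \<le> B / \<nu>"
    using remove_box_expansion[OF M, of a k] by blast
  \<comment> \<open>The first summand comes from the cross term with
    \<open>\<bar>\<delta>\<bar> \<le> 2 * p\<close>, the second from the square of one
    change.\<close>
  define B' where "B' = 2 * (2 * p) * (B + (real a)\<^sup>2 * p) + (B + real a * p)\<^sup>2"
  have B': "B' \<ge> 0" using B p by (simp add: B'_def)
  have "(\<Sum>b\<in>corners D. down_prob D b *
      (fps_nth (shape_series (2 * N) (D - {b}) ^ a) k - (real (card (D - {b})) / N) ^ a * \<rho>)\<^sup>2)
    \<le> (fps_nth (shape_series (2 * N) D ^ a) k - (real (card D) / N) ^ a * \<rho>)\<^sup>2 + B' / N\<^sup>2"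
    if N: "N \<ge> 1" and D: "bounded_shape (2 * N) M D" and cD: "real (card D) \<le> N" and ne: "D \<noteq> {}"
      and rho: "\<bar>\<rho>\<bar> \<le> p" for N D \<rho>
  proof -
    define R where "R E = fps_nth (shape_series (2 * N) E ^ a) k" for E
    define x where "x = real (card D) / N"
    define y where "y = (real (card D) - 1) / N"
    define \<delta> where "\<delta> = R D - x ^ a * \<rho>"
    define e where "e = (x ^ a - y ^ a) * \<rho>"
    define d where "d b = R (D - {b}) - R D" for b
    have sh: "shape D" and fin: "finite D" using D shape_finite by (auto simp: bounded_shape_def)
    have m: "card D > 0" using ne fin by (simp add: card_gt_0_iff)
    have nu: "2 * N \<ge> 1" "2 * N > 0" using N by auto
    have y: "0 \<le> y" "y \<le> x" "x \<le> 1" and xy: "x - y = 1 / N"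
      using m N cD by (auto simp: x_def y_def field_simps)
    have new: "R (D - {b}) - (real (card (D - {b})) / N) ^ a * \<rho> = \<delta> + (d b + e)" if b: "b \<in> corners D" for b
    proof -
      have "real (card (D - {b})) = real (card D) - 1"
        using b corners_subset[of D] fin m by (subst card_Diff_singleton) (auto simp: of_nat_diff)
      then have "real (card (D - {b})) / N = y" by (simp only: y_def)
      then show ?thesis by (simp add: \<delta>_def d_def e_def algebra_simps)
    qed
    note sum1 = sum_down_prob[OF sh ne]
    have dle: "\<bar>d b\<bar> \<le> B / N" if b: "b \<in> corners D" for b
    proof -
      have "\<bar>d b\<bar> \<le> B / (2 * N)" using step[OF nu(1) D b] by (simp add: d_def R_def)
      also have "\<dots> \<le> B / N" using B N by (intro divide_left_mono) auto
      finally show ?thesis .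
    qed
    note pw = power_diff_bounds[OF y, of a, unfolded xy]
    have ele: "\<bar>e\<bar> \<le> real a * p / N"
    proof -
      have "\<bar>e\<bar> \<le> (real a * (1 / N)) * p"
        unfolding e_def abs_mult using pw rho by (intro mult_mono) auto
      then show ?thesis by simp
    qed
    have Rb: "\<bar>R D\<bar> \<le> p"
      unfolding R_def p_def using D M nu
      by (intro fps_boundedD[OF fps_bounded_power] shape_series_bounded) auto
    have "\<bar>x ^ a * \<rho>\<bar> \<le> 1 * p"
      unfolding abs_mult using rho y by (intro mult_mono) (auto simp: power_abs intro: power_le_one)
    then have dl: "\<bar>\<delta>\<bar> \<le> 2 * p" using Rb by (simp add: \<delta>_def)
    have mean: "\<bar>(\<Sum>b\<in>corners D. down_prob D b * d b) + real a / real (card D) * R D\<bar> \<le> B / N\<^sup>2"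
    proof -
      let ?l = "\<lambda>b. real a / (2 * N) * fps_nth (box_series (box_weight (2 * N) (box_content b)) * shape_series (2 * N) D ^ a) k"
      have l: "(\<Sum>b\<in>corners D. down_prob D b * ?l b) = - (real a / real (card D)) * R D"
        unfolding R_def a_def by (rule expected_change[OF sh ne nu(2) k])
      have "(\<Sum>b\<in>corners D. down_prob D b * d b) + real a / real (card D) * R D =
          (\<Sum>b\<in>corners D. down_prob D b * d b) - (\<Sum>b\<in>corners D. down_prob D b * ?l b)"
        unfolding l by simp
      also have "\<dots> = (\<Sum>b\<in>corners D. down_prob D b * (d b - ?l b))"
        by (simp only: sum_subtractf right_diff_distrib)
      finally have "\<bar>(\<Sum>b\<in>corners D. down_prob D b * d b) + real a / real (card D) * R D\<bar> \<le>
          (\<Sum>b\<in>corners D. \<bar>down_prob D b * (d b - ?l b)\<bar>)"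
        by (simp only: sum_abs)
      also have "\<dots> \<le> (\<Sum>b\<in>corners D. down_prob D b * (B / N\<^sup>2))"
      proof (rule sum_mono)
        fix b assume b: "b \<in> corners D"
        have "\<bar>d b - ?l b\<bar> \<le> B / (2 * N)\<^sup>2" using step[OF nu(1) D b] unfolding d_def R_def by blast
        also have "\<dots> \<le> B / N\<^sup>2" using B N by (intro divide_left_mono power_mono) auto
        finally show "\<bar>down_prob D b * (d b - ?l b)\<bar> \<le> down_prob D b * (B / N\<^sup>2)"
          unfolding abs_mult using down_prob_nonneg[of D b] by (simp add: mult_left_mono del: times_divide_eq_right)
      qed
      also have "\<dots> = B / N\<^sup>2" using sum1 by (simp only: sum_distrib_right[symmetric] mult_1_left)
      finally show ?thesis .
    qed
    \<comment> \<open>Since \<open>x = card D / N\<close>, the derivative term a x^(a-1) / N equals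
      (a / \<open>card D\<close>) x^a: the deterministic part decays at the same relative rate as
      the mean of R.\<close>
    have e2: "\<bar>e - real a / real (card D) * (x ^ a * \<rho>)\<bar> \<le> (real a)\<^sup>2 * p / N\<^sup>2"
    proof -
      have "real a * x ^ (a - 1) * (1 / N) = real a / real (card D) * x ^ a"
      proof (cases a)
        case (Suc i)
        have "x ^ a = x ^ (a - 1) * (real (card D) / N)" using Suc by (simp add: x_def)
        then show ?thesis using m by simp
      qed simp
      then have "e - real a / real (card D) * (x ^ a * \<rho>) =
          (x ^ a - y ^ a - real a * x ^ (a - 1) * (1 / N)) * \<rho>"
        by (simp add: e_def algebra_simps)
      moreover have "\<bar>(x ^ a - y ^ a - real a * x ^ (a - 1) * (1 / N)) * \<rho>\<bar> \<le> ((real a)\<^sup>2 * (1 / N)\<^sup>2) * p"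
        unfolding abs_mult using pw rho by (intro mult_mono) auto
      ultimately show ?thesis by (simp add: power_divide)
    qed
    define S where "S = (\<Sum>b\<in>corners D. down_prob D b * d b)"
    have err: "\<bar>S + e + real a / real (card D) * \<delta>\<bar> \<le> (B + (real a)\<^sup>2 * p) / N\<^sup>2"
    proof -
      have eq: "S + e + real a / real (card D) * \<delta> = (S + real a / real (card D) * R D) +
          (e - real a / real (card D) * (x ^ a * \<rho>))"
        unfolding \<delta>_def by (simp add: algebra_simps)
      show ?thesis unfolding eq add_divide_distrib unfolding S_def
        by (rule order_trans[OF abs_triangle_ineq add_mono[OF mean e2]])
    qed
    define u where "u = S + e + real a / real (card D) * \<delta>"
    have "\<delta> * (S + e) = \<delta> * u - real a / real (card D) * \<delta>\<^sup>2"
      by (simp add: u_def algebra_simps power2_eq_square)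
    also have "\<dots> \<le> \<delta> * u" by simp
    also have "\<dots> \<le> \<bar>\<delta> * u\<bar>" by simp
    also have "\<dots> \<le> (2 * p) * ((B + (real a)\<^sup>2 * p) / N\<^sup>2)"
      unfolding abs_mult using dl err p unfolding u_def by (intro mult_mono) auto
    finally have cross: "\<delta> * (S + e) \<le> (2 * p) * ((B + (real a)\<^sup>2 * p) / N\<^sup>2)" .
    have sq: "(\<Sum>b\<in>corners D. down_prob D b * (d b + e)\<^sup>2) \<le> ((B + real a * p) / N)\<^sup>2"
    proof -
      have "(\<Sum>b\<in>corners D. down_prob D b * (d b + e)\<^sup>2) \<le> (\<Sum>b\<in>corners D. down_prob D b * ((B + real a * p) / N)\<^sup>2)"
      proof (intro sum_mono mult_left_mono down_prob_nonneg)
        fix b assume b: "b \<in> corners D"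
        have "\<bar>d b + e\<bar> \<le> (B + real a * p) / N" using dle[OF b] ele unfolding add_divide_distrib by linarith
        then show "(d b + e)\<^sup>2 \<le> ((B + real a * p) / N)\<^sup>2" by (metis abs_ge_zero power2_abs power_mono)
      qed
      also have "\<dots> = ((B + real a * p) / N)\<^sup>2" using sum1 by (simp only: sum_distrib_right[symmetric] mult_1_left)
      finally show ?thesis .
    qed
    have "(\<Sum>b\<in>corners D. down_prob D b * (R (D - {b}) - (real (card (D - {b})) / N) ^ a * \<rho>)\<^sup>2) =
        (\<Sum>b\<in>corners D. down_prob D b * \<delta>\<^sup>2 + 2 * \<delta> * (down_prob D b * d b + down_prob D b * e) + down_prob D b * (d b + e)\<^sup>2)"
      by (rule sum.cong[OF refl]) (simp only: new, simp add: power2_eq_square algebra_simps)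
    also have "\<dots> = (\<Sum>b\<in>corners D. down_prob D b) * \<delta>\<^sup>2 + 2 * \<delta> * (S + (\<Sum>b\<in>corners D. down_prob D b) * e) +
        (\<Sum>b\<in>corners D. down_prob D b * (d b + e)\<^sup>2)"
      by (simp add: S_def sum.distrib sum_distrib_left sum_distrib_right algebra_simps)
    also have "\<dots> = \<delta>\<^sup>2 + 2 * (\<delta> * (S + e)) + (\<Sum>b\<in>corners D. down_prob D b * (d b + e)\<^sup>2)"
      unfolding sum1 by simp
    also have "\<dots> \<le> \<delta>\<^sup>2 + 2 * ((2 * p) * ((B + (real a)\<^sup>2 * p) / N\<^sup>2)) + ((B + real a * p) / N)\<^sup>2"
      using cross sq by linarith
    also have "\<dots> = \<delta>\<^sup>2 + B' / N\<^sup>2"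
      unfolding B'_def power_divide add_divide_distrib[of "2 * (2 * p) * (B + (real a)\<^sup>2 * p)"] by simp
    finally show ?thesis unfolding R_def \<delta>_def x_def .
  qed
  then show ?thesis using B' unfolding p_def by blast
qed

lemma sublevel_card:
  assumes "finite D" "T \<in> linear_extensions D" "m \<le> card D"
  shows "card {b \<in> D. T b \<le> m} = m"
proof -
  have bij: "bij_betw T D {1..card D}" using assms by (auto simp: linear_extensions_def)
  have "T ` {b \<in> D. T b \<le> m} = {1..m}"
  proof (intro equalityI subsetI)
    fix i assume "i \<in> {1..m}"
    moreover from this have "i \<in> T ` D" using bij assms(3) by (auto simp: bij_betw_def)
    ultimately show "i \<in> T ` {b \<in> D. T b \<le> m}" by auto
  next
    fix i assume "i \<in> T ` {b \<in> D. T b \<le> m}"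
    then show "i \<in> {1..m}" using bij by (auto dest: bij_betw_apply)
  qed
  moreover have "inj_on T {b \<in> D. T b \<le> m}"
    using bij by (auto simp: bij_betw_def intro: inj_on_subset)
  ultimately show ?thesis by (metis card_atLeastAtMost card_image diff_Suc_1)
qed

text \<open>The second moment starts from 0 at the full shape and grows by at most B / N^2 in each
  of at most N removals.\<close>

lemma concentration:
  fixes k :: nat
  assumes M: "M \<ge> 1" and k: "k \<ge> 1"
  shows "\<exists>B\<ge>0. \<forall>D m. D \<noteq> {} \<longrightarrow> bounded_shape (2 * real (card D)) M D \<longrightarrow> m \<le> card D \<longrightarrow>
    sublevel_avg D m (\<lambda>E. (fps_nth (shape_series (2 * real (card D)) E ^ (2 * k - 1)) k
      - (real m / real (card D)) ^ (2 * k - 1) * fps_nth (shape_series (2 * real (card D)) D ^ (2 * k - 1)) k)\<^sup>2)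
    \<le> B / real (card D)"
proof -
  define a where "a = 2 * k - 1"
  obtain B where B: "B \<ge> 0" and step: "\<And>N D \<rho>. N \<ge> 1 \<Longrightarrow> bounded_shape (2 * N) M D \<Longrightarrow> real (card D) \<le> N \<Longrightarrow> D \<noteq> {} \<Longrightarrow>
    \<bar>\<rho>\<bar> \<le> (real (k + 1) * (2 * M ^ k)) ^ a \<Longrightarrow>
    (\<Sum>b\<in>corners D. down_prob D b *
      (fps_nth (shape_series (2 * N) (D - {b}) ^ a) k - (real (card (D - {b})) / N) ^ a * \<rho>)\<^sup>2)
    \<le> (fps_nth (shape_series (2 * N) D ^ a) k - (real (card D) / N) ^ a * \<rho>)\<^sup>2 + B / N\<^sup>2"
    using down_step_second_moment[OF M k] unfolding a_def by blast
  have "sublevel_avg D m (\<lambda>E. (fps_nth (shape_series (2 * real (card D)) E ^ a) k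
      - (real m / real (card D)) ^ a * fps_nth (shape_series (2 * real (card D)) D ^ a) k)\<^sup>2)
    \<le> B / real (card D)"
    if ne: "D \<noteq> {}" and D: "bounded_shape (2 * real (card D)) M D" and m: "m \<le> card D" for D m
  proof -
    define N where "N = real (card D)"
    define \<rho> where "\<rho> = fps_nth (shape_series (2 * N) D ^ a) k"
    define V where "V E = (fps_nth (shape_series (2 * N) E ^ a) k - (real (card E) / N) ^ a * \<rho>)\<^sup>2" for E
    have fin: "finite D" using D shape_finite by (auto simp: bounded_shape_def)
    have N: "N \<ge> 1" using ne fin by (simp add: N_def Suc_le_eq card_gt_0_iff)
    have rho: "\<bar>\<rho>\<bar> \<le> (real (k + 1) * (2 * M ^ k)) ^ a"
      unfolding \<rho>_def using D M N
      by (intro fps_boundedD[OF fps_bounded_power] shape_series_bounded) (auto simp: N_def)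
    \<comment> \<open>N and \<rho> stay frozen at the full shape while E runs over subshapes. V
      refers to the current size \<open>card E\<close>, which is m on the sublevels.\<close>
    have ind: "sublevel_avg E m V \<le> V E + real (card E - m) * (B / N\<^sup>2)"
      if "bounded_shape (2 * N) M E" "real (card E) \<le> N" "m \<le> card E" for E
      using that
    proof (induction "card E - m" arbitrary: E)
      case 0
      then have "m = card E" by simp
      moreover have "shape E" using 0 by (simp add: bounded_shape_def)
      ultimately show ?case
        using sublevel_avg_full[of E V] shape_finite shape_linear_extensions by simp
    next
      case (Suc i)
      have sh: "shape E" and finE: "finite E" using Suc.prems shape_finite by (auto simp: bounded_shape_def)
      have neE: "E \<noteq> {}" and lt: "m < card E" using Suc.hyps(2) by auto
      have "sublevel_avg E m V = (\<Sum>b\<in>corners E. down_prob E b * sublevel_avg (E - {b}) m V)"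
        unfolding down_prob_def by (rule sublevel_avg_step[OF finE lt])
      also have "\<dots> \<le> (\<Sum>b\<in>corners E. down_prob E b * (V (E - {b}) + real i * (B / N\<^sup>2)))"
      proof (intro sum_mono mult_left_mono down_prob_nonneg)
        fix b assume b: "b \<in> corners E"
        have c: "card (E - {b}) = card E - 1" using b corners_subset[of E] finE by auto
        then have i: "card (E - {b}) - m = i" using Suc.hyps(2) by simp
        have "sublevel_avg (E - {b}) m V \<le> V (E - {b}) + real (card (E - {b}) - m) * (B / N\<^sup>2)"
          using Suc.prems lt c i by (intro Suc.hyps(1) bounded_shape_remove[OF _ b]) auto
        then show "sublevel_avg (E - {b}) m V \<le> V (E - {b}) + real i * (B / N\<^sup>2)" unfolding i .
      qed
      also have "\<dots> = (\<Sum>b\<in>corners E. down_prob E b * V (E - {b})) + (\<Sum>b\<in>corners E. down_prob E b) * (real i * (B / N\<^sup>2))"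
        by (simp only: distrib_left sum.distrib sum_distrib_right)
      also have "\<dots> \<le> (V E + B / N\<^sup>2) + 1 * (real i * (B / N\<^sup>2))"
        unfolding sum_down_prob[OF sh neE] V_def using step[OF N Suc.prems(1,2) neE rho] by simp
      also have "\<dots> = V E + real (card E - m) * (B / N\<^sup>2)"
        unfolding Suc.hyps(2)[symmetric] by (simp add: algebra_simps add_divide_distrib)
      finally show ?case .
    qed
    have "V D = 0" using N by (simp add: V_def \<rho>_def N_def)
    then have "sublevel_avg D m V \<le> real (card D - m) * (B / N\<^sup>2)"
      using ind[of D] D m by (simp add: N_def)
    also have "\<dots> \<le> N * (B / N\<^sup>2)" using B by (intro mult_right_mono) (auto simp: N_def)
    also have "\<dots> = B / N" using N by (simp add: power2_eq_square)
    finally have "sublevel_avg D m V \<le> B / N" .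
    moreover have "sublevel_avg D m V = sublevel_avg D m (\<lambda>E. (fps_nth (shape_series (2 * N) E ^ a) k
      - (real m / N) ^ a * \<rho>)\<^sup>2)"
      unfolding sublevel_avg_def V_def using sublevel_card[OF fin _ m]
      by (intro arg_cong[where f = "\<lambda>s. s / _"] sum.cong) auto
    ultimately show ?thesis unfolding N_def \<rho>_def by simp
  qed
  then show ?thesis using B unfolding a_def by blast
qed

section \<open>Convergence in mean along a sequence of finite uniform samples\<close>

definition avg :: "'a set \<Rightarrow> ('a \<Rightarrow> real) \<Rightarrow> real" where
  "avg A h = (\<Sum>x\<in>A. h x) / real (card A)"

lemma avg_add: "avg A (\<lambda>x. f x + g x) = avg A f + avg A g"
  by (simp add: avg_def sum.distrib add_divide_distrib)

lemma avg_cmult: "avg A (\<lambda>x. c * f x) = c * avg A f"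
  by (simp add: avg_def sum_distrib_left)

lemma avg_mono: "(\<And>x. x \<in> A \<Longrightarrow> f x \<le> g x) \<Longrightarrow> avg A f \<le> avg A g"
  by (simp add: avg_def sum_mono divide_right_mono)

lemma avg_nonneg: "(\<And>x. x \<in> A \<Longrightarrow> 0 \<le> f x) \<Longrightarrow> 0 \<le> avg A f"
  by (simp add: avg_def sum_nonneg)

lemma avg_cong: "(\<And>x. x \<in> A \<Longrightarrow> f x = g x) \<Longrightarrow> avg A f = avg A g"
  by (simp add: avg_def cong: sum.cong)

locale finite_samples =
  fixes Om :: "nat \<Rightarrow> 'a set"
  assumes fin: "finite (Om k)" and ne: "Om k \<noteq> {}"
begin

lemma avg_const: "avg (Om k) (\<lambda>_. c) = c"
  using fin[of k] ne[of k] by (simp add: avg_def)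

lemma avg_le_const: "(\<And>T. T \<in> Om k \<Longrightarrow> f T \<le> c) \<Longrightarrow> avg (Om k) f \<le> c"
  using avg_mono[of "Om k" f "\<lambda>_. c"] avg_const by simp

lemma const_le_avg: "(\<And>T. T \<in> Om k \<Longrightarrow> c \<le> f T) \<Longrightarrow> c \<le> avg (Om k) f"
  using avg_mono[of "Om k" "\<lambda>_. c" f] avg_const by simp

text \<open>Convergence in mean to a constant. The sample spaces vary with k, so the notion must not
  refer to a common probability space.\<close>

definition converges :: "(nat \<Rightarrow> 'a \<Rightarrow> real) \<Rightarrow> real \<Rightarrow> bool" where
  "converges Z x \<longleftrightarrow> (\<lambda>k. avg (Om k) (\<lambda>T. \<bar>Z k T - x\<bar>)) \<longlonglongrightarrow> 0"

lemma convergesI_le: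
  assumes "eventually (\<lambda>k. avg (Om k) (\<lambda>T. \<bar>Z k T - x\<bar>) \<le> g k) sequentially" "g \<longlonglongrightarrow> 0"
  shows "converges Z x"
  unfolding converges_def
  by (rule tendsto_sandwich[OF _ assms(1) tendsto_const assms(2)]) (simp add: avg_nonneg)

lemma converges_det:
  assumes "z \<longlonglongrightarrow> x" shows "converges (\<lambda>k T. z k) x"
  using assms unfolding converges_def avg_const by (simp add: LIM_zero tendsto_rabs_zero)

lemma converges_const: "converges (\<lambda>k T. x) x"
  by (rule converges_det) simp

lemma converges_add:
  assumes "converges Z x" "converges W y" shows "converges (\<lambda>k T. Z k T + W k T) (x + y)"
proof (rule convergesI_le)
  show "\<forall>\<^sub>F k in sequentially. avg (Om k) (\<lambda>T. \<bar>Z k T + W k T - (x + y)\<bar>) \<le>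
     avg (Om k) (\<lambda>T. \<bar>Z k T - x\<bar>) + avg (Om k) (\<lambda>T. \<bar>W k T - y\<bar>)"
    unfolding avg_add[symmetric] by (intro always_eventually allI avg_mono) linarith
  show "(\<lambda>k. avg (Om k) (\<lambda>T. \<bar>Z k T - x\<bar>) + avg (Om k) (\<lambda>T. \<bar>W k T - y\<bar>)) \<longlonglongrightarrow> 0"
    using tendsto_add[OF assms[unfolded converges_def]] by simp
qed

lemma converges_cmult:
  assumes "converges Z x" shows "converges (\<lambda>k T. c * Z k T) (c * x)"
proof -
  have "\<bar>c * Z k T - c * x\<bar> = \<bar>c\<bar> * \<bar>Z k T - x\<bar>" for k T
    by (simp only: abs_mult[symmetric] right_diff_distrib)
  then show ?thesis
    using tendsto_mult_right_zero[OF assms[unfolded converges_def], of "\<bar>c\<bar>"]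
    unfolding converges_def by (simp add: avg_cmult)
qed

lemma converges_diff:
  assumes "converges Z x" "converges W y" shows "converges (\<lambda>k T. Z k T - W k T) (x - y)"
  using converges_add[OF assms(1) converges_cmult[OF assms(2), of "-1"]] by simp

lemma converges_sum:
  assumes "\<And>i. i \<in> I \<Longrightarrow> converges (Z i) (x i)"
  shows "converges (\<lambda>k T. \<Sum>i\<in>I. Z i k T) (\<Sum>i\<in>I. x i)"
proof (cases "finite I")
  case True
  then show ?thesis using assms
    by (induction rule: finite_induct) (auto intro!: converges_const converges_add)
qed (simp add: converges_const)

lemma converges_mult:
  assumes Z: "converges Z x" and W: "converges W y" and B: "\<And>k T. T \<in> Om k \<Longrightarrow> \<bar>W k T\<bar> \<le> B"
  shows "converges (\<lambda>k T. Z k T * W k T) (x * y)"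
proof (rule convergesI_le)
  have "\<bar>Z k T * W k T - x * y\<bar> \<le> B * \<bar>Z k T - x\<bar> + \<bar>x\<bar> * \<bar>W k T - y\<bar>" if "T \<in> Om k" for k T
  proof -
    have "Z k T * W k T - x * y = W k T * (Z k T - x) + x * (W k T - y)" by (simp add: algebra_simps)
    then have "\<bar>Z k T * W k T - x * y\<bar> \<le> \<bar>W k T\<bar> * \<bar>Z k T - x\<bar> + \<bar>x\<bar> * \<bar>W k T - y\<bar>"
      by (metis abs_mult abs_triangle_ineq)
    also have "\<dots> \<le> B * \<bar>Z k T - x\<bar> + \<bar>x\<bar> * \<bar>W k T - y\<bar>"
      using B[OF that] by (intro add_right_mono mult_right_mono) auto
    finally show ?thesis .
  qed
  then show "\<forall>\<^sub>F k in sequentially. avg (Om k) (\<lambda>T. \<bar>Z k T * W k T - x * y\<bar>) \<le>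
     B * avg (Om k) (\<lambda>T. \<bar>Z k T - x\<bar>) + \<bar>x\<bar> * avg (Om k) (\<lambda>T. \<bar>W k T - y\<bar>)"
    unfolding avg_cmult[symmetric] avg_add[symmetric] by (intro always_eventually allI avg_mono) simp
  show "(\<lambda>k. B * avg (Om k) (\<lambda>T. \<bar>Z k T - x\<bar>) + \<bar>x\<bar> * avg (Om k) (\<lambda>T. \<bar>W k T - y\<bar>)) \<longlonglongrightarrow> 0"
    using tendsto_add[OF tendsto_mult_right_zero[OF Z[unfolded converges_def], of B]
        tendsto_mult_right_zero[OF W[unfolded converges_def], of "\<bar>x\<bar>"]] by simp
qed

lemma converges_cong:
  assumes "\<And>k T. T \<in> Om k \<Longrightarrow> Z k T = W k T"
  shows "converges Z x \<longleftrightarrow> converges W x"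
proof -
  have "avg (Om k) (\<lambda>T. \<bar>Z k T - x\<bar>) = avg (Om k) (\<lambda>T. \<bar>W k T - x\<bar>)" for k
    by (rule avg_cong) (simp add: assms)
  then show ?thesis by (simp add: converges_def)
qed

lemma converges_transfer:
  "converges W x \<Longrightarrow> (\<And>k T. T \<in> Om k \<Longrightarrow> Z k T = W k T) \<Longrightarrow> converges Z x"
  using converges_cong[of Z W x] by blast

lemma converges_close:
  assumes "converges W x" "(\<lambda>k. avg (Om k) (\<lambda>T. \<bar>Z k T - W k T\<bar>)) \<longlonglongrightarrow> 0"
  shows "converges Z x"
proof (rule convergesI_le)
  show "\<forall>\<^sub>F k in sequentially. avg (Om k) (\<lambda>T. \<bar>Z k T - x\<bar>) \<le>
     avg (Om k) (\<lambda>T. \<bar>W k T - x\<bar>) + avg (Om k) (\<lambda>T. \<bar>Z k T - W k T\<bar>)"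
    unfolding avg_add[symmetric] by (intro always_eventually allI avg_mono) linarith
  show "(\<lambda>k. avg (Om k) (\<lambda>T. \<bar>W k T - x\<bar>) + avg (Om k) (\<lambda>T. \<bar>Z k T - W k T\<bar>)) \<longlonglongrightarrow> 0"
    using tendsto_add[OF assms(1)[unfolded converges_def] assms(2)] by simp
qed

lemma converges_close_uniform:
  assumes "converges W x" "\<And>k T. T \<in> Om k \<Longrightarrow> \<bar>Z k T - W k T\<bar> \<le> g k" "g \<longlonglongrightarrow> 0"
  shows "converges Z x"
proof (rule converges_close[OF assms(1)])
  show "(\<lambda>k. avg (Om k) (\<lambda>T. \<bar>Z k T - W k T\<bar>)) \<longlonglongrightarrow> 0"
    by (rule tendsto_sandwich[OF _ _ tendsto_const assms(3)])
       (auto intro!: always_eventually avg_nonneg avg_le_const assms)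
qed

text \<open>The limits are constants and the samples non-empty, so an inequality between samples
  passes to the limits. All regularity of the limit heights is obtained this way from finite
  shapes.\<close>

lemma converges_le:
  assumes Z: "converges Z x" and W: "converges W y"
    and le: "\<forall>\<^sub>F k in sequentially. \<forall>T\<in>Om k. Z k T \<le> W k T"
  shows "x \<le> y"
proof (rule tendsto_lowerbound)
  show "(\<lambda>k. avg (Om k) (\<lambda>T. \<bar>Z k T - x\<bar>) + avg (Om k) (\<lambda>T. \<bar>W k T - y\<bar>) + y) \<longlonglongrightarrow> y"
    using tendsto_add[OF tendsto_add[OF Z[unfolded converges_def] W[unfolded converges_def]] tendsto_const[of y]]
    by simp
  show "\<forall>\<^sub>F k in sequentially. x \<le> avg (Om k) (\<lambda>T. \<bar>Z k T - x\<bar>) + avg (Om k) (\<lambda>T. \<bar>W k T - y\<bar>) + y"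
    using le
  proof eventually_elim
    case (elim k)
    have "x - y \<le> avg (Om k) (\<lambda>T. \<bar>Z k T - x\<bar> + \<bar>W k T - y\<bar>)"
    proof (rule const_le_avg)
      fix T assume "T \<in> Om k"
      then have "Z k T \<le> W k T" using elim by blast
      then show "x - y \<le> \<bar>Z k T - x\<bar> + \<bar>W k T - y\<bar>" by linarith
    qed
    then show ?case unfolding avg_add by linarith
  qed
qed simp

text \<open>Completeness: it produces a limit without a candidate for its value, which suits
  quantities accessible only through polynomial test functions.\<close>

lemma converges_approx:
  assumes "\<And>\<epsilon>. \<epsilon> > 0 \<Longrightarrow> \<exists>W x. converges W x \<and>
      (\<forall>\<^sub>F k in sequentially. avg (Om k) (\<lambda>T. \<bar>Z k T - W k T\<bar>) \<le> \<epsilon>)"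
  shows "\<exists>x. converges Z x"
proof -
  have ex: "\<exists>x. \<forall>\<^sub>F k in sequentially. avg (Om k) (\<lambda>T. \<bar>Z k T - x\<bar>) \<le> \<epsilon>" if eps: "\<epsilon> > 0" for \<epsilon> :: real
  proof -
    obtain W x where W: "converges W x"
      "\<forall>\<^sub>F k in sequentially. avg (Om k) (\<lambda>T. \<bar>Z k T - W k T\<bar>) \<le> \<epsilon> / 2"
      using assms[of "\<epsilon> / 2"] eps by auto
    have "\<forall>\<^sub>F k in sequentially. avg (Om k) (\<lambda>T. \<bar>W k T - x\<bar>) < \<epsilon> / 2"
      using order_tendstoD(2)[OF W(1)[unfolded converges_def], of "\<epsilon> / 2"] eps by simp
    with W(2) have "\<forall>\<^sub>F k in sequentially. avg (Om k) (\<lambda>T. \<bar>Z k T - x\<bar>) \<le> \<epsilon>"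
    proof eventually_elim
      case (elim k)
      have "avg (Om k) (\<lambda>T. \<bar>Z k T - x\<bar>) \<le> avg (Om k) (\<lambda>T. \<bar>Z k T - W k T\<bar> + \<bar>W k T - x\<bar>)"
        by (rule avg_mono) linarith
      then show ?case using elim unfolding avg_add by linarith
    qed
    then show ?thesis by blast
  qed
  have "\<forall>i. \<exists>x. \<forall>\<^sub>F k in sequentially. avg (Om k) (\<lambda>T. \<bar>Z k T - x\<bar>) \<le> 1 / real (Suc i)"
  proof
    fix i show "\<exists>x. \<forall>\<^sub>F k in sequentially. avg (Om k) (\<lambda>T. \<bar>Z k T - x\<bar>) \<le> 1 / real (Suc i)"
      by (rule ex) simp
  qed
  from choice[OF this] obtain x where
    x: "\<And>i. \<forall>\<^sub>F k in sequentially. avg (Om k) (\<lambda>T. \<bar>Z k T - x i\<bar>) \<le> 1 / real (Suc i)" by blast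
  \<comment> \<open>Two near-limits are compared through a common sample, for any k large enough for
    both.\<close>
  have close: "\<bar>x i - x j\<bar> \<le> 1 / real (Suc i) + 1 / real (Suc j)" for i j
  proof -
    have "\<forall>\<^sub>F k in sequentially. \<bar>x i - x j\<bar> \<le> 1 / real (Suc i) + 1 / real (Suc j)"
      using x[of i] x[of j]
    proof eventually_elim
      case (elim k)
      have "\<bar>x i - x j\<bar> \<le> avg (Om k) (\<lambda>T. \<bar>Z k T - x i\<bar> + \<bar>Z k T - x j\<bar>)"
        by (rule const_le_avg) linarith
      then show ?case using elim unfolding avg_add by linarith
    qed
    then show ?thesis by simp
  qed
  have lim1: "(\<lambda>i. 1 / real (Suc i)) \<longlonglongrightarrow> 0" using LIMSEQ_inverse_real_of_nat by (simp add: inverse_eq_divide)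
  have "Cauchy x"
  proof (rule metric_CauchyI)
    fix e :: real assume "e > 0"
    then obtain N where N: "1 / real (Suc N) < e / 2" using nat_approx_posE[of "e / 2"] by auto
    have "dist (x i) (x j) < e" if "i \<ge> N" "j \<ge> N" for i j
    proof -
      have "1 / real (Suc i) \<le> 1 / real (Suc N)" "1 / real (Suc j) \<le> 1 / real (Suc N)"
        using that by (auto intro!: divide_left_mono)
      then show ?thesis using close[of i j] N unfolding dist_real_def by linarith
    qed
    then show "\<exists>M. \<forall>m\<ge>M. \<forall>n\<ge>M. dist (x m) (x n) < e" by blast
  qed
  then obtain l where l: "x \<longlonglongrightarrow> l" using real_Cauchy_convergent convergent_def by blast
  have xl: "\<bar>x i - l\<bar> \<le> 1 / real (Suc i)" for i
  proof (rule tendsto_upperbound)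
    show "(\<lambda>j. \<bar>x i - x j\<bar> - 1 / real (Suc j)) \<longlonglongrightarrow> \<bar>x i - l\<bar>"
      using tendsto_diff[OF tendsto_rabs[OF tendsto_diff[OF tendsto_const[of "x i"] l]] lim1] by simp
    show "\<forall>\<^sub>F j in sequentially. \<bar>x i - x j\<bar> - 1 / real (Suc j) \<le> 1 / real (Suc i)"
    proof (intro always_eventually allI)
      fix j show "\<bar>x i - x j\<bar> - 1 / real (Suc j) \<le> 1 / real (Suc i)" using close[of i j] by linarith
    qed
  qed simp
  have "converges Z l"
    unfolding converges_def
  proof (rule order_tendstoI)
    fix e :: real assume "e < 0"
    then show "\<forall>\<^sub>F k in sequentially. e < avg (Om k) (\<lambda>T. \<bar>Z k T - l\<bar>)"
      by (intro always_eventually allI) (rule order_less_le_trans[OF _ avg_nonneg], simp_all)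
  next
    fix e :: real assume "0 < e"
    then obtain i where i: "1 / real (Suc i) < e / 2" using nat_approx_posE[of "e / 2"] by auto
    show "\<forall>\<^sub>F k in sequentially. avg (Om k) (\<lambda>T. \<bar>Z k T - l\<bar>) < e"
      using x[of i]
    proof eventually_elim
      case (elim k)
      have "avg (Om k) (\<lambda>T. \<bar>Z k T - l\<bar>) \<le> avg (Om k) (\<lambda>T. \<bar>Z k T - x i\<bar> + \<bar>x i - l\<bar>)"
        by (rule avg_mono) linarith
      then show ?case using elim i xl[of i] unfolding avg_add avg_const by linarith
    qed
  qed
  then show ?thesis by blast
qed

lemma converges_prob:
  assumes Z: "converges Z x" and e: "e > 0"
  shows "(\<lambda>k. real (card {T \<in> Om k. \<bar>Z k T - x\<bar> > e}) / real (card (Om k))) \<longlonglongrightarrow> 0"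
proof (rule tendsto_sandwich[OF _ _ tendsto_const])
  show "(\<lambda>k. 1 / e * avg (Om k) (\<lambda>T. \<bar>Z k T - x\<bar>)) \<longlonglongrightarrow> 0"
    using tendsto_mult_right_zero[OF Z[unfolded converges_def]] .
  show "\<forall>\<^sub>F k in sequentially. real (card {T \<in> Om k. \<bar>Z k T - x\<bar> > e}) / real (card (Om k)) \<le>
      1 / e * avg (Om k) (\<lambda>T. \<bar>Z k T - x\<bar>)"
  proof (intro always_eventually allI)
    fix k
    have "real (card {T \<in> Om k. \<bar>Z k T - x\<bar> > e}) / real (card (Om k)) =
        avg (Om k) (\<lambda>T. if \<bar>Z k T - x\<bar> > e then 1 else 0)"
      using fin[of k] by (simp add: avg_def sum.If_cases Int_def)
    also have "\<dots> \<le> avg (Om k) (\<lambda>T. 1 / e * \<bar>Z k T - x\<bar>)"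
      using e by (intro avg_mono) (auto simp: field_simps)
    finally show "real (card {T \<in> Om k. \<bar>Z k T - x\<bar> > e}) / real (card (Om k)) \<le>
      1 / e * avg (Om k) (\<lambda>T. \<bar>Z k T - x\<bar>)" unfolding avg_cmult .
  qed
qed simp

subsection \<open>Power series with converging coefficients\<close>

definition coeffs_converge :: "nat \<Rightarrow> (nat \<Rightarrow> 'a \<Rightarrow> real fps) \<Rightarrow> bool" where
  "coeffs_converge K f \<longleftrightarrow> (\<forall>j\<le>K. \<exists>x. converges (\<lambda>k T. fps_nth (f k T) j) x) \<and>
     (\<exists>m. \<forall>k. \<forall>T\<in>Om k. fps_bounded K m (f k T))"

lemma coeffs_converge_mult:
  assumes f: "coeffs_converge K f" and g: "coeffs_converge K g"
  shows "coeffs_converge K (\<lambda>k T. f k T * g k T)"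
proof -
  obtain m where m: "\<And>k T. T \<in> Om k \<Longrightarrow> fps_bounded K m (f k T)"
    using f unfolding coeffs_converge_def by blast
  obtain m' where m': "\<And>k T. T \<in> Om k \<Longrightarrow> fps_bounded K m' (g k T)"
    using g unfolding coeffs_converge_def by blast
  obtain x where x: "\<And>j. j \<le> K \<Longrightarrow> converges (\<lambda>k T. fps_nth (f k T) j) (x j)"
    using f unfolding coeffs_converge_def by metis
  obtain y where y: "\<And>j. j \<le> K \<Longrightarrow> converges (\<lambda>k T. fps_nth (g k T) j) (y j)"
    using g unfolding coeffs_converge_def by metis
  have "converges (\<lambda>k T. fps_nth (f k T * g k T) j) (\<Sum>i=0..j. x i * y (j - i))" if "j \<le> K" for j
    unfolding fps_mult_nth
  proof (intro converges_sum)
    fix i assume i: "i \<in> {0..j}"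
    show "converges (\<lambda>k T. fps_nth (f k T) i * fps_nth (g k T) (j - i)) (x i * y (j - i))"
      by (rule converges_mult[OF x y]) (use that i in \<open>auto intro: fps_boundedD[OF m']\<close>)
  qed
  then show ?thesis
    unfolding coeffs_converge_def using fps_bounded_mult[OF m m'] by blast
qed

lemma coeffs_converge_power:
  assumes "coeffs_converge K f" shows "coeffs_converge K (\<lambda>k T. f k T ^ a)"
proof (induction a)
  case 0
  have "\<exists>x. converges (\<lambda>k T. fps_nth 1 j) x" for j :: nat
    using converges_const by blast
  moreover have "fps_bounded K 1 1" by (simp add: fps_bounded_def)
  ultimately show ?case unfolding coeffs_converge_def power_0 by blast
next
  case (Suc a)
  then show ?case using coeffs_converge_mult[OF assms Suc] by simp
qed

end

text \<open>With constant coefficient 1, the k-th coefficient of f^a is a times that of f plus a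
  polynomial in the lower ones.\<close>

lemma fps_power_agree:
  fixes f g :: "real fps"
  assumes "fps_nth f 0 = 1" "fps_nth g 0 = 1" "k \<ge> 1" "\<And>j. j < k \<Longrightarrow> fps_nth f j = fps_nth g j"
  shows "(\<forall>j<k. fps_nth (f ^ a) j = fps_nth (g ^ a) j) \<and>
    fps_nth (f ^ a) k - fps_nth (g ^ a) k = real a * (fps_nth f k - fps_nth g k)"
proof (induction a)
  case (Suc a)
  have low: "fps_nth (f ^ Suc a) j = fps_nth (g ^ Suc a) j" if "j < k" for j
    unfolding power_Suc fps_mult_nth using Suc assms(4) that by (intro sum.cong) auto
  have split: "fps_nth (h * H) k = fps_nth h 0 * fps_nth H k + (\<Sum>i=1..<k. fps_nth h i * fps_nth H (k - i)) +
      fps_nth h k * fps_nth H 0" for h H :: "real fps"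
  proof -
    have "{0..k} = insert 0 (insert k {1..<k})" using assms(3) by auto
    then show ?thesis using assms(3) by (simp add: fps_mult_nth)
  qed
  have "(\<Sum>i=1..<k. fps_nth f i * fps_nth (f ^ a) (k - i)) = (\<Sum>i=1..<k. fps_nth g i * fps_nth (g ^ a) (k - i))"
    using Suc assms(4) by (intro sum.cong) auto
  then have "fps_nth (f ^ Suc a) k - fps_nth (g ^ Suc a) k = real (Suc a) * (fps_nth f k - fps_nth g k)"
    unfolding power_Suc split using Suc assms by (simp add: algebra_simps fps_nth_power_0)
  then show ?case using low by blast
qed simp

context finite_samples
begin

text \<open>The exponent changes with i, so coefficients are recovered one at a time. Cutting the
  series off below j gives a power whose j-th coefficient converges by induction and misses the true
  one by a fixed multiple of the j-th coefficient.\<close>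

lemma coeffs_converge_from_powers:
  assumes f0: "\<And>k T. T \<in> Om k \<Longrightarrow> fps_nth (f k T) 0 = 1"
    and bd: "\<And>K. \<exists>m. \<forall>k. \<forall>T\<in>Om k. fps_bounded K m (f k T)"
    and R: "\<And>i. i \<ge> 1 \<Longrightarrow> \<exists>x. converges (\<lambda>k T. fps_nth (f k T ^ (2 * i - 1)) i) x"
  shows "\<exists>x. converges (\<lambda>k T. fps_nth (f k T) j) x"
proof (induction j rule: less_induct)
  case (less j)
  show ?case
  proof (cases "j = 0")
    case True
    then show ?thesis using converges_transfer[OF converges_const[of 1], of "\<lambda>k T. fps_nth (f k T) j"] f0
      by blast
  next
    case False
    define a where "a = 2 * j - 1"
    have a: "a \<ge> 1" using False by (simp add: a_def)
    let ?g = "\<lambda>k T. fps_cutoff j (f k T)"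
    obtain m where m: "\<And>k T. T \<in> Om k \<Longrightarrow> fps_bounded j m (f k T)" using bd by blast
    have "fps_bounded j m (?g k T)" if "T \<in> Om k" for k T
      using m[OF that] fps_bounded_nonneg[OF m[OF that]] by (auto simp: fps_bounded_def)
    moreover have "\<exists>x. converges (\<lambda>k T. fps_nth (?g k T) i) x" if "i \<le> j" for i
      using less[of i] converges_const by (cases "i < j") auto
    ultimately have "coeffs_converge j ?g" unfolding coeffs_converge_def by blast
    from coeffs_converge_power[OF this, of a]
    obtain x where x: "converges (\<lambda>k T. fps_nth (?g k T ^ a) j) x" unfolding coeffs_converge_def by blast
    obtain y where y: "converges (\<lambda>k T. fps_nth (f k T ^ a) j) y" using R[of j] False by (auto simp: a_def)
    have "fps_nth (f k T) j = 1 / real a * (fps_nth (f k T ^ a) j - fps_nth (?g k T ^ a) j)"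
      if "T \<in> Om k" for k T
      using fps_power_agree[of "f k T" "?g k T" j a] f0[OF that] False a by simp
    then have "converges (\<lambda>k T. fps_nth (f k T) j) (1 / real a * (y - x))"
      by (rule converges_transfer[OF converges_cmult[OF converges_diff[OF y x]]])
    then show ?thesis by blast
  qed
qed

lemma log_derivative_nth:
  fixes f s :: "real fps"
  assumes "fps_X * fps_deriv f = - (f * s)" "fps_nth f 0 = 1" "fps_nth s 0 = 0"
  shows "real j * fps_nth f j = - (\<Sum>i=1..j. fps_nth s i * fps_nth f (j - i))"
proof -
  have "real j * fps_nth f j = fps_nth (fps_X * fps_deriv f) j" by (cases j) auto
  also have "\<dots> = - (\<Sum>i=0..j. fps_nth s i * fps_nth f (j - i))"
    unfolding assms(1) mult.commute[of f s] by (simp add: fps_mult_nth)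
  also have "(\<Sum>i=0..j. fps_nth s i * fps_nth f (j - i)) = (\<Sum>i=1..j. fps_nth s i * fps_nth f (j - i))"
  proof -
    have "{0..j} = insert 0 {1..j}" by auto
    then show ?thesis using assms(3) by simp
  qed
  finally show ?thesis .
qed

text \<open>Newton's identities solved in both directions: for s because f has constant coefficient
  1, for f by dividing by j.\<close>

lemma log_derivative_converges:
  assumes eq: "\<And>k T. T \<in> Om k \<Longrightarrow> fps_X * fps_deriv (f k T) = - (f k T * s k T)"
    and f0: "\<And>k T. T \<in> Om k \<Longrightarrow> fps_nth (f k T) 0 = 1" and s0: "\<And>k T. T \<in> Om k \<Longrightarrow> fps_nth (s k T) 0 = 0"
    and bd: "\<And>K. \<exists>m. \<forall>k. \<forall>T\<in>Om k. fps_bounded K m (f k T)"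
  shows "(\<forall>j. \<exists>x. converges (\<lambda>k T. fps_nth (f k T) j) x) \<longleftrightarrow> (\<forall>j. \<exists>x. converges (\<lambda>k T. fps_nth (s k T) j) x)"
    (is "?L \<longleftrightarrow> ?R")
proof
  assume ?L
  then obtain x where x: "\<And>j. converges (\<lambda>k T. fps_nth (f k T) j) (x j)" by metis
  have "\<exists>y. converges (\<lambda>k T. fps_nth (s k T) j) y" for j
  proof (induction j rule: less_induct)
    case (less j)
    show ?case
    proof (cases "j = 0")
      case True
      then show ?thesis using converges_transfer[OF converges_const[of 0], of "\<lambda>k T. fps_nth (s k T) j"] s0
        by blast
    next
      case False
      obtain y where y: "\<And>i. i < j \<Longrightarrow> converges (\<lambda>k T. fps_nth (s k T) i) (y i)" using less by metis
      obtain m where m: "\<And>k T. T \<in> Om k \<Longrightarrow> fps_bounded j m (f k T)" using bd by blast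
      have rec: "fps_nth (s k T) j = (- real j) * fps_nth (f k T) j - (\<Sum>i=1..<j. fps_nth (s k T) i * fps_nth (f k T) (j - i))"
        if "T \<in> Om k" for k T
      proof -
        have "{1..j} = insert j {1..<j}" using False by auto
        then show ?thesis using log_derivative_nth[OF eq[OF that] f0[OF that] s0[OF that], of j] f0[OF that]
          by simp
      qed
      have lim: "converges (\<lambda>k T. (- real j) * fps_nth (f k T) j - (\<Sum>i=1..<j. fps_nth (s k T) i * fps_nth (f k T) (j - i)))
          ((- real j) * x j - (\<Sum>i=1..<j. y i * x (j - i)))"
      proof (intro converges_diff converges_cmult converges_sum x)
        fix i assume "i \<in> {1..<j}"
        then show "converges (\<lambda>k T. fps_nth (s k T) i * fps_nth (f k T) (j - i)) (y i * x (j - i))"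
          by (intro converges_mult[OF y x, where B = m]) (auto intro: fps_boundedD[OF m])
      qed
      show ?thesis by (rule exI, rule converges_transfer[OF lim rec])
    qed
  qed
  then show ?R by blast
next
  assume ?R
  then obtain y where y: "\<And>j. converges (\<lambda>k T. fps_nth (s k T) j) (y j)" by metis
  have "\<exists>x. converges (\<lambda>k T. fps_nth (f k T) j) x" for j
  proof (induction j rule: less_induct)
    case (less j)
    show ?case
    proof (cases "j = 0")
      case True
      then show ?thesis using converges_transfer[OF converges_const[of 1], of "\<lambda>k T. fps_nth (f k T) j"] f0
        by blast
    next
      case False
      obtain x where x: "\<And>i. i < j \<Longrightarrow> converges (\<lambda>k T. fps_nth (f k T) i) (x i)" using less by metis
      obtain m where m: "\<And>k T. T \<in> Om k \<Longrightarrow> fps_bounded j m (f k T)" using bd by blast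
      have rec: "fps_nth (f k T) j = (- 1 / real j) * (\<Sum>i=1..j. fps_nth (s k T) i * fps_nth (f k T) (j - i))"
        if "T \<in> Om k" for k T
        using log_derivative_nth[OF eq[OF that] f0[OF that] s0[OF that], of j] False by (simp add: field_simps)
      have lim: "converges (\<lambda>k T. (- 1 / real j) * (\<Sum>i=1..j. fps_nth (s k T) i * fps_nth (f k T) (j - i)))
          ((- 1 / real j) * (\<Sum>i=1..j. y i * x (j - i)))"
      proof (intro converges_cmult converges_sum)
        fix i assume i: "i \<in> {1..j}"
        then show "converges (\<lambda>k T. fps_nth (s k T) i * fps_nth (f k T) (j - i)) (y i * x (j - i))"
          by (intro converges_mult[OF y x, where B = m]) (auto intro: fps_boundedD[OF m])
      qed
      show ?thesis by (rule exI, rule converges_transfer[OF lim rec])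
    qed
  qed
  then show ?L by blast
qed

end

subsection \<open>Logarithmic derivative of the shape series\<close>

definition box_log_deriv :: "real \<Rightarrow> nat \<Rightarrow> real fps" where
  "box_log_deriv \<nu> c = - (fps_X * fps_deriv (box_factor \<nu> c) * inverse (box_factor \<nu> c))"

lemma box_factor_0: "fps_nth (box_factor \<nu> c) 0 = 1"
  by (simp add: box_factor_def box_series_def)

lemma box_log_deriv_eq:
  "fps_X * fps_deriv (box_factor \<nu> c) = - (box_factor \<nu> c * box_log_deriv \<nu> c)"
proof -
  have "inverse (box_factor \<nu> c) * box_factor \<nu> c = 1"
    using inverse_mult_eq_1[of "box_factor \<nu> c"] box_factor_0 by simp
  then have "fps_X * fps_deriv (box_factor \<nu> c) * (inverse (box_factor \<nu> c) * box_factor \<nu> c) =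
      fps_X * fps_deriv (box_factor \<nu> c)" by simp
  then show ?thesis unfolding box_log_deriv_def by (simp add: mult_ac)
qed

text \<open>Taking logarithmic derivatives turns the product over boxes into a sum, from which
  moments can be read off.\<close>

lemma shape_log_deriv:
  assumes "finite D"
  shows "fps_X * fps_deriv (shape_series \<nu> D) = - (shape_series \<nu> D * (\<Sum>b\<in>D. box_log_deriv \<nu> (box_content b)))"
  using assms
proof (induction rule: finite_induct)
  case (insert b D)
  let ?f = "box_factor \<nu> (box_content b)" and ?P = "shape_series \<nu> D"
  have eq: "shape_series \<nu> (insert b D) = ?f * ?P" using insert by (simp add: shape_series_def)
  have "fps_X * fps_deriv (?f * ?P) = (fps_X * fps_deriv ?f) * ?P + ?f * (fps_X * fps_deriv ?P)"
    by (simp add: algebra_simps)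
  also have "\<dots> = - (?f * ?P * (box_log_deriv \<nu> (box_content b) + (\<Sum>b\<in>D. box_log_deriv \<nu> (box_content b))))"
    unfolding box_log_deriv_eq insert.IH by (simp add: algebra_simps)
  finally show ?case unfolding eq using insert by simp
qed (simp add: shape_series_def)

text \<open>The recursion for the inverse is majorised by a geometric sum: the terms (1 + E)^i E
  with i < j add up to (1 + E)^j - 1.\<close>

lemma fps_inverse_bounded:
  fixes f :: "real fps"
  assumes f0: "fps_nth f 0 = 1" and E: "E \<ge> 0" "\<And>i. 1 \<le> i \<Longrightarrow> i \<le> K \<Longrightarrow> \<bar>fps_nth f i\<bar> \<le> E" and j: "j \<le> K"
  shows "\<bar>fps_nth (inverse f) j\<bar> \<le> (1 + E) ^ j"
  using j
proof (induction j rule: less_induct)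
  case (less j)
  show ?case
  proof (cases "j = 0")
    case True
    then show ?thesis using f0 by simp
  next
    case False
    have "0 = fps_nth (inverse f * f) j" using False inverse_mult_eq_1[of f] f0 by simp
    also have "\<dots> = (\<Sum>i=0..j. fps_nth (inverse f) i * fps_nth f (j - i))" by (rule fps_mult_nth)
    also have "{0..j} = insert j {..<j}" by auto
    finally have "fps_nth (inverse f) j = - (\<Sum>i<j. fps_nth (inverse f) i * fps_nth f (j - i))"
      using f0 by simp
    then have "\<bar>fps_nth (inverse f) j\<bar> \<le> (\<Sum>i<j. \<bar>fps_nth (inverse f) i * fps_nth f (j - i)\<bar>)"
      by (simp only: abs_minus_cancel sum_abs)
    also have "\<dots> \<le> (\<Sum>i<j. (1 + E) ^ i * E)"
      unfolding abs_mult using less E by (intro sum_mono mult_mono) auto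
    also have "\<dots> = (1 + E) ^ j - 1"
      by (induction j) (simp_all add: algebra_simps)
    finally show ?thesis by simp
  qed
qed

text \<open>With \<open>box_factor\<close> written as 1 - x the series is u x' / (1 - x). Replacing
  1 / (1 - x) by 1 costs a second factor x, hence another 1 / \<nu>.\<close>

lemma box_log_deriv_estimate:
  assumes M: "M \<ge> 1"
  shows "\<exists>B\<ge>0. \<forall>\<nu> c. \<nu> \<ge> 1 \<longrightarrow> box_weight \<nu> c \<le> M \<longrightarrow>
    \<bar>fps_nth (box_log_deriv \<nu> c) i - real i / \<nu> * fps_nth (box_series (box_weight \<nu> c)) i\<bar> \<le> B / \<nu>\<^sup>2"
proof -
  define E where "E = 4 * real i * M ^ i"
  define q where "q = real (i + 1)"
  define B where "B = q * (q * (real i * E * (1 + E) ^ i) * E)"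
  have E: "E \<ge> 0" using M by (simp add: E_def)
  have B: "B \<ge> 0" using E by (simp add: B_def q_def)
  have "\<bar>fps_nth (box_log_deriv \<nu> c) i - real i / \<nu> * fps_nth (box_series (box_weight \<nu> c)) i\<bar> \<le> B / \<nu>\<^sup>2"
    if nu: "\<nu> \<ge> 1" and w: "box_weight \<nu> c \<le> M" for \<nu> c
  proof -
    define e where "e = box_series (box_weight \<nu> c)"
    define x where "x = fps_const (1 / \<nu>) * e"
    define t where "t = fps_X * fps_deriv x"
    define g where "g = inverse (box_factor \<nu> c)"
    have eb: "fps_bounded i E e"
      unfolding e_def E_def using nu w M box_weight_nonneg[of \<nu> c] by (intro box_series_bounded) auto
    then have xb: "fps_bounded i (E / \<nu>) x"
      using fps_bounded_cmult[of i E e "1 / \<nu>"] nu by (simp add: x_def)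
    have "E / \<nu> \<le> E / 1" using nu E by (intro divide_left_mono) auto
    then have xE: "fps_bounded i E x" using fps_bounded_mono[OF xb] by simp
    have f: "box_factor \<nu> c = 1 - x" by (simp add: box_factor_def x_def e_def)
    have gb: "fps_bounded i ((1 + E) ^ i) g"
      unfolding fps_bounded_def
    proof (intro allI impI)
      fix j assume j: "j \<le> i"
      have "\<bar>fps_nth g j\<bar> \<le> (1 + E) ^ j"
        unfolding g_def
      proof (rule fps_inverse_bounded[OF _ E _ j])
        show "fps_nth (box_factor \<nu> c) 0 = 1" by (rule box_factor_0)
        fix l assume "1 \<le> l" "l \<le> i"
        then show "\<bar>fps_nth (box_factor \<nu> c) l\<bar> \<le> E" using fps_boundedD[OF xE, of l] by (simp add: f)
      qed
      also have "\<dots> \<le> (1 + E) ^ i" using E j by (intro power_increasing) auto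
      finally show "\<bar>fps_nth g j\<bar> \<le> (1 + E) ^ i" .
    qed
    have tn: "fps_nth t j = real j * fps_nth x j" for j by (cases j) (auto simp: t_def)
    have tb: "fps_bounded i (real i * E / \<nu>) t"
      unfolding fps_bounded_def
    proof (intro allI impI)
      fix j assume j: "j \<le> i"
      have "\<bar>fps_nth t j\<bar> = real j * \<bar>fps_nth x j\<bar>" by (simp add: tn abs_mult)
      also have "\<dots> \<le> real i * (E / \<nu>)" using fps_boundedD[OF xb j] j by (intro mult_mono) auto
      finally show "\<bar>fps_nth t j\<bar> \<le> real i * E / \<nu>" by simp
    qed
    have kap: "box_log_deriv \<nu> c = t * g"
      unfolding box_log_deriv_def f t_def g_def by simp
    have "g * (1 - x) = 1" unfolding g_def f[symmetric]
      using inverse_mult_eq_1[of "box_factor \<nu> c"] box_factor_0 by simp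
    then have "g = 1 + g * x" by (simp add: algebra_simps)
    then have "t * g = t + t * g * x" by (metis distrib_left mult.assoc mult_1_right)
    then have "fps_nth (box_log_deriv \<nu> c) i - fps_nth t i = fps_nth (t * g * x) i"
      unfolding kap by (metis add_diff_cancel_left' fps_sub_nth)
    moreover have "fps_bounded i (q * (q * (real i * E / \<nu> * (1 + E) ^ i) * (E / \<nu>))) (t * g * x)"
      unfolding q_def by (intro fps_bounded_mult tb gb xb)
    then have "\<bar>fps_nth (t * g * x) i\<bar> \<le> B / \<nu>\<^sup>2"
      using fps_boundedD[of i _ "t * g * x" i] by (simp add: B_def power2_eq_square mult_ac)
    moreover have "fps_nth t i = real i / \<nu> * fps_nth e i" by (simp add: tn x_def)
    ultimately show ?thesis unfolding e_def by simp
  qed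
  then show ?thesis using B by blast
qed

definition box_moment :: "real \<Rightarrow> nat \<Rightarrow> (nat \<times> nat) set \<Rightarrow> real" where
  "box_moment \<nu> j D = (\<Sum>b\<in>D. box_weight \<nu> (box_content b) ^ j) / \<nu>"

text \<open>There are at most \<nu> boxes with an error of order 1 / \<nu>^2 each, so log-derivative
  coefficients and weight moments have proportional limits.\<close>

lemma shape_log_deriv_estimate:
  assumes M: "M \<ge> 1"
  shows "\<exists>B\<ge>0. \<forall>\<nu> D. \<nu> \<ge> 1 \<longrightarrow> bounded_shape \<nu> M D \<longrightarrow>
    \<bar>fps_nth (\<Sum>b\<in>D. box_log_deriv \<nu> (box_content b)) (Suc j) -
       real (Suc j) * (4 * real (Suc j) - 2) * box_moment \<nu> j D\<bar> \<le> B / \<nu>"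
proof -
  obtain B where B: "B \<ge> 0" and est: "\<And>\<nu> c. \<nu> \<ge> 1 \<Longrightarrow> box_weight \<nu> c \<le> M \<Longrightarrow>
    \<bar>fps_nth (box_log_deriv \<nu> c) (Suc j) - real (Suc j) / \<nu> * fps_nth (box_series (box_weight \<nu> c)) (Suc j)\<bar> \<le> B / \<nu>\<^sup>2"
    using box_log_deriv_estimate[OF M, of "Suc j"] by blast
  have "\<bar>fps_nth (\<Sum>b\<in>D. box_log_deriv \<nu> (box_content b)) (Suc j) -
       real (Suc j) * (4 * real (Suc j) - 2) * box_moment \<nu> j D\<bar> \<le> B / \<nu>"
    if nu: "\<nu> \<ge> 1" and D: "bounded_shape \<nu> M D" for \<nu> D
  proof -
    have "real (Suc j) * (4 * real (Suc j) - 2) * box_moment \<nu> j D =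
      (\<Sum>b\<in>D. real (Suc j) / \<nu> * fps_nth (box_series (box_weight \<nu> (box_content b))) (Suc j))"
      unfolding box_moment_def box_series_def fps_nth_Abs_fps sum_divide_distrib sum_distrib_left
      by (rule sum.cong) auto
    then have "\<bar>fps_nth (\<Sum>b\<in>D. box_log_deriv \<nu> (box_content b)) (Suc j) -
       real (Suc j) * (4 * real (Suc j) - 2) * box_moment \<nu> j D\<bar> =
      \<bar>\<Sum>b\<in>D. fps_nth (box_log_deriv \<nu> (box_content b)) (Suc j) -
         real (Suc j) / \<nu> * fps_nth (box_series (box_weight \<nu> (box_content b))) (Suc j)\<bar>"
      by (simp only: fps_sum_nth sum_subtractf)
    also have "\<dots> \<le> (\<Sum>b\<in>D. B / \<nu>\<^sup>2)"
      using D by (intro order_trans[OF sum_abs] sum_mono est nu) (auto simp: bounded_shape_def)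
    also have "\<dots> = real (card D) * (B / \<nu>\<^sup>2)" by simp
    also have "\<dots> \<le> \<nu> * (B / \<nu>\<^sup>2)" using D B by (intro mult_right_mono) (auto simp: bounded_shape_def)
    also have "\<dots> = B / \<nu>" using nu by (simp add: power2_eq_square)
    finally show ?thesis .
  qed
  then show ?thesis using B by blast
qed

section \<open>Diagonals and profiles\<close>

definition diag_count :: "nat \<Rightarrow> (nat \<times> nat) set \<Rightarrow> nat" where
  "diag_count c D = card {b \<in> D. box_content b = c}"

text \<open>The diagonal of content c meets each row longer than c exactly once and no other
  row.\<close>

lemma diag_count_seq:
  assumes xi: "strict_seq xi"
  shows "diag_count c (seq_diagram xi) = card {y. c < xi y}"
proof -
  have "bij_betw (\<lambda>y. (Suc (y + c), y)) {y. c < xi y} {b \<in> seq_diagram xi. box_content b = c}"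
    by (rule bij_betw_byWitness[where f' = snd]) (auto simp: seq_diagram_def box_content_def)
  from bij_betw_same_card[OF this] show ?thesis unfolding diag_count_def by (rule sym)
qed

lemma finite_long_rows:
  assumes "strict_seq xi" shows "finite {y. c < xi y}"
  by (rule finite_subset[of _ "{y. xi y > 0}"]) (use assms in \<open>auto simp: strict_seq_def\<close>)

lemma long_rows_eq:
  assumes xi: "strict_seq xi"
  shows "{y. c < xi y} = {1..diag_count c (seq_diagram xi)}"
proof (cases "{y. c < xi y} = {}")
  case True
  then show ?thesis unfolding diag_count_seq[OF xi] by simp
next
  case False
  define L where "L = Max {y. c < xi y}"
  have L: "c < xi L" "\<And>y. c < xi y \<Longrightarrow> y \<le> L"
    using Max_in[OF finite_long_rows[OF xi] False] Max_ge[OF finite_long_rows[OF xi]] by (auto simp: L_def)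
  have "{y. c < xi y} = {1..L}"
  proof (intro set_eqI iffI)
    fix y assume "y \<in> {y. c < xi y}"
    then show "y \<in> {1..L}" using L(2)[of y] strict_seq_pos[OF xi, of y] by simp
  next
    fix y assume "y \<in> {1..L}"
    then show "y \<in> {y. c < xi y}" using strict_seq_gap[OF xi, of L y] L(1) by auto
  qed
  then show ?thesis unfolding diag_count_seq[OF xi] by simp
qed

lemma diag_count_antimono:
  assumes "shape D" "c \<le> c'" shows "diag_count c' D \<le> diag_count c D"
proof -
  obtain xi where xi: "strict_seq xi" "D = seq_diagram xi" using assms by (auto simp: shape_def)
  show ?thesis unfolding xi(2) diag_count_seq[OF xi(1)]
    using assms(2) by (intro card_mono finite_long_rows[OF xi(1)]) auto
qed

text \<open>Parts are distinct, so moving to the next diagonal loses at most one row, the one ending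
  on the diagonal just left.\<close>

lemma diag_count_lipschitz:
  assumes "shape D" shows "diag_count c D \<le> diag_count (c + i) D + i"
proof (induction i)
  case (Suc i)
  obtain xi where xi: "strict_seq xi" "D = seq_diagram xi" using assms by (auto simp: shape_def)
  have "{y. c + i < xi y} \<subseteq> {y. c + Suc i < xi y} \<union> {y. xi y = c + Suc i}" by auto
  then have "card {y. c + i < xi y} \<le> card ({y. c + Suc i < xi y} \<union> {y. xi y = c + Suc i})"
    by (rule card_mono[rotated]) (auto intro: finite_long_rows[OF xi(1)]
        finite_subset[OF _ finite_long_rows[OF xi(1), of "c + i"]])
  also have "\<dots> \<le> card {y. c + Suc i < xi y} + card {y. xi y = c + Suc i}" by (rule card_Un_le)
  also have "card {y. xi y = c + Suc i} \<le> Suc 0"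
  proof (rule card_le_Suc0_iff_eq[THEN iffD2])
    show "finite {y. xi y = c + Suc i}"
      by (rule finite_subset[OF _ finite_long_rows[OF xi(1), of "c + i"]]) auto
    show "\<forall>y\<in>{y. xi y = c + Suc i}. \<forall>y'\<in>{y. xi y = c + Suc i}. y = y'"
      using strict_seq_inj[OF xi(1)] by (auto simp: inj_on_def)
  qed
  finally show ?case using Suc unfolding xi(2) diag_count_seq[OF xi(1)] by simp
qed simp

lemma diag_count_dist:
  assumes "shape D"
  shows "\<bar>real (diag_count c D) - real (diag_count c' D)\<bar> \<le> \<bar>real c - real c'\<bar>"
proof -
  have *: "\<bar>real (diag_count c D) - real (diag_count c' D)\<bar> \<le> \<bar>real c - real c'\<bar>" if "c \<le> c'" for c c'
    using diag_count_antimono[OF assms that] diag_count_lipschitz[OF assms, of c "c' - c"] that by simp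
  show ?thesis using *[of c c'] *[of c' c] by (cases "c \<le> c'") auto
qed

text \<open>Distinct parts make the first row at least as long as the number of rows, and the
  content of its last box is below n.\<close>

lemma diag_count_le:
  assumes D: "shape D" and b: "\<And>b. b \<in> D \<Longrightarrow> box_content b < n"
  shows "diag_count c D \<le> n"
proof -
  obtain xi where xi: "strict_seq xi" "D = seq_diagram xi" using D by (auto simp: shape_def)
  define L where "L = diag_count 0 D"
  have "L \<le> n"
  proof (cases "L = 0")
    case False
    then have "L \<in> {y. 0 < xi y}" using long_rows_eq[OF xi(1), of 0] by (auto simp: L_def xi(2))
    then have "xi L + (L - 1) \<le> xi 1" using strict_seq_gap[OF xi(1), of L 1] False by simp
    moreover have "xi L > 0" using \<open>L \<in> {y. 0 < xi y}\<close> by simp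
    ultimately have "L \<le> xi 1" "xi 1 > 0" using False by linarith+
    then have "(Suc (xi 1), 1) \<in> D" by (auto simp: xi(2) seq_diagram_def)
    then have "xi 1 \<le> n" using b[of "(Suc (xi 1), 1)"] \<open>xi 1 > 0\<close> by (simp add: box_content_def)
    then show ?thesis using \<open>L \<le> xi 1\<close> by simp
  qed simp
  then show ?thesis using diag_count_antimono[OF D, of 0 c] by (simp add: L_def)
qed

lemma diag_count_0:
  assumes "\<And>b. b \<in> D \<Longrightarrow> box_content b < c" shows "diag_count c D = 0"
proof -
  have "{b \<in> D. box_content b = c} = {}" using assms by fastforce
  then show ?thesis unfolding diag_count_def by (simp only: card.empty)
qed

lemma sum_by_content:
  assumes "finite D" "\<And>b. b \<in> D \<Longrightarrow> box_content b < K"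
  shows "(\<Sum>b\<in>D. g (box_content b)) = (\<Sum>c<K. real (diag_count c D) * g c)"
proof -
  have "(\<Sum>c<K. real (diag_count c D) * g c) = (\<Sum>c<K. \<Sum>b\<in>{b \<in> D. box_content b = c}. g (box_content b))"
    by (rule sum.cong) (auto simp: diag_count_def)
  also have "\<dots> = (\<Sum>b\<in>D. g (box_content b))"
    using assms by (intro sum.group) auto
  finally show ?thesis by simp
qed

lemma diag_count_mono:
  assumes "finite D" "E \<subseteq> D" shows "diag_count c E \<le> diag_count c D"
  unfolding diag_count_def using assms by (intro card_mono) auto

text \<open>If diagonal c grows by d, diagonal c + i grows by at least d - i: D loses at most one
  box per diagonal and E gains none. Together these are d (d + 1) / 2 new boxes.\<close>

lemma diag_count_growth:
  assumes D: "shape D" and E: "shape E" "E \<subseteq> D"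
  shows "(diag_count c D - diag_count c E)\<^sup>2 \<le> 2 * (card D - card E)"
proof -
  define d where "d = diag_count c D - diag_count c E"
  have fin: "finite D" "finite E" using D E shape_finite by auto
  have low: "d - i \<le> diag_count (c + i) D - diag_count (c + i) E" if "i < d" for i
    using diag_count_lipschitz[OF D, of c i] diag_count_antimono[OF E(1), of c "c + i"] by (simp add: d_def)
  have diff: "card {b \<in> D - E. box_content b = x} = diag_count x D - diag_count x E" for x
  proof -
    have "{b \<in> D - E. box_content b = x} = {b \<in> D. box_content b = x} - {b \<in> E. box_content b = x}" by auto
    then show ?thesis using E fin by (simp add: diag_count_def card_Diff_subset Collect_mono_iff subset_iff)
  qed
  have "d * (d + 1) = 2 * (\<Sum>i<d. d - i)"
  proof -
    have "(\<Sum>i<d. d - i) = (\<Sum>i<d. Suc i)"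
      by (rule sum.reindex_bij_witness[of _ "\<lambda>i. d - Suc i" "\<lambda>i. d - Suc i"]) auto
    moreover have "d * (d + 1) = 2 * (\<Sum>i<d. Suc i)" by (induction d) auto
    ultimately show ?thesis by simp
  qed
  also have "(\<Sum>i<d. d - i) \<le> (\<Sum>i<d. card {b \<in> D - E. box_content b = c + i})"
    unfolding diff using low by (intro sum_mono) auto
  also have "\<dots> = card (\<Union>i<d. {b \<in> D - E. box_content b = c + i})"
    using fin by (intro card_UN_disjoint[symmetric]) auto
  also have "\<dots> \<le> card (D - E)" using fin by (intro card_mono) auto
  also have "\<dots> = card D - card E" using E fin by (simp add: card_Diff_subset)
  finally show ?thesis by (simp add: d_def[symmetric] power2_eq_square)
qed

lemma strict_seq_nth_part:
  assumes "ys \<in> strict_partitions n"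
  shows "strict_seq (nth_part ys)" "shifted_diagram ys = seq_diagram (nth_part ys)"
    "parts (nth_part ys) = set ys"
proof -
  have s: "sorted_wrt (>) ys" and pos: "\<And>p. p \<in> set ys \<Longrightarrow> p > 0"
    using assms by (auto simp: strict_partitions_def)
  have "finite {y. nth_part ys y > 0}"
    by (rule finite_subset[of _ "{..length ys}"]) (auto simp: nth_part_def split: if_splits)
  moreover have "nth_part ys (Suc y) = 0 \<or> nth_part ys (Suc y) < nth_part ys y" if "y \<ge> 1" for y
  proof (cases "Suc y \<le> length ys")
    case True
    then show ?thesis using sorted_wrt_nth_less[OF s, of "y - 1" y] that by (simp add: nth_part_def)
  qed (simp add: nth_part_def)
  moreover have "nth_part ys 0 = 0" by (simp add: nth_part_def)
  ultimately show "strict_seq (nth_part ys)"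
    unfolding strict_seq_def by blast
  show "shifted_diagram ys = seq_diagram (nth_part ys)"
    by (auto simp: shifted_diagram_def seq_diagram_def nth_part_def split: if_splits)
  show "parts (nth_part ys) = set ys"
  proof (intro set_eqI iffI)
    fix p assume "p \<in> parts (nth_part ys)"
    then show "p \<in> set ys" by (auto simp: parts_def nth_part_def split: if_splits)
  next
    fix p assume p: "p \<in> set ys"
    then obtain i where "i < length ys" "ys ! i = p" by (auto simp: in_set_conv_nth)
    then have "nth_part ys (Suc i) = p" by (simp add: nth_part_def)
    then show "p \<in> parts (nth_part ys)" using pos[OF p] partsI[of "nth_part ys" "Suc i"] by simp
  qed
qed

lemma shape_shifted_diagram:
  assumes "ys \<in> strict_partitions n" shows "shape (shifted_diagram ys)"
  unfolding shape_def
  by (intro exI[of _ "nth_part ys"] conjI strict_seq_nth_part(1,2)[OF assms])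

lemma card_shifted_diagram:
  assumes "ys \<in> strict_partitions n" shows "card (shifted_diagram ys) = n"
proof -
  have "sorted_wrt (>) ys" using assms by (simp add: strict_partitions_def)
  then have "distinct ys" by (induction ys) auto
  then show ?thesis
    using strict_seq_nth_part[OF assms] card_seq_diagram[of "nth_part ys"] assms
    by (simp add: strict_partitions_def distinct_sum_list_conv_Sum)
qed

lemma shifted_tableaux_eq:
  assumes "ys \<in> strict_partitions n"
  shows "shifted_tableaux ys = linear_extensions (shifted_diagram ys)"
proof -
  have "sum_list ys = n" using assms by (simp add: strict_partitions_def)
  then show ?thesis
    unfolding shifted_tableaux_def linear_extensions_def card_shifted_diagram[OF assms] by (simp only:)
qed

text \<open>The line of abscissa z meets only boxes of content near z, and the highest of them lies
  in a row close to the length of the diagonal. The bound 2 absorbs the half-unit shifts and a slip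
  by one diagonal.\<close>

lemma profile_estimate:
  assumes ys: "ys \<in> strict_partitions n" and z: "z \<ge> 0"
  shows "\<bar>profile ys z - (z + 2 * real (diag_count (nat \<lfloor>z\<rfloor>) (shifted_diagram ys)))\<bar> \<le> 2"
proof -
  define xi where "xi = nth_part ys"
  define D where "D = shifted_diagram ys"
  define c where "c = nat \<lfloor>z\<rfloor>"
  define N where "N = diag_count c D"
  have xi: "strict_seq xi" "D = seq_diagram xi" using strict_seq_nth_part[OF ys] by (auto simp: xi_def D_def)
  have sh: "shape D" using xi by (auto simp: shape_def)
  have c: "real c \<le> z" "z < real c + 1" using z by (auto simp: c_def)
  have up: "t \<le> z + 2 * real N + 2" if t: "t \<in> profile_heights ys z" for t
  proof -
    obtain x y where xy: "t = x + y - 1 / 2" "(x, y) \<in> shifted_region ys" "x - y - 1 / 2 = z"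
      using t by (auto simp: profile_heights_def)
    then obtain X Y where XY: "(X, Y) \<in> D" "real X - 1 \<le> x" "x \<le> real X" "real Y - 1 \<le> y" "y \<le> real Y"
      by (auto simp: shifted_region_def D_def)
    have b: "Y < X" "X \<le> Y + xi Y" using XY(1) by (auto simp: xi(2) seq_diagram_def)
    define c' where "c' = X - Y - 1"
    have c': "real c' = real X - real Y - 1" using b by (simp add: c'_def of_nat_diff)
    \<comment> \<open>A point of abscissa z can lie in a box of content as small as c - 1, whose
      diagonal may be longer by one.\<close>
    have "real c' \<ge> z - 3 / 2" using c' XY xy by linarith
    then have "real c' > real c - 2" using c by linarith
    then have cc: "c \<le> c' + 1" by linarith
    have "c' < xi Y" using b unfolding c'_def by linarith
    then have "Y \<in> {y. c' < xi y}" by simp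
    then have "Y \<in> {1..diag_count c' D}" unfolding long_rows_eq[OF xi(1)] xi(2) .
    then have "Y \<le> diag_count c' D" by simp
    also have "\<dots> \<le> diag_count (c' + 1) D + 1" by (rule diag_count_lipschitz[OF sh])
    also have "\<dots> \<le> N + 1" unfolding N_def using diag_count_antimono[OF sh cc] by simp
    finally have "real Y \<le> real N + 1" by linarith
    then show ?thesis using xy XY by linarith
  qed
  \<comment> \<open>The witness is the point of the line at half the height of the top box of
    diagonal c.\<close>
  have low: "z + 2 * real N - 1 \<in> profile_heights ys z" if N: "N > 0"
  proof -
    have "N \<in> {y. c < xi y}" unfolding long_rows_eq[OF xi(1)] using N by (simp add: N_def xi(2))
    then have "(Suc (N + c), N) \<in> D" by (auto simp: xi(2) seq_diagram_def)
    moreover have "real (Suc (N + c)) - 1 \<le> z + real N" "z + real N \<le> real (Suc (N + c))"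
      "real N - 1 \<le> real N - 1 / 2" "real N - 1 / 2 \<le> real N" using c by auto
    ultimately have "(z + real N, real N - 1 / 2) \<in> shifted_region ys"
      unfolding shifted_region_def D_def by force
    then show ?thesis unfolding profile_heights_def
      by (intro CollectI exI[of _ "z + real N"] exI[of _ "real N - 1 / 2"]) auto
  qed
  have bdd: "bdd_above (profile_heights ys z)" using up by (auto simp: bdd_above_def)
  have abs: "\<bar>z\<bar> = z" using z by simp
  have "z + 2 * real N - 1 \<le> profile ys z"
  proof (cases "N = 0")
    case True
    then show ?thesis using z by (auto simp: profile_def)
  next
    case False
    then have "z + 2 * real N - 1 \<le> Sup (profile_heights ys z)" using cSup_upper[OF low bdd] by simp
    then show ?thesis using low False by (auto simp: profile_def abs)
  qed
  moreover have "profile ys z \<le> z + 2 * real N + 2"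
  proof (cases "profile_heights ys z = {}")
    case False
    then have "Sup (profile_heights ys z) \<le> z + 2 * real N + 2" using up by (intro cSup_least) auto
    then show ?thesis using False by (simp add: profile_def abs)
  qed (simp add: profile_def abs)
  ultimately show ?thesis unfolding N_def c_def D_def by linarith
qed

section \<open>Riemann sums of step functions\<close>

lemma step_has_integral:
  fixes F :: "nat \<Rightarrow> real"
  assumes r: "r > 0"
  shows "((\<lambda>z. F (nat \<lfloor>r * z\<rfloor>)) has_integral (\<Sum>c<K. F c) / r) {0..real K / r}"
proof (induction K)
  case 0
  show ?case using has_integral_refl(1)[of "\<lambda>z. F (nat \<lfloor>r * z\<rfloor>)" 0] by simp
next
  case (Suc K)
  let ?a = "real K / r" and ?b = "real (Suc K) / r"
  have ab: "0 \<le> ?a" "?a \<le> ?b" using r by (simp_all add: divide_right_mono)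
  have "((\<lambda>_. F K) has_integral (?b - ?a) * F K) {?a..?b}"
    using has_integral_const_real[of "F K" ?a ?b] ab by simp
  then have "((\<lambda>z. F (nat \<lfloor>r * z\<rfloor>)) has_integral (?b - ?a) * F K) {?a..?b}"
  proof (rule has_integral_spike_finite[where S = "{?b}", rotated 2])
    fix z assume "z \<in> {?a..?b} - {?b}"
    then have "real K \<le> r * z" "r * z < real K + 1" using r by (auto simp: field_simps)
    then have "\<lfloor>r * z\<rfloor> = int K" by linarith
    then show "F (nat \<lfloor>r * z\<rfloor>) = F K" by simp
  qed simp
  from has_integral_combine[OF ab Suc this] show ?case
    using r by (simp add: field_simps)
qed

text \<open>The sums are integrals of step functions over one fixed interval, so pointwise
  convergence with a uniform bound suffices, by dominated convergence.\<close>

lemma riemann_sum_limit: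
  fixes F :: "nat \<Rightarrow> nat \<Rightarrow> real"
  assumes r: "\<And>k. r k \<ge> 1" and B: "B \<ge> 0"
    and zero: "\<And>k c. real c \<ge> B * r k \<Longrightarrow> F k c = 0" and bd: "\<And>k c. \<bar>F k c\<bar> \<le> A"
    and lim: "\<And>z. 0 \<le> z \<Longrightarrow> (\<lambda>k. F k (nat \<lfloor>r k * z\<rfloor>)) \<longlonglongrightarrow> f z"
    and K: "\<And>k. real (K k) \<ge> B * r k"
  shows "(\<lambda>k. (\<Sum>c<K k. F k c) / r k) \<longlonglongrightarrow> integral {0..B + 1} f"
proof -
  let ?g = "\<lambda>k z. F k (nat \<lfloor>r k * z\<rfloor>)"
  have int: "(?g k has_integral (\<Sum>c<K k. F k c) / r k) {0..B + 1}" for k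
  proof -
    \<comment> \<open>Rounding \<open>B * r k\<close> up to an integer costs at most
      \<open>r k\<close>; this is why the interval ends at B + 1.\<close>
    define K' where "K' = nat \<lceil>B * r k\<rceil>"
    have rk: "r k > 0" using r[of k] by simp
    have K'1: "real K' \<ge> B * r k" "real K' \<le> B * r k + 1" using B rk by (auto simp: K'_def of_nat_ceiling)
    have "real K' / r k \<le> (B * r k + r k) / r k" using K'1(2) r[of k] rk by (intro divide_right_mono) auto
    also have "\<dots> = B + 1" using rk by (simp add: add_divide_distrib)
    finally have le: "real K' / r k \<le> B + 1" .
    have "K' \<le> K k" using K[of k] by (simp add: K'_def ceiling_le_iff nat_le_iff)
    then have "(\<Sum>c<K k. F k c) = (\<Sum>c<K'. F k c)"
    proof (intro sum.mono_neutral_right ballI)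
      fix c assume "c \<in> {..<K k} - {..<K'}"
      then have "real K' \<le> real c" by simp
      then show "F k c = 0" using K'1(1) by (intro zero) linarith
    qed auto
    then have 1: "(?g k has_integral (\<Sum>c<K k. F k c) / r k) {0..real K' / r k}"
      using step_has_integral[OF rk, of "F k" K'] by simp
    have "?g k z = 0" if "z \<in> {real K' / r k..B + 1}" for z
    proof -
      have "real K' \<le> r k * z" using that rk by (simp add: field_simps)
      then have "K' \<le> nat \<lfloor>r k * z\<rfloor>" by (simp add: le_nat_iff le_floor_iff)
      then show ?thesis using K'1(1) by (intro zero) linarith
    qed
    then have 2: "(?g k has_integral 0) {real K' / r k..B + 1}" by (rule has_integral_is_0)
    show ?thesis using has_integral_combine[OF _ le 1 2] rk by simp
  qed
  have "(\<lambda>k. integral {0..B + 1} (?g k)) \<longlonglongrightarrow> integral {0..B + 1} f"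
  proof (rule dominated_convergence(2)[where h = "\<lambda>_. A"])
    show "?g k integrable_on {0..B + 1}" for k using int by blast
    show "(\<lambda>_. A) integrable_on {0..B + 1}" by (rule integrable_const_ivl)
  qed (use bd lim in auto)
  moreover have "integral {0..B + 1} (?g k) = (\<Sum>c<K k. F k c) / r k" for k
    using int by (rule integral_unique)
  ultimately show ?thesis by simp
qed

section \<open>Limits of level sets\<close>

text \<open>The bridge between geometry and series, crossed forwards for the full shapes and
  backwards for the random sublevels.\<close>

lemma (in finite_samples) moments_converge_iff:
  assumes M: "M \<ge> 1" and nu: "\<And>k. \<nu> k \<ge> 1" and lim: "(\<lambda>k. 1 / \<nu> k) \<longlonglongrightarrow> 0"
    and E: "\<And>k T. T \<in> Om k \<Longrightarrow> bounded_shape (\<nu> k) M (E k T)"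
  shows "(\<forall>j. \<exists>x. converges (\<lambda>k T. box_moment (\<nu> k) j (E k T)) x) \<longleftrightarrow>
    (\<forall>j. \<exists>x. converges (\<lambda>k T. fps_nth (shape_series (\<nu> k) (E k T)) j) x)"
proof -
  define s where "s k T = (\<Sum>b\<in>E k T. box_log_deriv (\<nu> k) (box_content b))" for k T
  have finE: "finite (E k T)" if "T \<in> Om k" for k T
    using E[OF that] shape_finite by (simp add: bounded_shape_def)
  have s0: "fps_nth (s k T) 0 = 0" for k T
    by (simp add: s_def fps_sum_nth box_log_deriv_def)
  have bd: "\<exists>m. \<forall>k. \<forall>T\<in>Om k. fps_bounded K m (shape_series (\<nu> k) (E k T))" for K
  proof (intro exI allI ballI)
    fix k T assume T: "T \<in> Om k"
    have "\<nu> k > 0" using nu[of k] by linarith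
    then show "fps_bounded K (2 * M ^ K) (shape_series (\<nu> k) (E k T))"
      by (rule shape_series_bounded[OF E[OF T] M])
  qed
  have log: "(\<forall>j. \<exists>x. converges (\<lambda>k T. fps_nth (shape_series (\<nu> k) (E k T)) j) x) \<longleftrightarrow>
      (\<forall>j. \<exists>x. converges (\<lambda>k T. fps_nth (s k T) j) x)"
  proof (rule log_derivative_converges[OF _ _ s0 bd])
    fix k T assume T: "T \<in> Om k"
    show "fps_X * fps_deriv (shape_series (\<nu> k) (E k T)) = - (shape_series (\<nu> k) (E k T) * s k T)"
      unfolding s_def by (rule shape_log_deriv[OF finE[OF T]])
    show "fps_nth (shape_series (\<nu> k) (E k T)) 0 = 1"
      using shape_series_nth_1[OF finE[OF T], of "\<nu> k"] by blast
  qed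
  have step: "(\<exists>x. converges (\<lambda>k T. fps_nth (s k T) (Suc j)) x) \<longleftrightarrow>
      (\<exists>x. converges (\<lambda>k T. box_moment (\<nu> k) j (E k T)) x)" for j
  proof -
    define a where "a = real (Suc j) * (4 * real (Suc j) - 2)"
    have a: "a \<noteq> 0" by (simp add: a_def)
    obtain B where B: "\<And>\<nu> D. \<nu> \<ge> 1 \<Longrightarrow> bounded_shape \<nu> M D \<Longrightarrow>
      \<bar>fps_nth (\<Sum>b\<in>D. box_log_deriv \<nu> (box_content b)) (Suc j) - a * box_moment \<nu> j D\<bar> \<le> B / \<nu>"
      using shape_log_deriv_estimate[OF M, of j] unfolding a_def by blast
    have close: "\<bar>fps_nth (s k T) (Suc j) - a * box_moment (\<nu> k) j (E k T)\<bar> \<le> B * (1 / \<nu> k)" if "T \<in> Om k" for k T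
      using B[OF nu E[OF that]] by (simp add: s_def)
    have z: "(\<lambda>k. B * (1 / \<nu> k)) \<longlonglongrightarrow> 0" by (rule tendsto_mult_right_zero[OF lim])
    show ?thesis
    proof
      assume "\<exists>x. converges (\<lambda>k T. fps_nth (s k T) (Suc j)) x"
      then obtain x where x: "converges (\<lambda>k T. fps_nth (s k T) (Suc j)) x" by blast
      have "converges (\<lambda>k T. a * box_moment (\<nu> k) j (E k T)) x"
        by (rule converges_close_uniform[OF x _ z]) (subst abs_minus_commute, rule close)
      from converges_cmult[OF this, of "1 / a"]
      show "\<exists>x. converges (\<lambda>k T. box_moment (\<nu> k) j (E k T)) x" using a by auto
    next
      assume "\<exists>x. converges (\<lambda>k T. box_moment (\<nu> k) j (E k T)) x"
      then obtain x where x: "converges (\<lambda>k T. box_moment (\<nu> k) j (E k T)) x" by blast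
      have "converges (\<lambda>k T. fps_nth (s k T) (Suc j)) (a * x)"
        by (rule converges_close_uniform[OF converges_cmult[OF x] close z])
      then show "\<exists>x. converges (\<lambda>k T. fps_nth (s k T) (Suc j)) x" by blast
    qed
  qed
  have zero: "\<exists>x. converges (\<lambda>k T. fps_nth (s k T) 0) x"
    unfolding s0 using converges_const by blast
  show ?thesis
    unfolding log
  proof
    assume h: "\<forall>j. \<exists>x. converges (\<lambda>k T. box_moment (\<nu> k) j (E k T)) x"
    show "\<forall>j. \<exists>x. converges (\<lambda>k T. fps_nth (s k T) j) x"
    proof
      fix j show "\<exists>x. converges (\<lambda>k T. fps_nth (s k T) j) x"
      proof (cases j)
        case 0
        then show ?thesis using zero by simp
      next
        case (Suc i)
        then show ?thesis using h step[of i] by simp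
      qed
    qed
  next
    assume h: "\<forall>j. \<exists>x. converges (\<lambda>k T. fps_nth (s k T) j) x"
    show "\<forall>j. \<exists>x. converges (\<lambda>k T. box_moment (\<nu> k) j (E k T)) x"
      using h step by simp
  qed
qed

text \<open>While the largest entry exceeds m, delete it: it sits in a corner, so a shape
  remains.\<close>

lemma sublevel_shape:
  assumes "shape D" "T \<in> linear_extensions D"
  shows "shape {b \<in> D. T b \<le> m}"
  using assms
proof (induction "card D" arbitrary: D T)
  case 0
  then have "D = {}" using shape_finite by auto
  then show ?case using 0 by simp
next
  case (Suc n)
  have fin: "finite D" and ne: "D \<noteq> {}" using Suc shape_finite by auto
  show ?case
  proof (cases "card D \<le> m")
    case True
    then have "{b \<in> D. T b \<le> m} = D" using linear_extension_le[OF Suc.prems(2)] by fastforce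
    then show ?thesis using Suc.prems by simp
  next
    case False
    obtain b where b: "b \<in> corners D" "restrict T (D - {b}) \<in> linear_extensions (D - {b})"
      "T = (restrict T (D - {b}))(b := card D)"
      using linear_extension_restrict[OF fin ne Suc.prems(2)] .
    have "T b = card D" using b(3) by (metis fun_upd_same)
    then have "{a \<in> D. T a \<le> m} = {a \<in> D - {b}. restrict T (D - {b}) a \<le> m}" using False by auto
    moreover have "n = card (D - {b})" using Suc.hyps(2) b(1) corners_subset[of D] fin by auto
    then have "shape {a \<in> D - {b}. restrict T (D - {b}) a \<le> m}"
      using Suc.hyps(1) shape_remove[OF Suc.prems(1) b(1)] b(2) by blast
    ultimately show ?thesis by simp
  qed
qed

section \<open>Rescaled shapes with a limiting profile\<close>

locale shape_sequence =
  fixes D :: "nat \<Rightarrow> (nat \<times> nat) set" and C :: real and G1 :: "real \<Rightarrow> real"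
  assumes sh: "shape (D k)" and D_ne: "D k \<noteq> {}" and C: "C \<ge> 1"
    and card_lim: "filterlim (\<lambda>k. card (D k)) at_top sequentially"
    and balanced: "b \<in> D k \<Longrightarrow> real (box_content b) + 1 \<le> C * sqrt (real (card (D k)))"
    and lim1: "z \<ge> 0 \<Longrightarrow> (\<lambda>k. real (diag_count (nat \<lfloor>sqrt (2 * real (card (D k))) * z\<rfloor>) (D k)) /
        sqrt (2 * real (card (D k)))) \<longlonglongrightarrow> G1 z"
begin

definition N :: "nat \<Rightarrow> real" where "N k = real (card (D k))"
text \<open>The unit of length. Its square is the parameter \<nu> = \<open>2 * N k\<close> of the
  series.\<close>

definition r :: "nat \<Rightarrow> real" where "r k = sqrt (2 * real (card (D k)))"

lemma finD: "finite (D k)" using sh shape_finite by blast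

lemma N1: "N k \<ge> 1"
  unfolding N_def using finD[of k] D_ne[of k] by (simp add: Suc_le_eq card_gt_0_iff)

lemma r_sq: "r k * r k = 2 * N k"
  by (simp add: r_def N_def)

lemma r1: "r k \<ge> 1"
  unfolding r_def using N1[of k] by (simp add: N_def)

lemma r_lim: "(\<lambda>k. 1 / r k) \<longlonglongrightarrow> 0"
proof -
  have "filterlim N at_top sequentially"
    unfolding N_def by (rule filterlim_compose[OF filterlim_real_sequentially card_lim])
  then have "filterlim (\<lambda>k. 2 * N k) at_top sequentially"
    by (rule filterlim_tendsto_pos_mult_at_top[OF tendsto_const, rotated]) simp
  then have "filterlim r at_top sequentially"
    unfolding r_def N_def by (rule filterlim_compose[OF sqrt_at_top])
  from tendsto_inverse_0_at_top[OF this] show ?thesis by (simp add: inverse_eq_divide)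
qed

lemma nu_lim: "(\<lambda>k. 1 / (2 * N k)) \<longlonglongrightarrow> 0"
  using tendsto_mult[OF r_lim r_lim] by (simp add: r_sq)

lemma sqrt_N_le: "sqrt (N k) \<le> r k"
  unfolding r_def N_def by (rule real_sqrt_le_mono) simp

lemma box_content_less: "b \<in> D k \<Longrightarrow> real (box_content b) < C * r k"
proof -
  assume b: "b \<in> D k"
  have "real (box_content b) + 1 \<le> C * sqrt (N k)" using balanced[OF b] by (simp add: N_def)
  also have "\<dots> \<le> C * r k" using C sqrt_N_le by (intro mult_left_mono) auto
  finally show ?thesis by simp
qed

definition M :: real where "M = C * C"

lemma M1: "M \<ge> 1" unfolding M_def using C mult_mono[of 1 C 1 C] by simp

lemma weight_le:
  assumes b: "b \<in> D k" shows "box_weight (2 * N k) (box_content b) \<le> M"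
proof -
  have le: "real (box_content b) + 1 \<le> C * sqrt (N k)" using balanced[OF b] by (simp add: N_def)
  have "real (box_content b) * (real (box_content b) + 1) \<le> (C * sqrt (N k)) * (C * sqrt (N k))"
    using le by (intro mult_mono) auto
  also have "\<dots> = M * N k" using N1[of k] by (simp add: M_def)
  also have "\<dots> \<le> M * (2 * N k)" using M1 N1[of k] by (intro mult_left_mono) auto
  finally show ?thesis unfolding box_weight_def using N1[of k] by (simp add: divide_le_eq)
qed

lemma bounded_sub:
  assumes "shape E" "E \<subseteq> D k" shows "bounded_shape (2 * N k) M E"
proof -
  have "card E \<le> card (D k)" using assms finD by (intro card_mono) auto
  then have "real (card E) \<le> 2 * N k" by (simp add: N_def)
  then show ?thesis unfolding bounded_shape_def using assms weight_le by auto
qed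

abbreviation Om :: "nat \<Rightarrow> (nat \<times> nat \<Rightarrow> nat) set" where
  "Om k \<equiv> linear_extensions (D k)"

sublocale finite_samples Om
  by unfold_locales (use finite_linear_extensions finD shape_linear_extensions sh in auto)

lemma floor_lim:
  assumes z: "z \<ge> 0"
  shows "(\<lambda>k. real (nat \<lfloor>r k * z\<rfloor>) / r k) \<longlonglongrightarrow> z"
proof (rule tendsto_sandwich)
  have fl: "r k * z - 1 \<le> real (nat \<lfloor>r k * z\<rfloor>) \<and> real (nat \<lfloor>r k * z\<rfloor>) \<le> r k * z" for k
  proof -
    have "0 \<le> r k * z" using z r1[of k] by simp
    then show ?thesis by linarith
  qed
  show "\<forall>\<^sub>F k in sequentially. z - 1 / r k \<le> real (nat \<lfloor>r k * z\<rfloor>) / r k"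
  proof (intro always_eventually allI)
    fix k
    have "(r k * z - 1) / r k \<le> real (nat \<lfloor>r k * z\<rfloor>) / r k"
      using fl[of k] r1[of k] by (intro divide_right_mono) auto
    then show "z - 1 / r k \<le> real (nat \<lfloor>r k * z\<rfloor>) / r k" using r1[of k] by (simp add: diff_divide_distrib)
  qed
  show "\<forall>\<^sub>F k in sequentially. real (nat \<lfloor>r k * z\<rfloor>) / r k \<le> z"
  proof (intro always_eventually allI)
    fix k
    have "real (nat \<lfloor>r k * z\<rfloor>) / r k \<le> r k * z / r k"
      using fl[of k] r1[of k] by (intro divide_right_mono) auto
    then show "real (nat \<lfloor>r k * z\<rfloor>) / r k \<le> z" using r1[of k] by simp
  qed
  show "(\<lambda>k. z - 1 / r k) \<longlonglongrightarrow> z" using tendsto_diff[OF tendsto_const[of z] r_lim] by simp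
qed simp

lemma weight_eq: "box_weight (2 * N k) c = (real c / r k) * (real c / r k + 1 / r k)"
  unfolding box_weight_def r_sq[symmetric] by (simp add: distrib_left add_divide_distrib)

lemma weight_lim:
  assumes z: "z \<ge> 0"
  shows "(\<lambda>k. box_weight (2 * N k) (nat \<lfloor>r k * z\<rfloor>)) \<longlonglongrightarrow> z\<^sup>2"
  unfolding weight_eq
  using tendsto_mult[OF floor_lim[OF z] tendsto_add[OF floor_lim[OF z] r_lim]] by (simp add: power2_eq_square)

lemma count_le:
  assumes "shape E" "E \<subseteq> D k" shows "real (diag_count c E) \<le> C * r k"
proof -
  define n where "n = nat \<lfloor>C * sqrt (N k)\<rfloor>"
  have "box_content b < n" if "b \<in> E" for b
  proof -
    have "real (box_content b + 1) \<le> C * sqrt (N k)" using balanced[of b k] that assms by (auto simp: N_def)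
    then have "int (box_content b + 1) \<le> \<lfloor>C * sqrt (N k)\<rfloor>" by (simp add: le_floor_iff)
    then show ?thesis by (simp add: n_def)
  qed
  then have "diag_count c E \<le> n" using diag_count_le[OF assms(1)] by blast
  then have "real (diag_count c E) \<le> real n" by simp
  also have "real n \<le> C * sqrt (N k)" using C N1[of k] by (simp add: n_def)
  also have "\<dots> \<le> C * r k" using C sqrt_N_le by (intro mult_left_mono) auto
  finally show ?thesis .
qed

lemma count_zero:
  assumes "E \<subseteq> D k" "real c \<ge> C * r k" shows "diag_count c E = 0"
proof (rule diag_count_0)
  fix b assume "b \<in> E"
  then have "real (box_content b) < real c" using box_content_less[of b k] assms by auto
  then show "box_content b < c" by simp
qed

text \<open>The normalisation \<open>1 / (2 * N k)\<close> splits into one \<open>1 / r k\<close>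
  for the height of a diagonal and one for the mesh, which makes the sum over diagonals a Riemann
  sum.\<close>

lemma test_sum_eq:
  assumes "E \<subseteq> D k" "real K \<ge> C * r k"
  shows "(\<Sum>b\<in>E. h (box_weight (2 * N k) (box_content b))) / (2 * N k) =
    (\<Sum>c<K. real (diag_count c E) / r k * h (box_weight (2 * N k) c)) / r k"
proof -
  have fin: "finite E" using assms finD finite_subset by blast
  have "box_content b < K" if "b \<in> E" for b using box_content_less[of b k] that assms by fastforce
  then have "(\<Sum>b\<in>E. h (box_weight (2 * N k) (box_content b))) =
      (\<Sum>c<K. real (diag_count c E) * h (box_weight (2 * N k) c))"
    using sum_by_content[OF fin, of K "\<lambda>c. h (box_weight (2 * N k) c)"] by blast
  then show ?thesis unfolding r_sq[symmetric] by (simp add: sum_divide_distrib)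
qed

text \<open>Here the convergence of the profiles enters: heights and weights converge pointwise, and
  the moments tend to the integrals of G1(z) z^(2j).\<close>

lemma moments_D: "\<exists>x. converges (\<lambda>k T. box_moment (2 * N k) j (D k)) x"
proof -
  define F where "F k c = real (diag_count c (D k)) / r k * box_weight (2 * N k) c ^ j" for k c
  define K where "K k = nat \<lceil>C * r k\<rceil>" for k
  have K: "real (K k) \<ge> C * r k" for k unfolding K_def by linarith
  have "(\<lambda>k. (\<Sum>c<K k. F k c) / r k) \<longlonglongrightarrow> integral {0..C + 1} (\<lambda>z. G1 z * (z\<^sup>2) ^ j)"
  proof (rule riemann_sum_limit[OF r1 _ _ _ _ K])
    show "C \<ge> 0" using C by simp
    show "F k c = 0" if "real c \<ge> C * r k" for k c
      using count_zero[OF order_refl that] by (simp add: F_def)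
    show "\<bar>F k c\<bar> \<le> C * M ^ j" for k c
    \<comment> \<open>A non-empty diagonal contains a box of \<open>D k\<close>, so its weight is at
      most M; on an empty one the height is 0.\<close>
    proof (cases "diag_count c (D k) = 0")
      case True
      then show ?thesis using C M1 by (simp add: F_def)
    next
      case False
      then have "{b \<in> D k. box_content b = c} \<noteq> {}" unfolding diag_count_def by (metis card.empty)
      then obtain b where b: "b \<in> D k" "box_content b = c" by blast
      have w: "0 \<le> box_weight (2 * N k) c" "box_weight (2 * N k) c \<le> M"
        using weight_le[OF b(1)] b(2) box_weight_nonneg[of "2 * N k" c] N1[of k] by auto
      have "real (diag_count c (D k)) / r k \<le> C"
        using count_le[OF sh order_refl, of c k] r1[of k] by (simp add: divide_le_eq)
      then have "real (diag_count c (D k)) / r k * box_weight (2 * N k) c ^ j \<le> C * M ^ j"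
        using w C by (intro mult_mono power_mono) auto
      moreover have "F k c \<ge> 0" unfolding F_def using w r1[of k] by simp
      ultimately show ?thesis by (simp add: F_def)
    qed
    fix z :: real assume z: "z \<ge> 0"
    show "(\<lambda>k. F k (nat \<lfloor>r k * z\<rfloor>)) \<longlonglongrightarrow> G1 z * (z\<^sup>2) ^ j"
      unfolding F_def by (intro tendsto_mult tendsto_power weight_lim[OF z] lim1[OF z, folded r_def])
  qed
  moreover have "box_moment (2 * N k) j (D k) = (\<Sum>c<K k. F k c) / r k" for k
    unfolding box_moment_def F_def
    using test_sum_eq[OF order_refl K, where h = "\<lambda>w. w ^ j"] by simp
  ultimately show ?thesis using converges_det by auto
qed

lemma coeffs_D: "\<exists>x. converges (\<lambda>k T. fps_nth (shape_series (2 * N k) (D k)) j) x"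
proof -
  have nu: "2 * N k \<ge> 1" for k using N1[of k] by simp
  have "\<forall>j. \<exists>x. converges (\<lambda>k T. fps_nth (shape_series (2 * N k) (D k)) j) x"
    using moments_converge_iff[OF M1 nu nu_lim, of "\<lambda>k T. D k"] bounded_sub[OF sh order_refl] moments_D by blast
  then show ?thesis by blast
qed

definition sublevel :: "(nat \<Rightarrow> nat) \<Rightarrow> nat \<Rightarrow> (nat \<times> nat \<Rightarrow> nat) \<Rightarrow> (nat \<times> nat) set" where
  "sublevel m k T = {b \<in> D k. T b \<le> m k}"

lemma sublevel_sub: "sublevel m k T \<subseteq> D k"
  by (auto simp: sublevel_def)

lemma sublevel_sh: "T \<in> Om k \<Longrightarrow> shape (sublevel m k T)"
  unfolding sublevel_def using sublevel_shape[OF sh] by blast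

text \<open>The coefficient concentrates at \<alpha>^(2i-1) times its limit for the full shapes.
  This is where the randomness of the filling enters the limit.\<close>

lemma power_coeff_sublevel:
  assumes m: "\<And>k. m k \<le> card (D k)" and lim: "(\<lambda>k. real (m k) / N k) \<longlonglongrightarrow> \<alpha>" and i: "i \<ge> 1"
  shows "\<exists>x. converges (\<lambda>k T. fps_nth (shape_series (2 * N k) (sublevel m k T) ^ (2 * i - 1)) i) x"
proof -
  define a where "a = 2 * i - 1"
  define \<rho> where "\<rho> k = fps_nth (shape_series (2 * N k) (D k) ^ a) i" for k
  have "fps_bounded i (2 * M ^ i) (shape_series (2 * N k) (D k))" for k
    using N1[of k] by (intro shape_series_bounded[OF bounded_sub[OF sh order_refl] M1]) auto
  then have "coeffs_converge i (\<lambda>k T. shape_series (2 * N k) (D k))"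
    unfolding coeffs_converge_def using coeffs_D by blast
  from coeffs_converge_power[OF this, of a]
  obtain x where x: "converges (\<lambda>k T. \<rho> k) x" unfolding coeffs_converge_def \<rho>_def by blast
  have "\<bar>(real (m k) / N k) ^ a\<bar> \<le> 1" for k
    using m[of k] N1[of k] by (simp add: power_abs N_def power_le_one)
  then have W: "converges (\<lambda>k T. \<rho> k * (real (m k) / N k) ^ a) (x * \<alpha> ^ a)"
    by (intro converges_mult[OF x, where B = 1] converges_det tendsto_power lim) auto
  obtain B where B: "B \<ge> 0" and conc: "\<And>D m. D \<noteq> {} \<Longrightarrow> bounded_shape (2 * real (card D)) M D \<Longrightarrow> m \<le> card D \<Longrightarrow>
    sublevel_avg D m (\<lambda>E. (fps_nth (shape_series (2 * real (card D)) E ^ a) i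
      - (real m / real (card D)) ^ a * fps_nth (shape_series (2 * real (card D)) D ^ a) i)\<^sup>2)
    \<le> B / real (card D)"
    using concentration[OF M1 i] unfolding a_def by blast
  define Y where "Y k T = fps_nth (shape_series (2 * N k) (sublevel m k T) ^ a) i - \<rho> k * (real (m k) / N k) ^ a" for k T
  have sq: "avg (Om k) (\<lambda>T. (Y k T)\<^sup>2) \<le> B / N k" for k
    using conc[OF D_ne bounded_sub[OF sh order_refl, unfolded N_def] m[of k]]
    unfolding sublevel_avg_def avg_def Y_def sublevel_def \<rho>_def N_def by (simp add: mult.commute)
  have bound: "avg (Om k) (\<lambda>T. \<bar>Y k T\<bar>) \<le> (1 + 2 * B) * (1 / r k)" for k
  proof -
    define s where "s = 1 / r k"
    have s: "s > 0" using r1[of k] by (simp add: s_def)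
    \<comment> \<open>From second moment to mean with the threshold s = 1 / r: a larger |y| is at
      most r y^2. Since the second moment is O(1 / r^2), the mean is O(1 / r).\<close>
    have "\<bar>y\<bar> \<le> s + r k * y\<^sup>2" for y :: real
    proof (cases "\<bar>y\<bar> \<le> s")
      case True
      then show ?thesis using r1[of k] by (simp add: add_increasing2)
    next
      case False
      then have "r k * s \<le> r k * \<bar>y\<bar>" using r1[of k] by (intro mult_left_mono) auto
      then have "1 \<le> r k * \<bar>y\<bar>" using r1[of k] by (simp add: s_def)
      then have "1 * \<bar>y\<bar> \<le> r k * \<bar>y\<bar> * \<bar>y\<bar>" by (intro mult_right_mono) auto
      then show ?thesis using s by (simp add: power2_eq_square mult.assoc)
    qed
    then have "avg (Om k) (\<lambda>T. \<bar>Y k T\<bar>) \<le> avg (Om k) (\<lambda>T. s + r k * (Y k T)\<^sup>2)" by (intro avg_mono)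
    also have "\<dots> = s + r k * avg (Om k) (\<lambda>T. (Y k T)\<^sup>2)" unfolding avg_add avg_cmult avg_const ..
    also have "\<dots> \<le> s + r k * (B / N k)" using sq[of k] r1[of k] by (intro add_left_mono mult_left_mono) auto
    also have "\<dots> = (1 + 2 * B) * (1 / r k)"
    proof -
      have Nr: "N k = r k * r k / 2" using r_sq[of k] by simp
      have "r k * (B / N k) = 2 * B / r k" unfolding Nr using r1[of k] by simp
      then show ?thesis by (simp add: s_def add_divide_distrib)
    qed
    finally show ?thesis .
  qed
  have "(\<lambda>k. avg (Om k) (\<lambda>T. \<bar>Y k T\<bar>)) \<longlonglongrightarrow> 0"
  proof (rule tendsto_sandwich[OF _ _ tendsto_const])
    show "\<forall>\<^sub>F k in sequentially. avg (Om k) (\<lambda>T. \<bar>Y k T\<bar>) \<le> (1 + 2 * B) * (1 / r k)"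
      using bound by (intro always_eventually) blast
    show "(\<lambda>k. (1 + 2 * B) * (1 / r k)) \<longlonglongrightarrow> 0" by (rule tendsto_mult_right_zero[OF r_lim])
  qed (simp add: avg_nonneg)
  from converges_close[OF W this[unfolded Y_def]] show ?thesis unfolding a_def by blast
qed

lemma moments_sublevel:
  assumes m: "\<And>k. m k \<le> card (D k)" and lim: "(\<lambda>k. real (m k) / N k) \<longlonglongrightarrow> \<alpha>"
  shows "\<exists>x. converges (\<lambda>k T. box_moment (2 * N k) j (sublevel m k T)) x"
proof -
  have nu: "2 * N k \<ge> 1" "2 * N k > 0" for k using N1[of k] by simp_all
  have bs: "bounded_shape (2 * N k) M (sublevel m k T)" if "T \<in> Om k" for k T
    by (rule bounded_sub[OF sublevel_sh[OF that] sublevel_sub])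
  have "\<exists>x. converges (\<lambda>k T. fps_nth (shape_series (2 * N k) (sublevel m k T)) i) x" for i
  proof (rule coeffs_converge_from_powers)
    fix k T assume T: "T \<in> Om k"
    show "fps_nth (shape_series (2 * N k) (sublevel m k T)) 0 = 1"
      using shape_series_nth_1[of "sublevel m k T" "2 * N k"] shape_finite[OF sublevel_sh[OF T]] by blast
  next
    fix K show "\<exists>x. \<forall>k. \<forall>T\<in>Om k. fps_bounded K x (shape_series (2 * N k) (sublevel m k T))"
      using shape_series_bounded[OF bs M1 nu(2)] by blast
  next
    fix i :: nat assume "i \<ge> 1"
    then show "\<exists>x. converges (\<lambda>k T. fps_nth (shape_series (2 * N k) (sublevel m k T) ^ (2 * i - 1)) i) x"
      by (rule power_coeff_sublevel[OF m lim])
  qed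
  then show ?thesis using moments_converge_iff[OF M1 nu(1) nu_lim, of "sublevel m"] bs by blast
qed

text \<open>Polynomials in the weight approximate h uniformly on [0, M], and there are at most
  \<open>2 * N k\<close> boxes under the normalisation, so the error carries over to the
  sums.\<close>

lemma test_converges:
  assumes m: "\<And>k. m k \<le> card (D k)" and lim: "(\<lambda>k. real (m k) / N k) \<longlonglongrightarrow> \<alpha>"
    and h: "continuous_on {0..M} h"
  shows "\<exists>x. converges (\<lambda>k T. (\<Sum>b\<in>sublevel m k T. h (box_weight (2 * N k) (box_content b))) / (2 * N k)) x"
proof (rule converges_approx)
  fix \<epsilon> :: real assume eps: "\<epsilon> > 0"
  obtain g where g: "real_polynomial_function g" "\<And>x. x \<in> {0..M} \<Longrightarrow> \<bar>h x - g x\<bar> < \<epsilon>"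
    using Stone_Weierstrass_real_polynomial_function[OF _ h eps] by auto
  obtain a n where an: "g = (\<lambda>x. \<Sum>i\<le>(n::nat). a i * x ^ i)"
    using real_polynomial_function_imp_sum[OF g(1)] by blast
  have "\<forall>j. \<exists>x. converges (\<lambda>k T. box_moment (2 * N k) j (sublevel m k T)) x"
    using moments_sublevel[OF m lim] by blast
  from choice[OF this] obtain x where
    x: "\<And>j. converges (\<lambda>k T. box_moment (2 * N k) j (sublevel m k T)) (x j)" by blast
  define W where "W k T = (\<Sum>i\<le>n. a i * box_moment (2 * N k) i (sublevel m k T))" for k T
  have W: "converges W (\<Sum>i\<le>n. a i * x i)"
    unfolding W_def by (intro converges_sum converges_cmult x)
  have eq: "W k T = (\<Sum>b\<in>sublevel m k T. g (box_weight (2 * N k) (box_content b))) / (2 * N k)" for k T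
    unfolding W_def an box_moment_def
    by (subst sum.swap) (simp add: sum_distrib_left sum_divide_distrib)
  have "\<bar>(\<Sum>b\<in>sublevel m k T. h (box_weight (2 * N k) (box_content b))) / (2 * N k) - W k T\<bar> \<le> \<epsilon>" if T: "T \<in> Om k" for k T
  proof -
    let ?E = "sublevel m k T"
    have "\<bar>(\<Sum>b\<in>?E. h (box_weight (2 * N k) (box_content b))) - (\<Sum>b\<in>?E. g (box_weight (2 * N k) (box_content b)))\<bar> \<le>
        (\<Sum>b\<in>?E. \<bar>h (box_weight (2 * N k) (box_content b)) - g (box_weight (2 * N k) (box_content b))\<bar>)"
      unfolding sum_subtractf[symmetric] by (rule sum_abs)
    also have "\<dots> \<le> (\<Sum>b\<in>?E. \<epsilon>)"
    proof (rule sum_mono)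
      fix b assume "b \<in> ?E"
      then have "b \<in> D k" using sublevel_sub by blast
      then have "box_weight (2 * N k) (box_content b) \<in> {0..M}"
        using weight_le box_weight_nonneg[of "2 * N k"] N1[of k] by simp
      then show "\<bar>h (box_weight (2 * N k) (box_content b)) - g (box_weight (2 * N k) (box_content b))\<bar> \<le> \<epsilon>"
        using g(2) by (simp add: less_imp_le)
    qed
    also have "\<dots> = real (card ?E) * \<epsilon>" by simp
    also have "\<dots> \<le> 2 * N k * \<epsilon>"
      using bounded_sub[OF sublevel_sh[OF T] sublevel_sub, of m] eps
      by (intro mult_right_mono) (auto simp: bounded_shape_def)
    finally have le: "\<bar>(\<Sum>b\<in>?E. h (box_weight (2 * N k) (box_content b))) - (\<Sum>b\<in>?E. g (box_weight (2 * N k) (box_content b)))\<bar> \<le> \<epsilon> * (2 * N k)"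
      by (simp add: mult.commute)
    have "\<bar>(\<Sum>b\<in>?E. h (box_weight (2 * N k) (box_content b))) / (2 * N k) - W k T\<bar> =
      \<bar>(\<Sum>b\<in>?E. h (box_weight (2 * N k) (box_content b))) - (\<Sum>b\<in>?E. g (box_weight (2 * N k) (box_content b)))\<bar> / (2 * N k)"
      unfolding eq diff_divide_distrib[symmetric] using N1[of k] by simp
    also have "\<dots> \<le> \<epsilon>" using le N1[of k] by (subst pos_divide_le_eq) auto
    finally show ?thesis .
  qed
  then have "\<forall>\<^sub>F k in sequentially. avg (Om k)
      (\<lambda>T. \<bar>(\<Sum>b\<in>sublevel m k T. h (box_weight (2 * N k) (box_content b))) / (2 * N k) - W k T\<bar>) \<le> \<epsilon>"
    by (intro always_eventually allI avg_le_const)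
  then show "\<exists>W x. converges W x \<and> (\<forall>\<^sub>F k in sequentially. avg (Om k)
      (\<lambda>T. \<bar>(\<Sum>b\<in>sublevel m k T. h (box_weight (2 * N k) (box_content b))) / (2 * N k) - W k T\<bar>) \<le> \<epsilon>)"
    using W by blast
qed

text \<open>c (c + 1) lies between the squares of c and c + 1, so the root of the weight is the
  rescaled content up to one mesh width.\<close>

lemma sqrt_weight_bounds:
  "real c / r k \<le> sqrt (box_weight (2 * N k) c)" "sqrt (box_weight (2 * N k) c) \<le> real c / r k + 1 / r k"
proof -
  let ?x = "real c / r k" and ?y = "real c / r k + 1 / r k"
  have xy: "0 \<le> ?x" "?x \<le> ?y" using r1[of k] by auto
  have "?x\<^sup>2 \<le> ?x * ?y" "?x * ?y \<le> ?y\<^sup>2"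
    unfolding power2_eq_square using xy by (intro mult_mono; simp)+
  then have *: "?x\<^sup>2 \<le> box_weight (2 * N k) c" "box_weight (2 * N k) c \<le> ?y\<^sup>2" unfolding weight_eq .
  show "?x \<le> sqrt (box_weight (2 * N k) c)" by (rule real_le_rsqrt[OF *(1)])
  show "sqrt (box_weight (2 * N k) c) \<le> ?y" using *(2) xy by (intro real_le_lsqrt) auto
qed

lemma floor_bound:
  assumes "z \<ge> 0" shows "\<bar>real (nat \<lfloor>r k * z\<rfloor>) / r k - z\<bar> \<le> 1 / r k"
proof -
  have "0 \<le> r k * z" using assms r1[of k] by simp
  then have "\<bar>real (nat \<lfloor>r k * z\<rfloor>) - r k * z\<bar> \<le> 1" by linarith
  then have "\<bar>real (nat \<lfloor>r k * z\<rfloor>) - r k * z\<bar> / r k \<le> 1 / r k"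
    using r1[of k] by (intro divide_right_mono) auto
  moreover have "real (nat \<lfloor>r k * z\<rfloor>) / r k - z = (real (nat \<lfloor>r k * z\<rfloor>) - r k * z) / r k"
    using r1[of k] by (simp add: diff_divide_distrib)
  ultimately show ?thesis using r1[of k] by simp
qed

definition diag_height :: "nat \<Rightarrow> real \<Rightarrow> (nat \<times> nat) set \<Rightarrow> real" where
  "diag_height k z E = real (diag_count (nat \<lfloor>r k * z\<rfloor>) E) / r k"

text \<open>A height is recovered from the integral of the height function against a narrow hat function.\<close>

lemma diag_height_converges:
  assumes m: "\<And>k. m k \<le> card (D k)" and lim: "(\<lambda>k. real (m k) / N k) \<longlonglongrightarrow> \<alpha>" and z: "z \<ge> 0"
  shows "\<exists>x. converges (\<lambda>k T. diag_height k z (sublevel m k T)) x"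
proof (rule converges_approx)
  fix \<epsilon> :: real assume eps: "\<epsilon> > 0"
  define \<eta> where "\<eta> = \<epsilon> / 2"
  have eta: "\<eta> > 0" using eps by (simp add: \<eta>_def)
  \<comment> \<open>A tent of half-width \<eta> around z in the variable \<open>sqrt w\<close>,
    which is nearly the rescaled content.\<close>
  define hat where "hat w = max 0 (1 - \<bar>sqrt w - z\<bar> / \<eta>)" for w
  define B where "B = z + \<eta>"
  \<comment> \<open>The range covers both the shapes, up to C, and the support of the tent, up to
    B.\<close>
  define K where "K k = nat \<lceil>(C + B) * r k\<rceil>" for k
  define H where "H k = (\<Sum>c<K k. hat (box_weight (2 * N k) c)) / r k" for k
  define HH where "HH = integral {0..B + 1} (\<lambda>t. hat (t\<^sup>2))"
  define X where "X k T = (\<Sum>b\<in>sublevel m k T. hat (box_weight (2 * N k) (box_content b))) / (2 * N k)" for k T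
  have B: "B \<ge> 0" using z eta by (simp add: B_def)
  have hat: "0 \<le> hat w" "hat w \<le> 1" for w using eta by (auto simp: hat_def)
  have hat0: "\<bar>sqrt w - z\<bar> < \<eta>" if "hat w \<noteq> 0" for w
  proof (rule ccontr)
    assume "\<not> \<bar>sqrt w - z\<bar> < \<eta>"
    then have "1 \<le> \<bar>sqrt w - z\<bar> / \<eta>" using eta by (simp add: le_divide_eq)
    then show False using that by (simp add: hat_def)
  qed
  have K: "C * r k \<le> real (K k)" "B * r k \<le> real (K k)" for k
  proof -
    have "(C + B) * r k \<le> real (K k)" unfolding K_def by linarith
    moreover have "C * r k \<le> (C + B) * r k" "B * r k \<le> (C + B) * r k"
      using B C r1[of k] by (auto intro!: mult_right_mono)
    ultimately show "C * r k \<le> real (K k)" "B * r k \<le> real (K k)" by linarith+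
  qed
  have cont: "continuous_on S hat" for S unfolding hat_def using eta by (intro continuous_intros) auto
  have H: "H \<longlonglongrightarrow> HH"
    unfolding H_def HH_def
  proof (rule riemann_sum_limit[where A = 1, OF r1 B _ _ _ K(2)])
    fix k c assume "B * r k \<le> real c"
    then have "B \<le> real c / r k" using r1[of k] by (simp add: le_divide_eq)
    then have "\<not> \<bar>sqrt (box_weight (2 * N k) c) - z\<bar> < \<eta>" using sqrt_weight_bounds(1)[of c k] by (simp add: B_def)
    then show "hat (box_weight (2 * N k) c) = 0" using hat0 by blast
  next
    fix k c show "\<bar>hat (box_weight (2 * N k) c)\<bar> \<le> 1" using hat by simp
  next
    fix t :: real assume t: "0 \<le> t"
    have "isCont hat (t\<^sup>2)" using cont[of UNIV] by (simp add: continuous_on_eq_continuous_at)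
    from isCont_tendsto_compose[OF this weight_lim[OF t]]
    show "(\<lambda>k. hat (box_weight (2 * N k) (nat \<lfloor>r k * t\<rfloor>))) \<longlonglongrightarrow> hat (t\<^sup>2)" .
  qed
  have HH: "HH > 0"
  proof -
    have c2: "continuous_on {0..B + 1} (\<lambda>t. hat (t\<^sup>2))"
      unfolding hat_def using eta by (intro continuous_intros) auto
    \<comment> \<open>The tent equals 1 at its centre, so its integral is positive and division by H
      is possible for large k.\<close>
    have "hat (z\<^sup>2) \<noteq> 0" "z \<in> {0..B + 1}" using z eta by (auto simp: hat_def B_def)
    moreover have "(0::real) < B + 1" using B by simp
    ultimately have "HH \<noteq> 0" unfolding HH_def using integral_eq_0_iff[OF c2] hat by blast
    moreover have "HH \<ge> 0" unfolding HH_def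
      using hat integrable_continuous_real[OF c2] by (intro integral_nonneg) auto
    ultimately show ?thesis by simp
  qed
  obtain x where x: "converges X x" unfolding X_def using test_converges[OF m lim cont] by blast
  have Xb: "\<bar>X k T\<bar> \<le> 1" if T: "T \<in> Om k" for k T
  proof -
    have "(\<Sum>b\<in>sublevel m k T. hat (box_weight (2 * N k) (box_content b))) \<le> (\<Sum>b\<in>sublevel m k T. 1)"
      by (rule sum_mono) (rule hat)
    also have "\<dots> \<le> 2 * N k"
      using bounded_sub[OF sublevel_sh[OF T] sublevel_sub, of m] by (simp add: bounded_shape_def)
    finally have "X k T \<le> 1" unfolding X_def using N1[of k] by (simp add: divide_le_eq)
    moreover have "X k T \<ge> 0" unfolding X_def using N1[of k] hat by (intro divide_nonneg_nonneg sum_nonneg) auto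
    ultimately show ?thesis by simp
  qed
  have "(\<lambda>k. 1 / H k) \<longlonglongrightarrow> 1 / HH" using tendsto_divide[OF tendsto_const[of 1] H] HH by simp
  then have W: "converges (\<lambda>k T. 1 / H k * X k T) (1 / HH * x)"
    by (intro converges_mult[OF converges_det x, where B = 1] Xb)
  \<comment> \<open>X averages heights with total mass H, so X / H differs from the height at z by
    at most their oscillation on the support. The term 2 / r pays for the floor and for the root of
    the weight.\<close>
  have close: "\<bar>diag_height k z (sublevel m k T) - 1 / H k * X k T\<bar> \<le> \<eta> + 2 / r k" if T: "T \<in> Om k" and Hk: "H k > 0" for k T
  proof -
    define f where "f = diag_height k z (sublevel m k T)"
    have "\<bar>X k T - f * H k\<bar> = \<bar>\<Sum>c<K k. (real (diag_count c (sublevel m k T)) / r k - f) * hat (box_weight (2 * N k) c)\<bar> / r k"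
    proof -
      have "X k T - f * H k = (\<Sum>c<K k. (real (diag_count c (sublevel m k T)) / r k - f) * hat (box_weight (2 * N k) c)) / r k"
        unfolding X_def H_def test_sum_eq[OF sublevel_sub K(1)] left_diff_distrib sum_subtractf
        by (simp add: diff_divide_distrib sum_distrib_left)
      then show ?thesis using r1[of k] by simp
    qed
    also have "\<dots> \<le> (\<Sum>c<K k. (\<eta> + 2 / r k) * hat (box_weight (2 * N k) c)) / r k"
    proof (intro divide_right_mono order_trans[OF sum_abs] sum_mono)
      fix c
      show "\<bar>(real (diag_count c (sublevel m k T)) / r k - f) * hat (box_weight (2 * N k) c)\<bar> \<le>
          (\<eta> + 2 / r k) * hat (box_weight (2 * N k) c)"
      proof (cases "hat (box_weight (2 * N k) c) = 0")
        case False
        define c0 where "c0 = nat \<lfloor>r k * z\<rfloor>"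
        have "\<bar>real c / r k - z\<bar> \<le> \<eta> + 1 / r k"
          using hat0[OF False] sqrt_weight_bounds(1)[of c k] sqrt_weight_bounds(2)[of k c] by linarith
        have "\<bar>real c / r k - real c0 / r k\<bar> \<le> \<eta> + 2 / r k"
        proof -
          have "2 / r k = 1 / r k + 1 / r k" by simp
          then show ?thesis using \<open>\<bar>real c / r k - z\<bar> \<le> \<eta> + 1 / r k\<close> floor_bound[OF z, of k]
            unfolding c0_def by linarith
        qed
        moreover have "\<bar>real (diag_count c (sublevel m k T)) / r k - f\<bar> =
            \<bar>real (diag_count c (sublevel m k T)) - real (diag_count c0 (sublevel m k T))\<bar> / r k"
          unfolding f_def diag_height_def c0_def diff_divide_distrib[symmetric] using r1[of k] by simp
        moreover have "\<dots> \<le> \<bar>real c - real c0\<bar> / r k"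
          using diag_count_dist[OF sublevel_sh[OF T]] r1[of k] by (intro divide_right_mono) auto
        moreover have "\<bar>real c - real c0\<bar> / r k = \<bar>real c / r k - real c0 / r k\<bar>"
          unfolding diff_divide_distrib[symmetric] using r1[of k] by simp
        ultimately have "\<bar>real (diag_count c (sublevel m k T)) / r k - f\<bar> \<le> \<eta> + 2 / r k" by linarith
        then show ?thesis unfolding abs_mult using hat by (intro mult_mono) auto
      qed simp
    qed (use r1[of k] in simp)
    also have "\<dots> = (\<eta> + 2 / r k) * H k" by (simp add: H_def sum_distrib_left)
    finally have le: "\<bar>X k T - f * H k\<bar> \<le> (\<eta> + 2 / r k) * H k" .
    have "f - 1 / H k * X k T = - ((X k T - f * H k) / H k)" using Hk by (simp add: diff_divide_distrib)
    then have "\<bar>f - 1 / H k * X k T\<bar> = \<bar>X k T - f * H k\<bar> / H k" using Hk by simp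
    also have "\<dots> \<le> \<eta> + 2 / r k" using le Hk by (simp add: pos_divide_le_eq)
    finally show ?thesis unfolding f_def .
  qed
  have "\<forall>\<^sub>F k in sequentially. H k > 0" using order_tendstoD(1)[OF H HH] .
  moreover have "\<forall>\<^sub>F k in sequentially. 1 / r k < \<eta> / 2" using order_tendstoD(2)[OF r_lim, of "\<eta> / 2"] eta by simp
  ultimately have "\<forall>\<^sub>F k in sequentially. avg (Om k) (\<lambda>T. \<bar>diag_height k z (sublevel m k T) - 1 / H k * X k T\<bar>) \<le> \<epsilon>"
  proof eventually_elim
    case (elim k)
    have "\<eta> + 2 / r k \<le> \<epsilon>" using elim(2) by (simp add: \<eta>_def)
    then show ?case using close[OF _ elim(1)] by (intro avg_le_const) (rule order_trans)
  qed
  then show "\<exists>W x. converges W x \<and> (\<forall>\<^sub>F k in sequentially. avg (Om k)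
      (\<lambda>T. \<bar>diag_height k z (sublevel m k T) - W k T\<bar>) \<le> \<epsilon>)"
    using W by blast
qed

end

text \<open>The infimum is the first time at which the height over x - y exceeds y, with 1 inserted
  for points never passed. Continuity in time rules out a jump right after \<alpha>, which would
  leave points above \<open>G \<alpha>\<close> with value \<alpha>.\<close>

lemma level_curve_eq:
  fixes G :: "real \<Rightarrow> real \<Rightarrow> real"
  assumes nonneg: "\<And>\<beta>. 0 < \<beta> \<Longrightarrow> \<beta> < 1 \<Longrightarrow> 0 \<le> G \<beta> z"
    and mono: "\<And>\<beta> \<gamma>. 0 < \<beta> \<Longrightarrow> \<beta> \<le> \<gamma> \<Longrightarrow> \<gamma> < 1 \<Longrightarrow> G \<beta> z \<le> G \<gamma> z"
    and cont: "\<And>\<beta> \<gamma>. 0 < \<beta> \<Longrightarrow> \<beta> \<le> \<gamma> \<Longrightarrow> \<gamma> < 1 \<Longrightarrow> G \<gamma> z \<le> G \<beta> z + sqrt (\<gamma> - \<beta>)"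
    and le: "\<And>\<beta>. 0 < \<beta> \<Longrightarrow> \<beta> < 1 \<Longrightarrow> z + 2 * G \<beta> z \<le> \<Omega> z"
    and z: "z \<ge> 0" and \<alpha>: "0 < \<alpha>" "\<alpha> < 1"
  shows "level_curve (limit_region \<Omega>)
    (\<lambda>(x, y). Inf (insert 1 {\<beta>. 0 < \<beta> \<and> \<beta> < 1 \<and> y < G \<beta> (x - y)})) \<alpha> z = z + 2 * G \<alpha> z"
proof -
  define F where "F = (\<lambda>(x, y). Inf (insert 1 {\<beta>. 0 < \<beta> \<and> \<beta> < 1 \<and> y < G \<beta> (x - y)}))"
  define H where "H = level_heights (limit_region \<Omega>) F \<alpha> z"
  have bdd: "bdd_below (insert 1 {\<beta>. 0 < \<beta> \<and> \<beta> < 1 \<and> y < G \<beta> u})" for y u :: real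
    by (rule bdd_belowI[of _ 0]) auto
  have mem: "z + 2 * y \<in> H" if y: "0 \<le> y" "y < G \<alpha> z" for y
  proof -
    have "F (z + y, y) \<le> \<alpha>"
      unfolding F_def using y \<alpha> bdd[of y "z + y - y"] by (auto intro!: cInf_lower)
    moreover have "(z + y, y) \<in> limit_region \<Omega>"
      using y le[OF \<alpha>] z by (auto simp: limit_region_def)
    ultimately show ?thesis unfolding H_def level_heights_def
      by (intro CollectI exI[of _ "z + y"] exI[of _ y]) auto
  qed
  have upper: "t \<le> z + 2 * G \<alpha> z \<and> z \<le> t" if t: "t \<in> H" for t
  proof -
    obtain x y where xy: "t = x + y" "(x, y) \<in> limit_region \<Omega>" "x - y = z" "F (x, y) \<le> \<alpha>"
      using t by (auto simp: H_def level_heights_def)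
    have y0: "0 \<le> y" using xy by (simp add: limit_region_def)
    have "y \<le> G \<alpha> z"
    proof (rule ccontr)
      assume "\<not> y \<le> G \<alpha> z"
      define d where "d = y - G \<alpha> z"
      have d: "d > 0" using \<open>\<not> y \<le> G \<alpha> z\<close> by (simp add: d_def)
      \<comment> \<open>By the square-root modulus a time increment of d^2 raises the height by at
        most d; the other bound keeps \<beta> below 1.\<close>
      define \<beta> where "\<beta> = \<alpha> + min ((1 - \<alpha>) / 2) (d\<^sup>2)"
      have \<beta>: "\<alpha> < \<beta>" "\<beta> < 1" "\<beta> - \<alpha> \<le> d\<^sup>2" using \<alpha> d by (auto simp: \<beta>_def min_def field_simps)
      have "Inf (insert 1 {\<beta>. 0 < \<beta> \<and> \<beta> < 1 \<and> y < G \<beta> z}) < \<beta>" using xy \<beta> by (simp add: F_def)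
      then obtain \<gamma> where \<gamma>: "\<gamma> \<in> insert 1 {\<beta>. 0 < \<beta> \<and> \<beta> < 1 \<and> y < G \<beta> z}" "\<gamma> < \<beta>"
        using cInf_less_iff[OF _ bdd] by blast
      then have "0 < \<gamma>" "y < G \<gamma> z" using \<beta> by auto
      then have "y < G \<beta> z" using mono[of \<gamma> \<beta>] \<gamma> \<beta> by linarith
      also have "\<dots> \<le> G \<alpha> z + sqrt (\<beta> - \<alpha>)" using cont[of \<alpha> \<beta>] \<alpha> \<beta> by simp
      also have "sqrt (\<beta> - \<alpha>) \<le> d" using \<beta> d by (intro real_le_lsqrt) auto
      finally show False by (simp add: d_def)
    qed
    then show ?thesis using xy y0 by auto
  qed
  have "level_curve (limit_region \<Omega>) F \<alpha> z = z + 2 * G \<alpha> z"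
  \<comment> \<open>At height 0 the set of heights is empty or just {z}; the convention for the
    empty supremum gives z as well.\<close>
  proof (cases "G \<alpha> z = 0")
    case True
    have sub: "H \<subseteq> {z}" using upper True by fastforce
    show ?thesis
    proof (cases "H = {}")
      case True
      then show ?thesis using \<open>G \<alpha> z = 0\<close> z by (simp add: level_curve_def H_def)
    next
      case False
      then have "H = {z}" using sub by blast
      then show ?thesis using \<open>G \<alpha> z = 0\<close> by (simp add: level_curve_def H_def)
    qed
  next
    case False
    then have pos: "G \<alpha> z > 0" using nonneg[OF \<alpha>] by simp
    have ne: "H \<noteq> {}" using mem[of 0] pos by auto
    have "Sup H = z + 2 * G \<alpha> z"
    proof (rule cSup_eq_non_empty[OF ne])
      show "\<And>t. t \<in> H \<Longrightarrow> t \<le> z + 2 * G \<alpha> z" using upper by blast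
      fix u assume u: "\<And>t. t \<in> H \<Longrightarrow> t \<le> u"
      have "G \<alpha> z \<le> (u - z) / 2"
      proof (rule dense_le_bounded[OF pos])
        fix y assume "0 < y" "y < G \<alpha> z"
        then show "y \<le> (u - z) / 2" using u[OF mem[of y]] by simp
      qed
      then show "z + 2 * G \<alpha> z \<le> u" by simp
    qed
    then show ?thesis using ne by (simp add: level_curve_def H_def)
  qed
  then show ?thesis unfolding F_def .
qed

text \<open>Polya-type argument: both functions decrease and g varies by at most \<eta> on a cell,
  so the grid values control everything in between. Beyond the grid g is 0 and f stays below its
  last grid value.\<close>

lemma uniform_from_grid:
  fixes f g :: "real \<Rightarrow> real"
  assumes f: "\<And>x y. 0 \<le> x \<Longrightarrow> x \<le> y \<Longrightarrow> f y \<le> f x" "\<And>x. 0 \<le> x \<Longrightarrow> 0 \<le> f x"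
    and g: "\<And>x y. 0 \<le> x \<Longrightarrow> x \<le> y \<Longrightarrow> g y \<le> g x" "\<And>x. 0 \<le> x \<Longrightarrow> 0 \<le> g x"
      "\<And>x y. 0 \<le> x \<Longrightarrow> x \<le> y \<Longrightarrow> g x \<le> g y + (y - x)"
    and g0: "g (real L * \<eta>) = 0" and eta: "\<eta> > 0"
    and grid: "\<And>i. i \<le> L \<Longrightarrow> \<bar>f (real i * \<eta>) - g (real i * \<eta>)\<bar> \<le> \<delta>" and x: "x \<ge> 0"
  shows "\<bar>f x - g x\<bar> \<le> \<delta> + \<eta>"
proof (cases "x < real L * \<eta>")
  case True
  define i where "i = nat \<lfloor>x / \<eta>\<rfloor>"
  have q: "0 \<le> x / \<eta>" using x eta by simp
  have "real i \<le> x / \<eta>" "x / \<eta> < real i + 1" using q by (auto simp: i_def)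
  then have i: "real i * \<eta> \<le> x" "x \<le> real (Suc i) * \<eta>" using eta by (auto simp: field_simps)
  have "real i * \<eta> < real L * \<eta>" using i True by linarith
  then have iL: "i \<le> L" "Suc i \<le> L" using eta by auto
  have i0: "0 \<le> real i * \<eta>" using eta by simp
  have s: "real (Suc i) * \<eta> - real i * \<eta> = \<eta>" by (simp add: algebra_simps)
  have "f x \<le> f (real i * \<eta>)" "g (real i * \<eta>) \<le> g x + (x - real i * \<eta>)"
    using f(1)[OF i0 i(1)] g(3)[OF i0 i(1)] .
  moreover have "f (real (Suc i) * \<eta>) \<le> f x" "g x \<le> g (real (Suc i) * \<eta>) + (real (Suc i) * \<eta> - x)"
    using f(1)[OF x i(2)] g(3)[OF x i(2)] .
  ultimately show ?thesis using grid[OF iL(1)] grid[OF iL(2)] i s by linarith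
next
  case False
  then have L: "real L * \<eta> \<le> x" and L0: "0 \<le> real L * \<eta>" using eta by auto
  have "g x = 0" using g(1)[OF L0 L] g(2)[OF x] g0 by linarith
  moreover have "f x \<le> f (real L * \<eta>)" "0 \<le> f x" using f(1)[OF L0 L] f(2)[OF x] .
  ultimately show ?thesis using grid[of L] g0 eta by linarith
qed

section \<open>Limit heights and their regularity\<close>

context shape_sequence
begin

definition steps :: "real \<Rightarrow> nat \<Rightarrow> nat" where "steps \<alpha> k = nat \<lfloor>\<alpha> * N k\<rfloor>"

lemma steps_bounds:
  assumes "0 < \<alpha>" shows "\<alpha> * N k - 1 \<le> real (steps \<alpha> k)" "real (steps \<alpha> k) \<le> \<alpha> * N k"
proof -
  have "0 \<le> \<alpha> * N k" using assms N1[of k] by simp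
  then show "\<alpha> * N k - 1 \<le> real (steps \<alpha> k)" "real (steps \<alpha> k) \<le> \<alpha> * N k"
    unfolding steps_def by linarith+
qed

lemma steps_le:
  assumes "0 < \<alpha>" "\<alpha> < 1" shows "steps \<alpha> k \<le> card (D k)"
proof -
  have "\<alpha> * N k \<le> 1 * N k" using assms N1[of k] by (intro mult_right_mono) auto
  then have "real (steps \<alpha> k) \<le> real (card (D k))" using steps_bounds(2)[OF assms(1), of k] by (simp add: N_def)
  then show ?thesis by simp
qed

lemma steps_lim:
  assumes "0 < \<alpha>" shows "(\<lambda>k. real (steps \<alpha> k) / N k) \<longlonglongrightarrow> \<alpha>"
proof (rule tendsto_sandwich)
  have "(\<lambda>k. \<alpha> - 2 * (1 / (2 * N k))) \<longlonglongrightarrow> \<alpha> - 2 * 0" by (intro tendsto_intros nu_lim)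
  then show "(\<lambda>k. \<alpha> - 1 / N k) \<longlonglongrightarrow> \<alpha>" by simp
  show "\<forall>\<^sub>F k in sequentially. \<alpha> - 1 / N k \<le> real (steps \<alpha> k) / N k"
  proof (intro always_eventually allI)
    fix k
    have "(\<alpha> * N k - 1) / N k \<le> real (steps \<alpha> k) / N k"
      using steps_bounds(1)[OF assms, of k] N1[of k] by (intro divide_right_mono) auto
    then show "\<alpha> - 1 / N k \<le> real (steps \<alpha> k) / N k" using N1[of k] by (simp add: diff_divide_distrib)
  qed
  show "\<forall>\<^sub>F k in sequentially. real (steps \<alpha> k) / N k \<le> \<alpha>"
  proof (intro always_eventually allI)
    fix k show "real (steps \<alpha> k) / N k \<le> \<alpha>"
      using steps_bounds(2)[OF assms, of k] N1[of k] by (simp add: divide_le_eq)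
  qed
qed simp

definition G :: "real \<Rightarrow> real \<Rightarrow> real" where
  "G \<alpha> z = (SOME x. converges (\<lambda>k T. diag_height k z (sublevel (steps \<alpha>) k T)) x)"

lemma G_converges:
  assumes "0 < \<alpha>" "\<alpha> < 1" "z \<ge> 0"
  shows "converges (\<lambda>k T. diag_height k z (sublevel (steps \<alpha>) k T)) (G \<alpha> z)"
  unfolding G_def
  by (rule someI_ex, rule diag_height_converges[OF steps_le[OF assms(1,2)] steps_lim[OF assms(1)] assms(3)])

lemma diag_height_nonneg: "0 \<le> diag_height k z E"
  unfolding diag_height_def using r1[of k] by simp

lemma diag_height_antimono:
  assumes "shape E" "z \<le> z'" shows "diag_height k z' E \<le> diag_height k z E"
proof -
  have "r k * z \<le> r k * z'" using assms r1[of k] by (intro mult_left_mono) auto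
  then have "nat \<lfloor>r k * z\<rfloor> \<le> nat \<lfloor>r k * z'\<rfloor>" by (intro nat_mono floor_mono)
  then show ?thesis unfolding diag_height_def using r1[of k] diag_count_antimono[OF assms(1)]
    by (intro divide_right_mono) auto
qed

lemma diag_height_lipschitz:
  assumes E: "shape E" and z: "0 \<le> z" "z \<le> z'"
  shows "diag_height k z E \<le> diag_height k z' E + (z' - z) + 2 * (1 / r k)"
proof -
  let ?c = "nat \<lfloor>r k * z\<rfloor>" and ?c' = "nat \<lfloor>r k * z'\<rfloor>"
  have "diag_height k z E - diag_height k z' E = (real (diag_count ?c E) - real (diag_count ?c' E)) / r k"
    by (simp add: diag_height_def diff_divide_distrib)
  also have "\<dots> \<le> \<bar>real ?c - real ?c'\<bar> / r k"
    using diag_count_dist[OF E, of ?c ?c'] r1[of k] by (intro divide_right_mono) linarith+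
  also have "\<dots> = \<bar>real ?c / r k - real ?c' / r k\<bar>"
    unfolding diff_divide_distrib[symmetric] using r1[of k] by simp
  finally show ?thesis using floor_bound[of z k] floor_bound[of z' k] z by linarith
qed

lemma G_nonneg: "0 < \<alpha> \<Longrightarrow> \<alpha> < 1 \<Longrightarrow> z \<ge> 0 \<Longrightarrow> 0 \<le> G \<alpha> z"
  by (rule converges_le[OF converges_const[of 0] G_converges])
     (assumption | intro always_eventually allI ballI diag_height_nonneg)+

lemma G_antimono:
  assumes "0 < \<alpha>" "\<alpha> < 1" "z \<ge> 0" "z \<le> z'" shows "G \<alpha> z' \<le> G \<alpha> z"
proof (rule converges_le)
  show "converges (\<lambda>k T. diag_height k z' (sublevel (steps \<alpha>) k T)) (G \<alpha> z')"
    "converges (\<lambda>k T. diag_height k z (sublevel (steps \<alpha>) k T)) (G \<alpha> z)"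
    using assms by (simp_all add: G_converges)
  show "\<forall>\<^sub>F k in sequentially. \<forall>T\<in>Om k. diag_height k z' (sublevel (steps \<alpha>) k T) \<le> diag_height k z (sublevel (steps \<alpha>) k T)"
    by (intro always_eventually allI ballI diag_height_antimono sublevel_sh assms)
qed

lemma G_lipschitz:
  assumes "0 < \<alpha>" "\<alpha> < 1" "z \<ge> 0" "z \<le> z'" shows "G \<alpha> z \<le> G \<alpha> z' + (z' - z)"
proof (rule converges_le)
  show "converges (\<lambda>k T. diag_height k z (sublevel (steps \<alpha>) k T)) (G \<alpha> z)" using assms by (intro G_converges)
  have "(\<lambda>k. (z' - z) + 2 * (1 / r k)) \<longlonglongrightarrow> (z' - z) + 2 * 0" by (intro tendsto_intros r_lim)
  then have "(\<lambda>k. (z' - z) + 2 * (1 / r k)) \<longlonglongrightarrow> z' - z" by simp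
  then show "converges (\<lambda>k T. diag_height k z' (sublevel (steps \<alpha>) k T) + ((z' - z) + 2 * (1 / r k))) (G \<alpha> z' + (z' - z))"
    using assms by (intro converges_add G_converges converges_det) auto
  show "\<forall>\<^sub>F k in sequentially. \<forall>T\<in>Om k. diag_height k z (sublevel (steps \<alpha>) k T) \<le>
      diag_height k z' (sublevel (steps \<alpha>) k T) + ((z' - z) + 2 * (1 / r k))"
    unfolding add.assoc[symmetric]
    by (intro always_eventually allI ballI diag_height_lipschitz sublevel_sh assms)
qed

lemma G_zero:
  assumes "0 < \<alpha>" "\<alpha> < 1" "z \<ge> C + 1" shows "G \<alpha> z = 0"
proof -
  have z: "z \<ge> 0" using assms C by simp
  have "diag_height k z (sublevel (steps \<alpha>) k T) = 0" for k T
  proof -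
    have "r k * (C + 1) \<le> r k * z" using assms r1[of k] by (intro mult_left_mono) auto
    then have "C * r k + r k \<le> r k * z" by (simp add: algebra_simps)
    then have "C * r k \<le> real (nat \<lfloor>r k * z\<rfloor>)" using r1[of k] by linarith
    then show ?thesis unfolding diag_height_def using count_zero[OF sublevel_sub] by simp
  qed
  then have "G \<alpha> z \<le> 0"
    using assms z by (intro converges_le[OF G_converges converges_const[of 0]]) auto
  then show ?thesis using G_nonneg[of \<alpha> z] assms z by simp
qed

lemma diag_height_mono:
  assumes "finite E'" "E \<subseteq> E'" shows "diag_height k z E \<le> diag_height k z E'"
  unfolding diag_height_def using diag_count_mono[OF assms] r1[of k] by (intro divide_right_mono) auto

lemma G_mono:
  assumes "0 < \<alpha>" "\<alpha> \<le> \<beta>" "\<beta> < 1" "z \<ge> 0" shows "G \<alpha> z \<le> G \<beta> z"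
proof -
  have sub: "sublevel (steps \<alpha>) k T \<subseteq> sublevel (steps \<beta>) k T" for k T
  proof -
    have "\<alpha> * N k \<le> \<beta> * N k" using assms N1[of k] by (intro mult_right_mono) auto
    then have "steps \<alpha> k \<le> steps \<beta> k" unfolding steps_def by (intro nat_mono floor_mono)
    then show ?thesis by (auto simp: sublevel_def)
  qed
  have finS: "finite (sublevel m k T)" for m k T by (rule finite_subset[OF sublevel_sub finD])
  show ?thesis
  proof (rule converges_le)
    show "converges (\<lambda>k T. diag_height k z (sublevel (steps \<alpha>) k T)) (G \<alpha> z)"
      "converges (\<lambda>k T. diag_height k z (sublevel (steps \<beta>) k T)) (G \<beta> z)"
      using assms by (simp_all add: G_converges)
    show "\<forall>\<^sub>F k in sequentially. \<forall>T\<in>Om k. diag_height k z (sublevel (steps \<alpha>) k T) \<le> diag_height k z (sublevel (steps \<beta>) k T)"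
      by (intro always_eventually allI ballI diag_height_mono finS sub)
  qed
qed

text \<open>A diagonal that gains d boxes forces at least d^2 / 2 new boxes in all. About (\<beta> -
  \<alpha>) N are available and the unit of length is sqrt (2 N), so the rescaled gain is at most
  sqrt (\<beta> - \<alpha>) in the limit.\<close>

lemma G_continuous:
  assumes "0 < \<alpha>" "\<alpha> \<le> \<beta>" "\<beta> < 1" "z \<ge> 0" shows "G \<beta> z \<le> G \<alpha> z + sqrt (\<beta> - \<alpha>)"
proof (rule converges_le)
  show "converges (\<lambda>k T. diag_height k z (sublevel (steps \<beta>) k T)) (G \<beta> z)" using assms by (intro G_converges) auto
  have "(\<lambda>k. sqrt (real (steps \<beta> k) / N k - real (steps \<alpha> k) / N k)) \<longlonglongrightarrow> sqrt (\<beta> - \<alpha>)"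
    using assms by (intro tendsto_real_sqrt tendsto_diff steps_lim) auto
  then show "converges (\<lambda>k T. diag_height k z (sublevel (steps \<alpha>) k T) +
      sqrt (real (steps \<beta> k) / N k - real (steps \<alpha> k) / N k)) (G \<alpha> z + sqrt (\<beta> - \<alpha>))"
    using assms by (intro converges_add G_converges converges_det) auto
  show "\<forall>\<^sub>F k in sequentially. \<forall>T\<in>Om k. diag_height k z (sublevel (steps \<beta>) k T) \<le>
      diag_height k z (sublevel (steps \<alpha>) k T) + sqrt (real (steps \<beta> k) / N k - real (steps \<alpha> k) / N k)"
  proof (intro always_eventually allI ballI)
    fix k T assume T: "T \<in> Om k"
    define E where "E = sublevel (steps \<alpha>) k T"
    define E' where "E' = sublevel (steps \<beta>) k T"
    define c where "c = nat \<lfloor>r k * z\<rfloor>"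
    have "\<alpha> * N k \<le> \<beta> * N k" using assms N1[of k] by (intro mult_right_mono) auto
    then have le: "steps \<alpha> k \<le> steps \<beta> k" unfolding steps_def by (intro nat_mono floor_mono)
    then have sub: "E \<subseteq> E'" by (auto simp: E_def E'_def sublevel_def)
    have shapes: "shape E" "shape E'" using sublevel_sh[OF T] by (auto simp: E_def E'_def)
    have cards: "card E = steps \<alpha> k" "card E' = steps \<beta> k"
      unfolding E_def E'_def sublevel_def using assms
      by (auto intro!: sublevel_card[OF finD T] steps_le)
    have mono: "diag_count c E \<le> diag_count c E'" using diag_count_mono[OF shape_finite[OF shapes(2)] sub] .
    have "(real (diag_count c E') - real (diag_count c E))\<^sup>2 \<le> 2 * (real (steps \<beta> k) - real (steps \<alpha> k))"
    proof -
      have "real ((diag_count c E' - diag_count c E)\<^sup>2) \<le> real (2 * (card E' - card E))"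
        using diag_count_growth[OF shapes(2,1) sub, of c] of_nat_le_iff by blast
      then show ?thesis using mono le cards by (simp add: of_nat_diff)
    qed
    then have "((real (diag_count c E') - real (diag_count c E)) / r k)\<^sup>2 \<le>
        2 * (real (steps \<beta> k) - real (steps \<alpha> k)) / (2 * N k)"
      unfolding power_divide power2_eq_square[of "r k"] r_sq using N1[of k] by (intro divide_right_mono) auto
    also have "\<dots> = real (steps \<beta> k) / N k - real (steps \<alpha> k) / N k"
      using N1[of k] by (simp add: diff_divide_distrib)
    finally have "(real (diag_count c E') - real (diag_count c E)) / r k \<le>
        sqrt (real (steps \<beta> k) / N k - real (steps \<alpha> k) / N k)"
      by (rule real_le_rsqrt)
    then show "diag_height k z (sublevel (steps \<beta>) k T) \<le>
        diag_height k z (sublevel (steps \<alpha>) k T) + sqrt (real (steps \<beta> k) / N k - real (steps \<alpha> k) / N k)"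
      unfolding diag_height_def E_def E'_def c_def by (simp add: diff_divide_distrib)
  qed
qed

lemma G_le_G1:
  assumes "0 < \<alpha>" "\<alpha> < 1" "z \<ge> 0" shows "G \<alpha> z \<le> G1 z"
proof (rule converges_le[OF G_converges[OF assms]])
  show "converges (\<lambda>k T. diag_height k z (D k)) (G1 z)"
    unfolding diag_height_def r_def by (intro converges_det lim1 assms)
  show "\<forall>\<^sub>F k in sequentially. \<forall>T\<in>Om k. diag_height k z (sublevel (steps \<alpha>) k T) \<le> diag_height k z (D k)"
    by (intro always_eventually allI ballI diag_height_mono finD sublevel_sub)
qed

text \<open>Union bound over finitely many grid points: off their exceptional events the heights are
  uniformly close, so an event excluded by closeness has vanishing probability.\<close>

lemma bad_prob:
  assumes \<alpha>: "0 < \<alpha>" "\<alpha> < 1" and d: "\<delta> > 0" and eta: "\<eta> > 0"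
    and bad: "\<forall>\<^sub>F k in sequentially. \<forall>T\<in>Om k.
      (\<forall>x\<ge>0. \<bar>diag_height k x (sublevel (steps \<alpha>) k T) - G \<alpha> x\<bar> \<le> \<delta> + \<eta>) \<longrightarrow> \<not> Q k T"
  shows "(\<lambda>k. real (card {T \<in> Om k. Q k T}) / real (card (Om k))) \<longlonglongrightarrow> 0"
proof -
  \<comment> \<open>The grid reaches C + 1, where the limit height vanishes; its size is independent
    of k.\<close>
  obtain L where L: "real L * \<eta> \<ge> C + 1" using real_arch_simple[of "(C + 1) / \<eta>"] eta by (auto simp: divide_le_eq)
  define A where "A i k = {T \<in> Om k. \<bar>diag_height k (real i * \<eta>) (sublevel (steps \<alpha>) k T) - G \<alpha> (real i * \<eta>)\<bar> > \<delta>}" for i k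
  have lim: "(\<lambda>k. real (card (A i k)) / real (card (Om k))) \<longlonglongrightarrow> 0" for i
    unfolding A_def by (rule converges_prob[OF G_converges[OF \<alpha>] d]) (use eta in simp)
  show ?thesis
  proof (rule tendsto_sandwich[OF _ _ tendsto_const])
    show "(\<lambda>k. \<Sum>i\<le>L. real (card (A i k)) / real (card (Om k))) \<longlonglongrightarrow> 0"
      using tendsto_sum[of "{..L}", OF lim] by simp
    show "\<forall>\<^sub>F k in sequentially. real (card {T \<in> Om k. Q k T}) / real (card (Om k)) \<le>
        (\<Sum>i\<le>L. real (card (A i k)) / real (card (Om k)))"
      using bad
    proof eventually_elim
      case (elim k)
      have "{T \<in> Om k. Q k T} \<subseteq> (\<Union>i\<le>L. A i k)"
      proof (rule subsetI, rule ccontr)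
        fix T assume T: "T \<in> {T \<in> Om k. Q k T}" and n: "T \<notin> (\<Union>i\<le>L. A i k)"
        have TO: "T \<in> Om k" using T by simp
        have "\<bar>diag_height k x (sublevel (steps \<alpha>) k T) - G \<alpha> x\<bar> \<le> \<delta> + \<eta>" if x: "x \<ge> 0" for x
        proof (rule uniform_from_grid[where L = L, OF _ _ _ _ _ _ eta _ x])
          show "G \<alpha> (real L * \<eta>) = 0" using G_zero[OF \<alpha> L] .
          fix i assume "i \<le> L"
          then show "\<bar>diag_height k (real i * \<eta>) (sublevel (steps \<alpha>) k T) - G \<alpha> (real i * \<eta>)\<bar> \<le> \<delta>"
            using n TO by (auto simp: A_def not_less)
        qed (use diag_height_antimono[OF sublevel_sh[OF TO]] diag_height_nonneg G_antimono[OF \<alpha>] G_nonneg[OF \<alpha>] G_lipschitz[OF \<alpha>] in auto)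
        then show False using elim T by blast
      qed
      then have "card {T \<in> Om k. Q k T} \<le> card (\<Union>i\<le>L. A i k)"
        using fin[of k] by (intro card_mono) (auto simp: A_def)
      also have "\<dots> \<le> (\<Sum>i\<le>L. card (A i k))" by (rule card_UN_le) simp
      finally have "real (card {T \<in> Om k. Q k T}) \<le> (\<Sum>i\<le>L. real (card (A i k)))"
        by (simp flip: of_nat_sum)
      then have "real (card {T \<in> Om k. Q k T}) / real (card (Om k)) \<le> (\<Sum>i\<le>L. real (card (A i k))) / real (card (Om k))"
        by (rule divide_right_mono) simp
      then show ?case by (simp add: sum_divide_distrib)
    qed
  qed simp
qed

end

section \<open>From heights back to profiles\<close>

lemma dilated_profile_estimate:
  assumes "ys \<in> strict_partitions n" "z \<ge> 0" "\<rho> > 0"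
  shows "\<bar>dilated_profile (1 / \<rho>) ys z - (z + 2 * (real (diag_count (nat \<lfloor>\<rho> * z\<rfloor>) (shifted_diagram ys)) / \<rho>))\<bar> \<le> 2 / \<rho>"
proof -
  define c where "c = real (diag_count (nat \<lfloor>\<rho> * z\<rfloor>) (shifted_diagram ys))"
  have "\<bar>profile ys (\<rho> * z) - (\<rho> * z + 2 * c)\<bar> \<le> 2"
    unfolding c_def using assms by (intro profile_estimate) auto
  then have "\<bar>profile ys (\<rho> * z) - (\<rho> * z + 2 * c)\<bar> / \<rho> \<le> 2 / \<rho>"
    using assms by (intro divide_right_mono) auto
  moreover have "dilated_profile (1 / \<rho>) ys z - (z + 2 * (c / \<rho>)) = (profile ys (\<rho> * z) - (\<rho> * z + 2 * c)) / \<rho>"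
    using assms by (simp add: dilated_profile_def diff_divide_distrib add_divide_distrib mult.commute)
  ultimately show ?thesis unfolding c_def using assms by simp
qed

lemma tableau_le_diagram:
  assumes "xs \<in> strict_partitions n" "T \<in> shifted_tableaux xs"
  shows "\<exists>m. tableau_le xs T s \<in> strict_partitions m"
    and "shifted_diagram (tableau_le xs T s) = {b \<in> shifted_diagram xs. real (T b) \<le> s}"
proof -
  have *: "(\<exists>m. tableau_le xs T s \<in> strict_partitions m) \<and>
      shifted_diagram (tableau_le xs T s) = {b \<in> shifted_diagram xs. real (T b) \<le> s}"
    unfolding tableau_le_def by (rule theI'[OF tableau_le_ex1[OF assms]])
  show "\<exists>m. tableau_le xs T s \<in> strict_partitions m" by (rule conjunct1[OF *])
  show "shifted_diagram (tableau_le xs T s) = {b \<in> shifted_diagram xs. real (T b) \<le> s}" by (rule conjunct2[OF *])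
qed

lemma box_content_nth_part:
  assumes "xs \<in> strict_partitions n" "b \<in> shifted_diagram xs"
  shows "box_content b + 1 \<le> nth_part xs 1"
proof -
  define xi where "xi = nth_part xs"
  have xi: "strict_seq xi" using strict_seq_nth_part[OF assms(1)] by (simp add: xi_def)
  obtain x y where b: "b = (x, y)" by (cases b)
  have xy: "y < x" "x \<le> y + xi y" using assms(2) unfolding strict_seq_nth_part(2)[OF assms(1)]
    by (auto simp: b seq_diagram_def xi_def)
  then have pos: "xi y > 0" by simp
  have "xi y \<le> xi 1" using strict_seq_gap[OF xi pos, of 1] strict_seq_pos[OF xi pos] by simp
  then show ?thesis using xy by (simp add: b box_content_def xi_def)
qed

theorem theorem1p1:
  fixes \<xi> :: "nat \<Rightarrow> nat list" and n :: "nat \<Rightarrow> nat" and \<Omega>\<^sub>1 :: "real \<Rightarrow> real" and C :: real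
  assumes "\<And>k. k \<ge> 1 \<Longrightarrow> n k > 0"
    and "filterlim n at_top sequentially"
    and "\<And>k. k \<ge> 1 \<Longrightarrow> \<xi> k \<in> strict_partitions (n k)"
    and "\<And>z. z \<ge> 0 \<Longrightarrow>
           (\<lambda>k. dilated_profile (1 / sqrt (2 * real (n k))) (\<xi> k) z) \<longlonglongrightarrow> \<Omega>\<^sub>1 z"
    and "C > 0"
    and "\<And>k. k \<ge> 1 \<Longrightarrow> real (nth_part (\<xi> k) 1) < C * sqrt (real (n k))"
  shows "\<exists>F \<in> limit_region \<Omega>\<^sub>1 \<rightarrow> {0..1}.
    \<forall>\<alpha> \<epsilon>. 0 < \<alpha> \<and> \<alpha> < 1 \<and> \<epsilon> > 0 \<longrightarrow>
      (\<lambda>k. measure_pmf.prob (pmf_of_set (shifted_tableaux (\<xi> k)))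
         {T. (SUP x\<in>{0..}. ereal
                \<bar>dilated_profile (1 / sqrt (2 * real (n k))) (tableau_le (\<xi> k) T (\<alpha> * real (n k))) x
                 - level_curve (limit_region \<Omega>\<^sub>1) F \<alpha> x\<bar>) > ereal \<epsilon>})
      \<longlonglongrightarrow> 0"
proof -
  \<comment> \<open>The hypotheses start at k = 1 while the locale covers every k, hence the shift
    to \<open>Suc k\<close>, undone at the end by \<open>LIMSEQ_imp_Suc\<close>.\<close>
  define D where "D k = shifted_diagram (\<xi> (Suc k))" for k
  \<comment> \<open>A profile value is z plus twice the height of the diagonal, up to a vanishing
    error.\<close>
  define G1 where "G1 z = (\<Omega>\<^sub>1 z - z) / 2" for z
  have part: "\<xi> (Suc k) \<in> strict_partitions (n (Suc k))" for k using assms(3) by simp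
  have cardD: "card (D k) = n (Suc k)" for k using card_shifted_diagram[OF part] by (simp add: D_def)
  have npos: "n (Suc k) > 0" for k using assms(1) by simp
  have nlim: "filterlim (\<lambda>k. n (Suc k)) at_top sequentially"
    by (rule filterlim_compose[OF assms(2) filterlim_Suc])
  have rlim: "(\<lambda>k. 1 / sqrt (2 * real (n (Suc k)))) \<longlonglongrightarrow> 0"
  proof -
    have "filterlim (\<lambda>k. real (n (Suc k))) at_top sequentially"
      by (rule filterlim_compose[OF filterlim_real_sequentially nlim])
    then have "filterlim (\<lambda>k. 2 * real (n (Suc k))) at_top sequentially"
      by (rule filterlim_tendsto_pos_mult_at_top[OF tendsto_const, rotated]) simp
    then have "filterlim (\<lambda>k. sqrt (2 * real (n (Suc k)))) at_top sequentially"
      by (rule filterlim_compose[OF sqrt_at_top])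
    from tendsto_inverse_0_at_top[OF this] show ?thesis by (simp add: inverse_eq_divide)
  qed
  interpret shape_sequence D "max C 1" G1
  proof
    fix k
    show "shape (D k)" unfolding D_def by (rule shape_shifted_diagram[OF part])
    show "D k \<noteq> {}" using cardD[of k] npos[of k] by auto
    show "max C 1 \<ge> 1" by simp
    show "filterlim (\<lambda>k. card (D k)) at_top sequentially" unfolding cardD by (rule nlim)
  next
    fix b k assume "b \<in> D k"
    then have "box_content b + 1 \<le> nth_part (\<xi> (Suc k)) 1" unfolding D_def by (rule box_content_nth_part[OF part])
    then have "real (box_content b) + 1 \<le> real (nth_part (\<xi> (Suc k)) 1)" by linarith
    also have "\<dots> \<le> C * sqrt (real (n (Suc k)))" using assms(6)[of "Suc k"] by simp
    also have "\<dots> \<le> max C 1 * sqrt (real (card (D k)))" unfolding cardD by (intro mult_right_mono) auto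
    finally show "real (box_content b) + 1 \<le> max C 1 * sqrt (real (card (D k)))" .
  next
    fix z :: real assume z: "z \<ge> 0"
    define f where "f k = real (diag_count (nat \<lfloor>sqrt (2 * real (card (D k))) * z\<rfloor>) (D k)) / sqrt (2 * real (card (D k)))" for k
    define p where "p k = dilated_profile (1 / sqrt (2 * real (n (Suc k)))) (\<xi> (Suc k)) z" for k
    have p: "p \<longlonglongrightarrow> \<Omega>\<^sub>1 z" unfolding p_def using LIMSEQ_Suc[OF assms(4)[OF z]] .
    have est: "\<bar>p k - (z + 2 * f k)\<bar> \<le> 2 * (1 / sqrt (2 * real (n (Suc k))))" for k
      using dilated_profile_estimate[OF part z, of "sqrt (2 * real (n (Suc k)))" k] npos[of k]
      by (simp add: p_def f_def cardD D_def[symmetric])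
    have "(\<lambda>k. p k - (z + 2 * f k)) \<longlonglongrightarrow> 0"
    proof (rule tendsto_rabs_zero_cancel, rule tendsto_sandwich[OF _ _ tendsto_const])
      show "\<forall>\<^sub>F k in sequentially. \<bar>p k - (z + 2 * f k)\<bar> \<le> 2 * (1 / sqrt (2 * real (n (Suc k))))"
        using est by (intro always_eventually allI)
      show "(\<lambda>k. 2 * (1 / sqrt (2 * real (n (Suc k))))) \<longlonglongrightarrow> 0" by (rule tendsto_mult_right_zero[OF rlim])
    qed simp
    \<comment> \<open>The height f k written through the profile p k and the vanishing
      error.\<close>
    then have "(\<lambda>k. (p k - (p k - (z + 2 * f k)) - z) / 2) \<longlonglongrightarrow> (\<Omega>\<^sub>1 z - 0 - z) / 2"
      by (intro tendsto_intros p) auto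
    then show "f \<longlonglongrightarrow> G1 z" by (simp add: G1_def)
  qed
  define F where "F = (\<lambda>(x, y). Inf (insert 1 {\<beta>. 0 < \<beta> \<and> \<beta> < 1 \<and> y < G \<beta> (x - y)}))"
  have F01: "F p \<in> {0..1}" for p
  proof -
    obtain x y where p: "p = (x, y)" by (cases p)
    have bdd: "bdd_below (insert 1 {\<beta>. 0 < \<beta> \<and> \<beta> < 1 \<and> y < G \<beta> (x - y)})"
      by (rule bdd_belowI[of _ 0]) auto
    have "0 \<le> F p" unfolding F_def p by (auto intro!: cInf_greatest)
    moreover have "F p \<le> 1" unfolding F_def p using bdd by (auto intro!: cInf_lower)
    ultimately show ?thesis by simp
  qed
  have level: "level_curve (limit_region \<Omega>\<^sub>1) F \<alpha> z = z + 2 * G \<alpha> z" if "0 < \<alpha>" "\<alpha> < 1" "z \<ge> 0" for \<alpha> z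
    unfolding F_def
  proof (rule level_curve_eq[OF _ _ _ _ that(3,1,2)])
    fix \<beta> :: real assume "0 < \<beta>" "\<beta> < 1"
    then show "z + 2 * G \<beta> z \<le> \<Omega>\<^sub>1 z" using G_le_G1[of \<beta> z] that by (simp add: G1_def)
  qed (use G_nonneg G_mono G_continuous that in auto)
  have "(\<lambda>k. measure_pmf.prob (pmf_of_set (shifted_tableaux (\<xi> k)))
         {T. (SUP x\<in>{0..}. ereal
                \<bar>dilated_profile (1 / sqrt (2 * real (n k))) (tableau_le (\<xi> k) T (\<alpha> * real (n k))) x
                 - level_curve (limit_region \<Omega>\<^sub>1) F \<alpha> x\<bar>) > ereal \<epsilon>})
      \<longlonglongrightarrow> 0" if \<alpha>: "0 < \<alpha>" "\<alpha> < 1" and eps: "\<epsilon> > 0" for \<alpha> \<epsilon> :: real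
  proof -
    define dev where "dev k T x = \<bar>dilated_profile (1 / sqrt (2 * real (n k))) (tableau_le (\<xi> k) T (\<alpha> * real (n k))) x
                 - level_curve (limit_region \<Omega>\<^sub>1) F \<alpha> x\<bar>" for k T x
    define Q where "Q k T \<longleftrightarrow> (SUP x\<in>{0..}. ereal (dev (Suc k) T x)) > ereal \<epsilon>" for k T
    have tab: "shifted_tableaux (\<xi> (Suc k)) = Om k" for k using shifted_tableaux_eq[OF part] by (simp add: D_def)
    have devle: "dev (Suc k) T x \<le> 2 * \<bar>diag_height k x (sublevel (steps \<alpha>) k T) - G \<alpha> x\<bar> + 2 / r k"
      if T: "T \<in> Om k" and x: "x \<ge> 0" for k T x
    proof -
      define ys where "ys = tableau_le (\<xi> (Suc k)) T (\<alpha> * real (n (Suc k)))"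
      have T': "T \<in> shifted_tableaux (\<xi> (Suc k))" using T tab by simp
      obtain l where l: "ys \<in> strict_partitions l" unfolding ys_def using tableau_le_diagram(1)[OF part T'] by blast
      have Nn: "N k = real (n (Suc k))" by (simp add: N_def cardD)
      \<comment> \<open>Entries are natural numbers, so the real bound \<alpha> N acts as its
        floor.\<close>
      have iff: "real (T b) \<le> \<alpha> * N k \<longleftrightarrow> T b \<le> steps \<alpha> k" for b
      proof
        assume "real (T b) \<le> \<alpha> * N k"
        then show "T b \<le> steps \<alpha> k" unfolding steps_def by (rule le_nat_floor)
      next
        assume "T b \<le> steps \<alpha> k"
        then have "real (T b) \<le> real (steps \<alpha> k)" by simp
        then show "real (T b) \<le> \<alpha> * N k" using steps_bounds(2)[OF \<alpha>(1), of k] by linarith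
      qed
      have dg: "shifted_diagram ys = sublevel (steps \<alpha>) k T"
        unfolding ys_def tableau_le_diagram(2)[OF part T'] sublevel_def Nn[symmetric] iff D_def[symmetric] ..
      have rr: "sqrt (2 * real (n (Suc k))) = r k" by (simp add: r_def cardD)
      have "\<bar>dilated_profile (1 / r k) ys x - (x + 2 * diag_height k x (sublevel (steps \<alpha>) k T))\<bar> \<le> 2 / r k"
        using dilated_profile_estimate[OF l x, of "r k"] r1[of k] unfolding dg diag_height_def by simp
      moreover have "\<bar>p - (x + 2 * g)\<bar> \<le> 2 * \<bar>h - g\<bar> + s" if "\<bar>p - (x + 2 * h)\<bar> \<le> s" for p h g s :: real
        using abs_le_D1[OF that] abs_le_D2[OF that] by (cases "g \<le> h"; simp add: abs_le_iff)
      ultimately show ?thesis unfolding dev_def ys_def[symmetric] rr level[OF \<alpha> x] by blast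
    qed
    \<comment> \<open>Error budget: heights within \<epsilon> / 4 count twice and use \<epsilon> /
      2, the term 2 / r uses the other half.\<close>
    have "\<forall>\<^sub>F k in sequentially. 1 / r k < \<epsilon> / 4" using order_tendstoD(2)[OF r_lim, of "\<epsilon> / 4"] eps by simp
    then have "\<forall>\<^sub>F k in sequentially. \<forall>T\<in>Om k.
      (\<forall>x\<ge>0. \<bar>diag_height k x (sublevel (steps \<alpha>) k T) - G \<alpha> x\<bar> \<le> \<epsilon> / 8 + \<epsilon> / 8) \<longrightarrow> \<not> Q k T"
    proof eventually_elim
      case (elim k)
      show ?case
      proof (intro ballI impI)
        fix T assume T: "T \<in> Om k" and h: "\<forall>x\<ge>0. \<bar>diag_height k x (sublevel (steps \<alpha>) k T) - G \<alpha> x\<bar> \<le> \<epsilon> / 8 + \<epsilon> / 8"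
        have "dev (Suc k) T x \<le> \<epsilon>" if x: "x \<ge> 0" for x
        proof -
          have "2 * \<bar>diag_height k x (sublevel (steps \<alpha>) k T) - G \<alpha> x\<bar> \<le> \<epsilon> / 2"
            using h[rule_format, OF x] by simp
          moreover have "2 / r k \<le> \<epsilon> / 2" using elim by simp
          ultimately have "2 * \<bar>diag_height k x (sublevel (steps \<alpha>) k T) - G \<alpha> x\<bar> + 2 / r k \<le> \<epsilon> / 2 + \<epsilon> / 2"
            by (rule add_mono)
          then show ?thesis using order_trans[OF devle[OF T x]] by simp
        qed
        \<comment> \<open>In \<open>ereal\<close> the supremum always exists, so the pointwise bound
          passes to it directly.\<close>
        then have "(SUP x\<in>{0..}. ereal (dev (Suc k) T x)) \<le> ereal \<epsilon>" by (intro SUP_least) auto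
        then show "\<not> Q k T" by (simp add: Q_def not_less)
      qed
    qed
    from bad_prob[OF \<alpha> _ _ this] eps
    have "(\<lambda>k. real (card {T \<in> Om k. Q k T}) / real (card (Om k))) \<longlonglongrightarrow> 0" by simp
    moreover have "measure_pmf.prob (pmf_of_set (shifted_tableaux (\<xi> (Suc k)))) {T. Q k T} =
        real (card {T \<in> Om k. Q k T}) / real (card (Om k))" for k
      unfolding tab measure_pmf_of_set[OF ne fin] by (simp add: Int_def)
    ultimately have "(\<lambda>k. measure_pmf.prob (pmf_of_set (shifted_tableaux (\<xi> (Suc k)))) {T. Q k T}) \<longlonglongrightarrow> 0" by simp
    then show ?thesis unfolding Q_def dev_def by (rule LIMSEQ_imp_Suc)
  qed
  then show ?thesis using F01 by (intro bexI[of _ F]) auto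
qed

end
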